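(* Let $X$ be a spectrally negative Lévy process with $X_0=0$, Laplace exponent $\psi$ and Gaussian coefficient $\sigma>0$, and let $T$ be an exponential random variable with parameter $\gamma>0$ independent of $X$. Let $S_T=\sup_{0\le s\le T}X_s$ and $I_T=\inf_{0\le s\le T}X_s$. Then for $a<0<b$, $$\mathbb{P}_0\{a<I_T,\ S_T<b\}=1-Z^{(\gamma)}(-a)+\bigl[Z^{(\gamma)}(b-a)-1\bigr]\frac{W^{(\gamma)}(-a)}{W^{(\gamma)}(b-a)}.$$
   Context: $X$ is a spectrally negative Lévy process (no positive jumps) with Laplace exponent (so $\mathbb{E}[e^{\lambda X_t}]=e^{t\psi(\lambda)}$) $$\psi(\lambda)=\mu\lambda+\frac{\sigma^2}{2}\lambda^2+\int_{(-\infty,0)}(e^{\lambda x}-1-\lambda x 1_{\{x>-1\}})\,\Pi(dx),$$ where $\mu\in\mathbb{R}$, $\sigma>0$, and $\Pi$ is concentrated on $(-\infty,0)$ with $\int_{-\infty}^0(1\wedge y^2)\,\Pi(dy)<\infty$. $\mathbb{P}_0$ is the law of the process started at $0$. $\Phi(q)=\sup\{\lambda\ge0:\psi(\lambda)=q\}$ is the right inverse of $\psi$. The $\gamma$-scale function $W^{(\gamma)}$ vanishes on $(-\infty,0)$, is continuous on $[0,\infty)$, and satisfies $\int_0^\infty e^{-\lambda x}W^{(\gamma)}(x)\,dx=\frac{1}{\psi(\lambda)-\gamma}$ for $\lambda>\Phi(\gamma)$. The second scale function is $Z^{(\gamma)}(x)=1+\gamma\int_0^xW^{(\gamma)}(y)\,dy$.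 *)

theory Defs
  imports "HOL-Probability.Probability"
begin

definition cadlag :: "(real \<Rightarrow> real) \<Rightarrow> bool" where
  "cadlag x \<longleftrightarrow>
     (\<forall>t\<ge>0. (x \<longlongrightarrow> x t) (at_right t)) \<and>
     (\<forall>t>0. \<exists>l. (x \<longlongrightarrow> l) (at_left t))"

text \<open>The time parameter is a real number; only nonnegative times are constrained.
  Measurability of functionals of the path, such as its running supremum, relies on every
  path being cadlag.\<close>

locale levy_process = prob_space M
  for M :: "'a measure" and X :: "real \<Rightarrow> 'a \<Rightarrow> real" +
  assumes random_variable_X: "0 \<le> t \<Longrightarrow> X t \<in> borel_measurable M"
    and start: "AE \<omega> in M. X 0 \<omega> = 0"
    and cadlag_paths: "\<omega> \<in> space M \<Longrightarrow> cadlag (\<lambda>t. X t \<omega>)"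
    and indep_increments:
      "0 \<le> u 0 \<Longrightarrow> (\<And>i. i < n \<Longrightarrow> u i \<le> u (Suc i)) \<Longrightarrow>
         indep_vars (\<lambda>_. borel) (\<lambda>i \<omega>. X (u (Suc i)) \<omega> - X (u i) \<omega>) {..<n::nat}"
    and stationary_increments:
      "0 \<le> s \<Longrightarrow> 0 \<le> h \<Longrightarrow>
         distr M borel (\<lambda>\<omega>. X (s + h) \<omega> - X s \<omega>) = distr M borel (X h)"

definition levy_measure_neg :: "real measure \<Rightarrow> bool" where
  "levy_measure_neg \<nu> \<longleftrightarrow>
     sets \<nu> = sets borel \<and> emeasure \<nu> {0..} = 0 \<and>
     (\<integral>\<^sup>+ y. ennreal (min 1 (y\<^sup>2)) \<partial>\<nu>) < \<infinity>"

definition laplace_exponent :: "real \<Rightarrow> real \<Rightarrow> real measure \<Rightarrow> real \<Rightarrow> real" where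
  "laplace_exponent \<mu> \<sigma> \<nu> \<theta> =
     \<mu> * \<theta> + \<sigma>\<^sup>2 / 2 * \<theta>\<^sup>2 +
     (LINT x:{..<0}|\<nu>. exp (\<theta> * x) - 1 - \<theta> * x * indicator {-1<..} x)"

locale spectrally_negative_levy_process = levy_process M X
  for M :: "'a measure" and X :: "real \<Rightarrow> 'a \<Rightarrow> real"
    and \<mu> \<sigma> :: real and \<nu> :: "real measure" +
  assumes levy_measure: "levy_measure_neg \<nu>"
    and no_positive_jumps: "AE \<omega> in M. \<forall>t>0. X t \<omega> \<le> Lim (at_left t) (\<lambda>s. X s \<omega>)"
    and exponential_moments:
      "0 \<le> t \<Longrightarrow> 0 \<le> \<theta> \<Longrightarrow>
         has_bochner_integral M (\<lambda>\<omega>. exp (\<theta> * X t \<omega>)) (exp (t * laplace_exponent \<mu> \<sigma> \<nu> \<theta>))"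

definition right_inverse :: "(real \<Rightarrow> real) \<Rightarrow> real \<Rightarrow> real" where
  "right_inverse \<psi> q = Sup {\<theta>. 0 \<le> \<theta> \<and> \<psi> \<theta> = q}"

text \<open>Continuity on the closed half-line and the Laplace transform determine the scale function
  uniquely.\<close>

definition is_scale_function :: "(real \<Rightarrow> real) \<Rightarrow> real \<Rightarrow> (real \<Rightarrow> real) \<Rightarrow> bool" where
  "is_scale_function \<psi> \<gamma> W \<longleftrightarrow>
     (\<forall>x<0. W x = 0) \<and>
     continuous_on {0..} W \<and>
     (\<forall>\<theta>>right_inverse \<psi> \<gamma>.
        has_bochner_integral lborel (\<lambda>x. indicator {0..} x * (exp (- \<theta> * x) * W x))
          (1 / (\<psi> \<theta> - \<gamma>)))"

definition second_scale_function :: "real \<Rightarrow> (real \<Rightarrow> real) \<Rightarrow> real \<Rightarrow> real" where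
  "second_scale_function \<gamma> W x = 1 + \<gamma> * (LINT y:{0..x}|lborel. W y)"

definition process_events :: "'a measure \<Rightarrow> (real \<Rightarrow> 'a \<Rightarrow> real) \<Rightarrow> 'a set set" where
  "process_events M X =
     sigma_sets (space M) {X t -` A \<inter> space M |t A. 0 \<le> t \<and> A \<in> sets borel}"

definition independent_of_process ::
    "'a measure \<Rightarrow> ('a \<Rightarrow> real) \<Rightarrow> (real \<Rightarrow> 'a \<Rightarrow> real) \<Rightarrow> bool" where
  "independent_of_process M T X \<longleftrightarrow>
     prob_space.indep_set M {T -` A \<inter> space M |A. A \<in> sets borel} (process_events M X)"

definition running_sup :: "(real \<Rightarrow> 'a \<Rightarrow> real) \<Rightarrow> real \<Rightarrow> 'a \<Rightarrow> real" where
  "running_sup X t \<omega> = (SUP s\<in>{0..t}. X s \<omega>)"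

definition running_inf :: "(real \<Rightarrow> 'a \<Rightarrow> real) \<Rightarrow> real \<Rightarrow> 'a \<Rightarrow> real" where
  "running_inf X t \<omega> = (INF s\<in>{0..t}. X s \<omega>)"

end

theory Submission
  imports Defs "HOL-Complex_Analysis.Complex_Analysis" "HOL-Real_Asymp.Real_Asymp"
begin

text \<open>
  Put x = -a and c = b - a, and let tau be the first time at which x + X leaves the interval (0, c).
  As T is exponential and independent of X, the probability in question is 1 - E exp(-gamma tau).
  Let V u be the integral of W over [0, u] and F = alpha W - gamma V, where alpha is chosen such that
  F c = 0. The right-hand side of the theorem is F x, so the task is to show
  F x = E (1 - exp(-gamma tau)).

  The reason is optional stopping. On Laplace transforms the generator L of X acts as multiplication
  by psi. The transform of F is (alpha - gamma / theta) / (psi theta - gamma), hence (L - gamma) F is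
  alpha times the unit mass at 0 minus gamma times the indicator of the positive half-line. On (0, c)
  this is the constant -gamma. At the exit time F vanishes: below 0 by
  definition, at 0 because W 0 = 0, and at c by the choice of alpha; the level c cannot be jumped over.
  Stopping exp(-gamma t) F (x + X_t) at tau therefore gives the claim. The same argument with F = W
  shows that W c = 0 would force W = 0 on (0, c), which the decay of the Laplace transform of W
  excludes; so the denominator is not 0.

  The proof carries this out with fixed times only, so that neither stopping times nor the unit mass at
  0 have to be handled. F is convolved with a continuous bump on [0, epsilon] and the interval is shrunk to
  [2 epsilon, c - epsilon]; then (L - gamma) F is a bounded continuous function which equals -gamma
  above epsilon. Dynkin's formula at a fixed time (dynkin_formula) holds because both of its sides are
  continuous in the starting point and have the same bilateral Laplace transform, and this transform is
  injective even if it is known for large real arguments only (bilaplace_zero_imp_AE_zero). The process is then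
  observed on a grid of mesh delta. A step down of size epsilon has probability o(1)
  (small_time_down). A step up of size epsilon has even an exponential moment of order o(delta)
  (small_time_up), because psi grows only quadratically; this is how the absence of
  positive jumps enters. A telescoping sum over the grid (grid_estimate) expresses F x, up to small
  errors, as the sum of the probabilities of survival up to the k-th grid point with the weights
  P(k delta < T <= (k + 1) delta), which is the probability of survival up to T (survive_sums).
  Letting delta and then epsilon tend to 0 gives confined_probability. Finally
  prob_extrema_in_interval identifies survival along dyadic times before T with the event of the
  theorem; the two events could differ only if the exit happens exactly at T, which is excluded by the
  lack of memory of T.
\<close>

section \<open>Bilateral Laplace transforms\<close>

text \<open>The integral extends over the whole line: the average of a function with support in the positive
  half-line over random translations no longer has such a support.\<close>
definition bilaplace :: "(real \<Rightarrow> real) \<Rightarrow> real \<Rightarrow> real" where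
  "bilaplace f \<theta> = (LINT x|lborel. exp (- \<theta> * x) * f x)"

text \<open>Averaging over random translations becomes multiplication, by Fubini's theorem. For Z = X t it
  describes the semigroup of the process, for Lebesgue measure and Z w = - w it is the convolution
  theorem, and on the product of time and probability space it describes the time-integrated
  semigroup.\<close>
lemma bilaplace_mixture:
  fixes Z g :: "'b \<Rightarrow> real" and f :: "real \<Rightarrow> real"
  assumes sf: "sigma_finite_measure N"
    and Z[measurable]: "Z \<in> borel_measurable N" and g[measurable]: "g \<in> borel_measurable N"
    and f[measurable]: "f \<in> borel_measurable borel"
    and Zg: "integrable N (\<lambda>w. exp (\<theta> * Z w) * g w)"
    and fi: "integrable lborel (\<lambda>x. exp (- \<theta> * x) * f x)"
  shows "integrable lborel (\<lambda>x. exp (- \<theta> * x) * (LINT w|N. f (x + Z w) * g w))" (is ?A)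
    and "bilaplace (\<lambda>x. LINT w|N. f (x + Z w) * g w) \<theta>
           = (LINT w|N. exp (\<theta> * Z w) * g w) * bilaplace f \<theta>" (is ?B)
proof -
  interpret N: sigma_finite_measure N by fact
  interpret P: pair_sigma_finite N lborel ..
  define H where "H w x = exp (- \<theta> * x) * (f (x + Z w) * g w)" for w x
  have H_meas: "(\<lambda>(w, x). H w x) \<in> borel_measurable (N \<Otimes>\<^sub>M lborel)"
    unfolding H_def by measurable
  have shift: "exp (- \<theta> * x) * f (x + z) = exp (\<theta> * z) * (exp (- \<theta> * (z + 1 * x)) * f (z + 1 * x))" for x z
  proof -
    have "exp (- \<theta> * x) = exp (\<theta> * z) * exp (- \<theta> * (z + 1 * x))"
      unfolding exp_add[symmetric] by (simp add: algebra_simps)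
    then show ?thesis by (simp add: add.commute)
  qed
  have shift_int: "integrable lborel (\<lambda>x. exp (- \<theta> * x) * f (x + z))" for z
    unfolding shift
    by (rule integrable_mult_right, rule lborel_integrable_real_affine[OF fi]) simp
  have shift_abs: "(LINT x|lborel. \<bar>exp (- \<theta> * x) * f (x + z)\<bar>) 
      = exp (\<theta> * z) * (LINT x|lborel. \<bar>exp (- \<theta> * x) * f x\<bar>)" for z
    unfolding shift abs_mult[of "exp (\<theta> * z)"] abs_exp_cancel
    by (subst lborel_integral_real_affine[of 1 "\<lambda>x. \<bar>exp (- \<theta> * x) * f x\<bar>" z]) (simp_all add: algebra_simps)
  have shift_val: "(LINT x|lborel. exp (- \<theta> * x) * f (x + z)) = exp (\<theta> * z) * bilaplace f \<theta>" for z
    unfolding shift bilaplace_def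
    by (subst lborel_integral_real_affine[of 1 "\<lambda>x. exp (- \<theta> * x) * f x" z]) (simp_all add: algebra_simps)
  have H_eq: "H w x = (exp (- \<theta> * x) * f (x + Z w)) * g w" for w x
    by (simp add: H_def)
  have H_norm: "(LINT x|lborel. norm (H w x)) = \<bar>exp (\<theta> * Z w) * g w\<bar> * (LINT x|lborel. \<bar>exp (- \<theta> * x) * f x\<bar>)" for w
    unfolding H_eq real_norm_def abs_mult[of _ "g w"] integral_mult_left_zero shift_abs
    by (simp add: algebra_simps)
  have Hint: "integrable (N \<Otimes>\<^sub>M lborel) (\<lambda>(w, x). H w x)"
  proof (rule P.Fubini_integrable[OF H_meas])
    show "integrable N (\<lambda>w. LINT x|lborel. norm (case (w, x) of (w, x) \<Rightarrow> H w x))"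
      unfolding prod.case H_norm by (intro integrable_mult_left integrable_abs Zg)
    show "AE w in N. integrable lborel (\<lambda>x. case (w, x) of (w, x) \<Rightarrow> H w x)"
      unfolding prod.case H_eq by (intro AE_I2 integrable_mult_left shift_int)
  qed
  have inner: "(LINT w|N. H w x) = exp (- \<theta> * x) * (LINT w|N. f (x + Z w) * g w)" for x
    unfolding H_def by simp
  show ?A
    using P.integrable_snd[OF Hint] by (simp add: inner)
  have "bilaplace (\<lambda>x. LINT w|N. f (x + Z w) * g w) \<theta> = (LINT x|lborel. LINT w|N. H w x)"
    unfolding bilaplace_def inner ..
  also have "\<dots> = (LINT w|N. LINT x|lborel. H w x)"
    by (rule P.Fubini_integral[OF Hint])
  also have "\<dots> = (LINT w|N. exp (\<theta> * Z w) * g w * bilaplace f \<theta>)"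
  proof (rule Bochner_Integration.integral_cong[OF refl])
    show "(LINT x|lborel. H w x) = exp (\<theta> * Z w) * g w * bilaplace f \<theta>" for w
      unfolding H_eq integral_mult_left_zero shift_val by (simp add: mult_ac)
  qed
  finally show ?B by (simp only: integral_mult_left_zero)
qed

text \<open>Frequency 0 shows that the positive and the negative part have equal mass. Divided by this mass
  they are densities of distributions with the same characteristic function.\<close>
lemma AE_zero_if_fourier_zero:
  fixes p :: "real \<Rightarrow> real"
  assumes p: "integrable lborel p"
    and zero: "\<And>t. (CLINT x|lborel. iexp (t * x) * p x) = 0"
  shows "AE x in lborel. p x = 0"
proof -
  define pp pm where "pp x = max 0 (p x)" and "pm x = max 0 (- p x)" for x
  have [measurable]: "p \<in> borel_measurable borel" using p by auto
  have ip: "integrable lborel pp" "integrable lborel pm" unfolding pp_def pm_def using p by auto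
  have p_eq: "p x = pp x - pm x" for x by (simp add: pp_def pm_def)
  have [measurable]: "pp \<in> borel_measurable borel" "pm \<in> borel_measurable borel"
    unfolding pp_def pm_def by measurable
  have ici: "integrable lborel (\<lambda>x. iexp (t * x) * complex_of_real (q x))" if "integrable lborel q" for q t
  proof (rule Bochner_Integration.integrable_bound[OF that])
    show "(\<lambda>x. iexp (t * x) * complex_of_real (q x)) \<in> borel_measurable lborel"
      using that by auto
  qed (simp add: norm_mult)
  have eq: "(CLINT x|lborel. iexp (t * x) * pp x) = (CLINT x|lborel. iexp (t * x) * pm x)" for t
  proof -
    have "(CLINT x|lborel. iexp (t * x) * p x) = (CLINT x|lborel. iexp (t * x) * pp x - iexp (t * x) * pm x)"
      by (intro Bochner_Integration.integral_cong) (simp_all add: p_eq algebra_simps)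
    also have "\<dots> = (CLINT x|lborel. iexp (t * x) * pp x) - (CLINT x|lborel. iexp (t * x) * pm x)"
      by (intro Bochner_Integration.integral_diff ici ip)
    finally show ?thesis using zero[of t] by simp
  qed
  define m where "m = (LINT x|lborel. pp x)"
  have m2: "(LINT x|lborel. pm x) = m"
  proof -
    have "complex_of_real (LINT x|lborel. pp x) = complex_of_real (LINT x|lborel. pm x)"
      using eq[of 0] by simp
    then show ?thesis by (simp only: of_real_eq_iff m_def)
  qed
  have nn: "0 \<le> pp x" "0 \<le> pm x" for x by (auto simp: pp_def pm_def)
  have "m \<ge> 0" unfolding m_def by (intro integral_nonneg_AE) (auto simp: nn)
  show ?thesis
  proof (cases "m = 0")
    case True
    have "AE x in lborel. pp x = 0"
      using integral_nonneg_eq_0_iff_AE[OF ip(1)] nn True m_def by auto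
    moreover have "AE x in lborel. pm x = 0"
      using integral_nonneg_eq_0_iff_AE[OF ip(2)] nn True m2 by auto
    ultimately show ?thesis by eventually_elim (simp add: p_eq)
  next
    case False
    then have m: "m > 0" using \<open>m \<ge> 0\<close> by simp
    define D where "D q = density lborel (\<lambda>x. ennreal (q x / m))" for q :: "real \<Rightarrow> real"
    have rd: "real_distribution (D q)" if q: "integrable lborel q" "\<And>x. 0 \<le> q x" "(LINT x|lborel. q x) = m" for q
    proof -
      have "prob_space (D q)"
      proof (rule prob_spaceI)
        have [measurable]: "q \<in> borel_measurable borel" using q(1) by auto
        have "emeasure (D q) (space (D q)) = (\<integral>\<^sup>+x. ennreal (q x / m) \<partial>lborel)"
          unfolding D_def by (subst emeasure_density) auto
        also have "\<dots> = ennreal (LINT x|lborel. q x / m)"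
          using q m by (intro nn_integral_eq_integral) auto
        also have "\<dots> = 1" using q m by simp
        finally show "emeasure (D q) (space (D q)) = 1" .
      qed
      then show ?thesis
        by (intro real_distribution.intro real_distribution_axioms.intro) (auto simp: D_def)
    qed
    have chD: "char (D q) t = (CLINT x|lborel. iexp (t * x) * q x) / m"
      if q: "integrable lborel q" "\<And>x. 0 \<le> q x" for q t
    proof -
      have [measurable]: "q \<in> borel_measurable borel" using q(1) by auto
      have "char (D q) t = (CLINT x|lborel. (q x / m) *\<^sub>R iexp (t * x))"
        unfolding char_def D_def using q m by (subst integral_density) auto
      also have "\<dots> = (CLINT x|lborel. (iexp (t * x) * q x) / m)"
        by (intro Bochner_Integration.integral_cong) (auto simp: scaleR_conv_of_real)
      finally show ?thesis by simp
    qed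
    have "D pp = D pm"
    proof (rule Levy_uniqueness)
      show "real_distribution (D pp)" "real_distribution (D pm)"
        using rd[OF ip(1) nn(1)] rd[OF ip(2) nn(2)] m_def m2 by auto
      show "char (D pp) = char (D pm)"
        using chD[OF ip(1) nn(1)] chD[OF ip(2) nn(2)] eq by (auto simp: fun_eq_iff)
    qed
    then have "AE x in lborel. ennreal (pp x / m) = ennreal (pm x / m)"
      unfolding D_def by (intro sigma_finite_measure.density_unique[OF lborel.sigma_finite_measure_axioms]) auto
    then show ?thesis
    proof eventually_elim
      case (elim x)
      then have "pp x / m = pm x / m" using nn m by (subst (asm) ennreal_inj) auto
      then show ?case using m by (simp add: p_eq)
    qed
  qed
qed

text \<open>About a real point \<open>z0\<close> the transform is a power series whose disc of convergence reaches to the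
  line through \<open>\<theta>\<^sub>0\<close>. As \<open>z0\<close> may lie arbitrarily far to the right, such a disc contains any given
  point of the half-plane, and it also contains a real segment on which the transform vanishes.\<close>
lemma complex_bilaplace_zero:
  fixes h :: "real \<Rightarrow> real" and z :: complex
  assumes int: "\<And>\<theta>. \<theta> > \<theta>\<^sub>0 \<Longrightarrow> integrable lborel (\<lambda>x. exp (- \<theta> * x) * h x)"
    and zero: "\<And>\<theta>. \<theta> > \<theta>\<^sub>0 \<Longrightarrow> bilaplace h \<theta> = 0"
    and z: "Re z > \<theta>\<^sub>0"
  shows "(CLINT x|lborel. exp (- z * x) * h x) = 0"
proof -
  define d where "d = Re z - \<theta>\<^sub>0"
  \<comment> \<open>The disc of radius r about z0 touches the line through \<open>\<theta>\<^sub>0\<close>; it contains z as soon as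
    2 d r exceeds the square of the distance of z from \<open>\<theta>\<^sub>0\<close>.\<close>
  define r where "r = (d\<^sup>2 + (Im z)\<^sup>2) / d"
  define z0 where "z0 = \<theta>\<^sub>0 + r"
  have d: "d > 0" using z by (simp add: d_def)
  have r: "r > 0" using d by (auto simp: r_def intro!: divide_pos_pos add_pos_nonneg)
  define f where "f w = (CLINT x|lborel. exp (- w * x) * h x)" for w :: complex
  define a where "a n = (CLINT x|lborel. (- complex_of_real x) ^ n / fact n * complex_of_real (exp (- z0 * x) * h x))" for n
  have [measurable]: "h \<in> borel_measurable borel"
  proof -
    have "(\<lambda>x. exp (- (\<theta>\<^sub>0+1) * x) * h x) \<in> borel_measurable lborel" using int[of "\<theta>\<^sub>0 + 1"] by auto
    then have "(\<lambda>x. exp ((\<theta>\<^sub>0+1) * x) * (exp (- (\<theta>\<^sub>0+1) * x) * h x)) \<in> borel_measurable lborel" by measurable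
    moreover have "(\<lambda>x. exp ((\<theta>\<^sub>0+1) * x) * (exp (- (\<theta>\<^sub>0+1) * x) * h x)) = h"
      by (simp only: mult.assoc[symmetric] exp_add[symmetric]) (simp add: fun_eq_iff algebra_simps)
    ultimately show ?thesis by simp
  qed
  have series: "(\<lambda>n. a n * (w - z0) ^ n) sums f w" if w: "w \<in> ball (complex_of_real z0) r" for w
  proof -
    define v where "v = w - z0"
    have v: "norm v < r" using w by (simp add: v_def dist_norm norm_minus_commute)
    define g where "g n x = (- complex_of_real x * v) ^ n / fact n * complex_of_real (exp (- z0 * x) * h x)" for n x
    define B where "B x = exp (norm v * \<bar>x\<bar>) * \<bar>exp (- z0 * x) * h x\<bar>" for x
    have B_int: "integrable lborel B"
    proof (rule Bochner_Integration.integrable_bound)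
      show "integrable lborel (\<lambda>x. \<bar>exp (- (z0 - norm v) * x) * h x\<bar> + \<bar>exp (- (z0 + norm v) * x) * h x\<bar>)"
        using v r by (intro Bochner_Integration.integrable_add integrable_abs int) (auto simp: z0_def intro: add_pos_nonneg)
      show "B \<in> borel_measurable lborel" unfolding B_def by measurable
      have "B x \<le> \<bar>exp (- (z0 - norm v) * x) * h x\<bar> + \<bar>exp (- (z0 + norm v) * x) * h x\<bar>" for x
      proof -
        have "exp (norm v * \<bar>x\<bar>) * exp (- z0 * x) \<le> exp (- (z0 - norm v) * x) + exp (- (z0 + norm v) * x)"
          by (cases "x \<ge> 0") (auto simp: exp_add[symmetric] algebra_simps add_increasing add_increasing2)
        then have "exp (norm v * \<bar>x\<bar>) * exp (- z0 * x) * \<bar>h x\<bar> \<le> (exp (- (z0 - norm v) * x) + exp (- (z0 + norm v) * x)) * \<bar>h x\<bar>"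
          by (intro mult_right_mono) auto
        then show ?thesis by (simp add: B_def abs_mult algebra_simps)
      qed
      moreover have "B x \<ge> 0" for x by (simp add: B_def)
      ultimately show "AE x in lborel. norm (B x) \<le> norm (\<bar>exp (- (z0 - norm v) * x) * h x\<bar> + \<bar>exp (- (z0 + norm v) * x) * h x\<bar>)"
        by (intro AE_I2) (auto intro: order.trans)
    qed
    have ng: "norm (g n x) = (norm v * \<bar>x\<bar>) ^ n /\<^sub>R fact n * \<bar>exp (- z0 * x) * h x\<bar>" for n x
      by (simp add: g_def norm_mult norm_divide norm_power power_mult_distrib divide_inverse abs_mult norm_inverse mult_ac flip: of_real_mult)
    have sumng: "(\<lambda>n. norm (g n x)) sums B x" for x
      unfolding ng B_def by (intro sums_mult2 exp_converges)
    have g_le: "norm (g n x) \<le> B x" for n x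
      using sum_le_suminf[OF sums_summable[OF sumng[of x]], of "{n}"] sums_unique[OF sumng[of x]] by simp
    have gsums: "g n x = (- complex_of_real x * v) ^ n /\<^sub>R fact n * complex_of_real (exp (- z0 * x) * h x)" for n x
      by (simp add: g_def scaleR_conv_of_real divide_inverse mult_ac)
    have sumg: "(\<lambda>n. g n x) sums (exp (- w * x) * h x)" for x
    proof -
      have "(\<lambda>n. g n x) sums (exp (- complex_of_real x * v) * complex_of_real (exp (- z0 * x) * h x))"
        unfolding gsums by (intro sums_mult2 exp_converges)
      also have "exp (- complex_of_real x * v) * complex_of_real (exp (- z0 * x) * h x)
          = exp (- complex_of_real x * v) * exp (complex_of_real (- z0 * x)) * h x"
        by (simp only: exp_of_real[symmetric] of_real_mult mult.assoc)
      also have "\<dots> = exp (- w * x) * h x"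
        by (simp add: v_def exp_add[symmetric] algebra_simps)
      finally show ?thesis .
    qed
    have gi: "integrable lborel (g n)" for n
    proof (rule Bochner_Integration.integrable_bound[OF B_int])
      show "g n \<in> borel_measurable lborel" unfolding g_def by measurable
      show "AE x in lborel. norm (g n x) \<le> norm (B x)" using order.trans[OF g_le abs_ge_self] by simp
    qed
    have "(\<lambda>n. integral\<^sup>L lborel (g n)) sums (LINT x|lborel. (\<Sum>n. g n x))"
    proof (rule sums_integral[OF gi])
      show "AE x in lborel. summable (\<lambda>n. norm (g n x))" using sumng by (auto intro: sums_summable)
      show "summable (\<lambda>n. LINT x|lborel. norm (g n x))"
      proof (rule summableI_nonneg_bounded[where x="integral\<^sup>L lborel B"])
        fix n
        show "0 \<le> (LINT x|lborel. norm (g n x))" by simp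
        have "(\<Sum>i<n. LINT x|lborel. norm (g i x)) = (LINT x|lborel. (\<Sum>i<n. norm (g i x)))"
          by (subst Bochner_Integration.integral_sum) (auto intro: integrable_norm gi)
        also have "\<dots> \<le> integral\<^sup>L lborel B"
        proof (intro integral_mono B_int Bochner_Integration.integrable_sum integrable_norm gi)
          fix x show "(\<Sum>i<n. norm (g i x)) \<le> B x"
            using sum_le_suminf[OF sums_summable[OF sumng[of x]], of "{..<n}"] sums_unique[OF sumng[of x]] by simp
        qed
        finally show "(\<Sum>i<n. LINT x|lborel. norm (g i x)) \<le> integral\<^sup>L lborel B" .
      qed
    qed
    moreover have "(LINT x|lborel. (\<Sum>n. g n x)) = f w"
      unfolding f_def by (intro Bochner_Integration.integral_cong) (auto simp: sums_unique[OF sumg, symmetric])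
    moreover have "integral\<^sup>L lborel (g n) = a n * v ^ n" for n
    proof -
      have "integral\<^sup>L lborel (g n) = (CLINT x|lborel. ((- complex_of_real x) ^ n / fact n * complex_of_real (exp (- z0 * x) * h x)) * v ^ n)"
        by (intro Bochner_Integration.integral_cong refl) (simp only: g_def power_mult_distrib divide_inverse mult.assoc mult.commute mult.left_commute)
      then show ?thesis by (simp add: a_def)
    qed
    ultimately show ?thesis by (simp add: v_def)
  qed
  define U where "U = complex_of_real ` {z0 - r <..< z0 + r}"
  have "f z = 0"
  proof (rule analytic_continuation[of f "ball (complex_of_real z0) r" U "complex_of_real z0" z])
    show "f holomorphic_on ball (complex_of_real z0) r"
      by (rule power_series_holomorphic[OF series])
    show "U \<subseteq> ball (complex_of_real z0) r"
      by (auto simp: U_def dist_of_real dist_real_def)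
    show "complex_of_real z0 \<in> ball (complex_of_real z0) r" using r by simp
    show "complex_of_real z0 islimpt U"
      unfolding islimpt_approachable
    proof (intro allI impI)
      fix e :: real assume e: "0 < e"
      define y where "y = z0 + min e r / 2"
      have "y \<in> {z0 - r <..< z0 + r}" "y \<noteq> z0" "\<bar>y - z0\<bar> < e" using e r by (auto simp: y_def min_def)
      then show "\<exists>x'\<in>U. x' \<noteq> complex_of_real z0 \<and> dist x' (complex_of_real z0) < e"
        by (intro bexI[of _ "complex_of_real y"]) (auto simp: U_def dist_of_real dist_real_def)
    qed
    show "f w = 0" if "w \<in> U" for w
    proof -
      from that obtain y where y: "w = complex_of_real y" "y > \<theta>\<^sub>0" by (auto simp: U_def z0_def)
      have "f w = (CLINT x|lborel. complex_of_real (exp (- y * x) * h x))"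
        unfolding f_def y by (intro Bochner_Integration.integral_cong) (auto simp: exp_of_real[symmetric])
      also have "\<dots> = complex_of_real (bilaplace h y)" unfolding bilaplace_def by (rule integral_of_real[OF int[OF y(2)]])
      finally show ?thesis using zero[OF y(2)] by simp
    qed
    show "z \<in> ball (complex_of_real z0) r"
    proof -
      have dr: "d * r = d\<^sup>2 + (Im z)\<^sup>2" using d by (simp add: r_def)
      have "d\<^sup>2 + (Im z)\<^sup>2 > 0" using d by (intro add_pos_nonneg) auto
      then have "(r - d)\<^sup>2 + (Im z)\<^sup>2 < r\<^sup>2" using dr by (simp add: power2_eq_square algebra_simps)
      then have "sqrt ((r - d)\<^sup>2 + (Im z)\<^sup>2) < r" using r by (intro real_less_lsqrt) auto
      then show ?thesis by (simp add: dist_norm cmod_def z0_def d_def algebra_simps)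
    qed
  qed auto
  then show ?thesis by (simp add: f_def)
qed

text \<open>On a vertical line in the half-plane of convergence the transform is a Fourier transform.\<close>
lemma bilaplace_zero_imp_AE_zero:
  fixes h :: "real \<Rightarrow> real"
  assumes int: "\<And>\<theta>. \<theta> > \<theta>\<^sub>0 \<Longrightarrow> integrable lborel (\<lambda>x. exp (- \<theta> * x) * h x)"
    and zero: "\<And>\<theta>. \<theta> > \<theta>\<^sub>0 \<Longrightarrow> bilaplace h \<theta> = 0"
  shows "AE x in lborel. h x = 0"
proof -
  define \<theta> where "\<theta> = \<theta>\<^sub>0 + 1"
  have "AE x in lborel. exp (- \<theta> * x) * h x = 0"
  proof (rule AE_zero_if_fourier_zero)
    show "integrable lborel (\<lambda>x. exp (- \<theta> * x) * h x)" by (rule int) (simp add: \<theta>_def)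
    fix t :: real
    have "(CLINT x|lborel. iexp (t * x) * complex_of_real (exp (- \<theta> * x) * h x))
        = (CLINT x|lborel. exp (- Complex \<theta> (- t) * x) * h x)"
    proof (intro Bochner_Integration.integral_cong refl)
      fix x :: real
      have "- Complex \<theta> (- t) * x = \<i> * complex_of_real (t * x) + complex_of_real (- \<theta> * x)"
        by (simp add: complex_eq_iff)
      then have "exp (- Complex \<theta> (- t) * x) = iexp (t * x) * complex_of_real (exp (- \<theta> * x))"
        by (simp only: exp_add exp_of_real)
      then show "iexp (t * x) * complex_of_real (exp (- \<theta> * x) * h x) = exp (- Complex \<theta> (- t) * x) * h x"
        by (simp only: of_real_mult mult.assoc)
    qed
    also have "\<dots> = 0" by (rule complex_bilaplace_zero[OF int zero]) (auto simp: \<theta>_def)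
    finally show "(CLINT x|lborel. iexp (t * x) * complex_of_real (exp (- \<theta> * x) * h x)) = 0" .
  qed
  then show ?thesis by auto
qed

lemma continuous_AE_zero:
  fixes h :: "real \<Rightarrow> real"
  assumes c: "continuous_on UNIV h" and ae: "AE x in lborel. h x = 0"
  shows "h x = 0"
proof (rule ccontr)
  assume "h x \<noteq> 0"
  let ?S = "{x. h x \<noteq> 0}"
  have "open ?S"
    using c by (intro open_Collect_neq) auto
  moreover have "?S \<in> null_sets lborel"
    using ae AE_iff_null_sets[of ?S lborel] \<open>open ?S\<close> by auto
  then have "negligible ?S"
    by (auto simp: negligible_iff_null_sets intro: null_sets_completionI)
  ultimately show False using open_not_negligible[of ?S] \<open>h x \<noteq> 0\<close> by blast
qed

lemma exp_integral_Icc: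
  fixes c t :: real
  assumes c: "c \<noteq> 0" and t: "0 \<le> t"
  shows "integrable lborel (\<lambda>s. exp (c * s) * indicator {0..t} s)"
    and "(LINT s|lborel. exp (c * s) * indicator {0..t} s) = (exp (c * t) - 1) / c"
proof -
  have "has_bochner_integral lborel (\<lambda>s. exp (c * s) * indicator {0..t} s) (exp (c * t) / c - exp (c * 0) / c)"
    using t c by (intro has_bochner_integral_FTC_Icc_real) 
       (auto intro!: derivative_eq_intros continuous_intros)
  then show "integrable lborel (\<lambda>s. exp (c * s) * indicator {0..t} s)"
    and "(LINT s|lborel. exp (c * s) * indicator {0..t} s) = (exp (c * t) - 1) / c"
    by (auto simp: has_bochner_integral_iff diff_divide_distrib)
qed

lemma exp_integral_atLeast:
  fixes c :: real
  assumes c: "c > 0"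
  shows "integrable lborel (\<lambda>s. exp (- c * s) * indicator {0..} s)"
    and "(LINT s|lborel. exp (- c * s) * indicator {0..} s) = 1 / c"
proof -
  have "(\<integral>\<^sup>+s. ennreal (exp (- c * s)) * indicator {0..} s \<partial>lborel) = ennreal (0 - (- exp (- c * 0) / c))"
  proof (rule nn_integral_FTC_atLeast)
    show "((\<lambda>s. - exp (- c * s) / c) \<longlongrightarrow> 0) at_top" using c by real_asymp
  qed (use c in \<open>auto intro!: derivative_eq_intros\<close>)
  then have "has_bochner_integral lborel (\<lambda>s. exp (- c * s) * indicator {0..} s) (1 / c)"
    using c by (intro has_bochner_integral_nn_integral) (auto simp: ennreal_mult' ennreal_indicator)
  then show "integrable lborel (\<lambda>s. exp (- c * s) * indicator {0..} s)"
    and "(LINT s|lborel. exp (- c * s) * indicator {0..} s) = 1 / c"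
    by (auto simp: has_bochner_integral_iff)
qed

text \<open>Applied both to the tail of a function and to a scale function that is supposed to vanish on an
  initial interval; in the second case the exponential decay contradicts the quadratic growth of the
  Laplace exponent.\<close>
lemma bilaplace_decay:
  assumes int: "integrable lborel (\<lambda>x. exp (- \<theta>\<^sub>0 * x) * f x)"
    and f: "\<And>x. x < c \<Longrightarrow> f x = 0" and th: "\<theta>\<^sub>0 \<le> \<theta>"
  shows "\<bar>bilaplace f \<theta>\<bar> \<le> exp (- (\<theta> - \<theta>\<^sub>0) * c) * (LINT x|lborel. \<bar>exp (- \<theta>\<^sub>0 * x) * f x\<bar>)"
proof -
  let ?f = "\<lambda>x. exp (- \<theta>\<^sub>0 * x) * f x"
  have bd: "\<bar>exp (- \<theta> * x) * f x\<bar> \<le> exp (- (\<theta> - \<theta>\<^sub>0) * c) * \<bar>?f x\<bar>" for x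
  proof (cases "x < c")
    case False
    have "exp (- \<theta> * x) = exp (- (\<theta> - \<theta>\<^sub>0) * x) * exp (- \<theta>\<^sub>0 * x)"
      by (simp add: exp_add[symmetric] algebra_simps)
    also have "\<dots> \<le> exp (- (\<theta> - \<theta>\<^sub>0) * c) * exp (- \<theta>\<^sub>0 * x)"
      using False th by (intro mult_right_mono) (auto simp: mult_left_mono_neg)
    finally have "exp (- \<theta> * x) * \<bar>f x\<bar> \<le> exp (- (\<theta> - \<theta>\<^sub>0) * c) * exp (- \<theta>\<^sub>0 * x) * \<bar>f x\<bar>"
      by (rule mult_right_mono) simp
    then show ?thesis by (simp only: abs_mult abs_exp_cancel mult.assoc)
  qed (simp add: f)
  have "\<bar>bilaplace f \<theta>\<bar> \<le> (LINT x|lborel. \<bar>exp (- \<theta> * x) * f x\<bar>)"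
    unfolding bilaplace_def using integral_norm_bound[of lborel "\<lambda>x. exp (- \<theta> * x) * f x"] by simp
  also have "\<dots> \<le> (LINT x|lborel. exp (- (\<theta> - \<theta>\<^sub>0) * c) * \<bar>?f x\<bar>)"
    using bd by (intro integral_mono_AE' integrable_mult_right integrable_abs int) auto
  finally show ?thesis by simp
qed

text \<open>If \<open>f 0\<close> were not 0, an interval \<open>[0, d]\<close> on which f stays away from 0 would contribute at least a
  multiple of \<open>1 / \<theta>\<close> to the transform, whereas the contribution of the rest decays exponentially.\<close>
lemma tendsto_bilaplace_zero_initial:
  assumes int: "integrable lborel (\<lambda>x. exp (- \<theta>\<^sub>0 * x) * f x)"
    and neg: "\<And>x. x < 0 \<Longrightarrow> f x = 0" and cont: "continuous_on {0..} f"
    and lim: "((\<lambda>\<theta>. \<theta> * bilaplace f \<theta>) \<longlongrightarrow> 0) at_top"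
  shows "f 0 = 0"
proof (rule ccontr)
  assume "f 0 \<noteq> 0"
  define w where "w = \<bar>f 0\<bar> / 2"
  have w: "w > 0" using \<open>f 0 \<noteq> 0\<close> by (simp add: w_def)
  obtain d where d: "d > 0" "\<And>x. 0 \<le> x \<Longrightarrow> x \<le> d \<Longrightarrow> \<bar>f x - f 0\<bar> < w"
  proof -
    from cont w obtain d where "d > 0" "\<And>x. 0 \<le> x \<Longrightarrow> dist x 0 < d \<Longrightarrow> dist (f x) (f 0) < w"
      unfolding continuous_on_iff by (metis atLeast_iff order_refl)
    then show ?thesis by (intro that[of "d/2"]) (auto simp: dist_real_def)
  qed
  define s where "s = sgn (f 0)"
  define f1 f2 where "f1 x = indicator {0..d} x * f x" and "f2 x = (if x \<le> d then 0 else f x)" for x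
  have meas0: "f \<in> borel_measurable borel"
  proof -
    have "(\<lambda>x. exp (\<theta>\<^sub>0 * x) * (exp (- \<theta>\<^sub>0 * x) * f x)) \<in> borel_measurable borel"
      using borel_measurable_integrable[OF int] by measurable
    moreover have "(\<lambda>x. exp (\<theta>\<^sub>0 * x) * (exp (- \<theta>\<^sub>0 * x) * f x)) = f"
      by (simp only: mult.assoc[symmetric] exp_add[symmetric]) simp
    ultimately show ?thesis by simp
  qed
  note meas0[measurable]
  define C where "C = (LINT x|lborel. \<bar>exp (- \<theta>\<^sub>0 * x) * f2 x\<bar>)"
  have f2i: "integrable lborel (\<lambda>x. exp (- \<theta>\<^sub>0 * x) * f2 x)"
    by (rule Bochner_Integration.integrable_bound[OF int]) (auto simp: f2_def)
  have inti: "integrable lborel (\<lambda>x. exp (- \<theta> * x) * f x)" if "\<theta>\<^sub>0 \<le> \<theta>" for \<theta>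
  proof (rule Bochner_Integration.integrable_bound[OF int])
    show "AE x in lborel. norm (exp (- \<theta> * x) * f x) \<le> norm (exp (- \<theta>\<^sub>0 * x) * f x)"
    proof (rule AE_I2)
      fix x show "norm (exp (- \<theta> * x) * f x) \<le> norm (exp (- \<theta>\<^sub>0 * x) * f x)"
        by (cases "x < 0") (use that neg in \<open>auto simp: abs_mult intro!: mult_right_mono\<close>)
    qed
  qed simp
  have low: "w * (1 - exp (- \<theta> * d)) - \<theta> * (exp (- (\<theta> - \<theta>\<^sub>0) * d) * C) \<le> \<bar>\<theta> * bilaplace f \<theta>\<bar>"
    if th: "\<theta> \<ge> max 1 \<theta>\<^sub>0" for \<theta>
  proof -
    have I: "integrable lborel (\<lambda>x. exp (- \<theta> * x) * f x)" using inti th by simp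
    have I1: "integrable lborel (\<lambda>x. exp (- \<theta> * x) * f1 x)"
      by (rule Bochner_Integration.integrable_bound[OF I]) (auto simp: f1_def indicator_def)
    have I2: "integrable lborel (\<lambda>x. exp (- \<theta> * x) * f2 x)"
      by (rule Bochner_Integration.integrable_bound[OF I]) (auto simp: f2_def)
    have "bilaplace f \<theta> = (LINT x|lborel. exp (- \<theta> * x) * f1 x + exp (- \<theta> * x) * f2 x)"
      unfolding bilaplace_def
      by (intro Bochner_Integration.integral_cong) (auto simp: f1_def f2_def neg indicator_def)
    also have "\<dots> = bilaplace f1 \<theta> + bilaplace f2 \<theta>"
      unfolding bilaplace_def by (rule Bochner_Integration.integral_add[OF I1 I2])
    finally have split: "bilaplace f \<theta> = bilaplace f1 \<theta> + bilaplace f2 \<theta>" .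
    have "(LINT x|lborel. w * (exp (- \<theta> * x) * indicator {0..d} x)) \<le> (LINT x|lborel. s * (exp (- \<theta> * x) * f1 x))"
    proof (intro integral_mono integrable_mult_right I1 exp_integral_Icc)
      fix x
      have "w \<le> s * f x" if "x \<in> {0..d}"
        using d(2)[of x] that w by (auto simp: s_def w_def sgn_if abs_if split: if_splits)
      then show "w * (exp (- \<theta> * x) * indicator {0..d} x) \<le> s * (exp (- \<theta> * x) * f1 x)"
        by (auto simp: f1_def indicator_def mult.left_commute)
    qed (use th d in auto)
    also have "\<dots> \<le> \<bar>bilaplace f1 \<theta>\<bar>"
      by (auto simp: bilaplace_def s_def sgn_if)
    finally have "w * (LINT x|lborel. exp (- \<theta> * x) * indicator {0..d} x) \<le> \<bar>bilaplace f1 \<theta>\<bar>"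
      by (simp only: integral_mult_right_zero)
    moreover have "(LINT x|lborel. exp (- \<theta> * x) * indicator {0..d} x) = (1 - exp (- \<theta> * d)) / \<theta>"
      using exp_integral_Icc(2)[of "- \<theta>" d] th d by (simp add: field_simps)
    ultimately have "w * ((1 - exp (- \<theta> * d)) / \<theta>) \<le> \<bar>bilaplace f1 \<theta>\<bar>" by simp
    then have A: "w * (1 - exp (- \<theta> * d)) \<le> \<theta> * \<bar>bilaplace f1 \<theta>\<bar>"
      using th by (simp add: field_simps)
    have "\<bar>bilaplace f2 \<theta>\<bar> \<le> exp (- (\<theta> - \<theta>\<^sub>0) * d) * C"
      unfolding C_def using th by (intro bilaplace_decay f2i) (auto simp: f2_def)
    then have B: "\<theta> * \<bar>bilaplace f2 \<theta>\<bar> \<le> \<theta> * (exp (- (\<theta> - \<theta>\<^sub>0) * d) * C)"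
      using th by (intro mult_left_mono) auto
    have "\<theta> * \<bar>bilaplace f1 \<theta>\<bar> - \<theta> * \<bar>bilaplace f2 \<theta>\<bar> \<le> \<theta> * \<bar>bilaplace f \<theta>\<bar>"
      unfolding split right_diff_distrib[symmetric] using th by (intro mult_left_mono) auto
    moreover have "\<bar>\<theta> * bilaplace f \<theta>\<bar> = \<theta> * \<bar>bilaplace f \<theta>\<bar>" using th by (simp add: abs_mult)
    ultimately show ?thesis using A B by linarith
  qed
  have "((\<lambda>\<theta>. w * (1 - exp (- \<theta> * d)) - \<theta> * (exp (- (\<theta> - \<theta>\<^sub>0) * d) * C)) \<longlongrightarrow> w) at_top"
    using d(1) by real_asymp
  moreover have "((\<lambda>\<theta>. \<bar>\<theta> * bilaplace f \<theta>\<bar>) \<longlongrightarrow> 0) at_top"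
    using lim by (simp add: tendsto_rabs_zero_iff)
  moreover have "eventually (\<lambda>\<theta>. w * (1 - exp (- \<theta> * d)) - \<theta> * (exp (- (\<theta> - \<theta>\<^sub>0) * d) * C) \<le> \<bar>\<theta> * bilaplace f \<theta>\<bar>) at_top"
    using eventually_ge_at_top[of "max 1 \<theta>\<^sub>0"] by eventually_elim (rule low)
  ultimately have "w \<le> 0" by (intro tendsto_le[of at_top]) auto
  then show False using w by simp
qed

section \<open>The Laplace exponent\<close>

text \<open>For \<open>\<theta> \<ge> 1\<close> the compensated integrand is at most \<open>\<theta>\<^sup>2 min(1, y\<^sup>2)\<close> in absolute value and at least
  \<open>- min(1, y\<^sup>2)\<close>. The upper bound controls upward steps over short times; the lower bound makes the
  exponent grow faster than linearly if the Gaussian coefficient is positive.\<close>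
lemma laplace_exponent_bounds:
  assumes "levy_measure_neg \<nu>"
  obtains C where "0 \<le> C" "\<And>\<theta>. 1 \<le> \<theta> \<Longrightarrow> \<bar>laplace_exponent \<mu> \<sigma> \<nu> \<theta>\<bar> \<le> C * \<theta>\<^sup>2"
    "\<And>\<theta>. 1 \<le> \<theta> \<Longrightarrow> laplace_exponent \<mu> \<sigma> \<nu> \<theta> \<ge> \<mu> * \<theta> + \<sigma>\<^sup>2 / 2 * \<theta>\<^sup>2 - C"
proof -
  define B where "B y = min 1 (y\<^sup>2)" for y :: real
  have sets_nu[measurable_cong]: "sets \<nu> = sets borel" 
    and fin: "(\<integral>\<^sup>+ y. ennreal (B y) \<partial>\<nu>) < \<infinity>"
    using assms by (auto simp: levy_measure_neg_def B_def)
  have B: "integrable \<nu> B"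
  proof (rule integrableI_bounded)
    show "B \<in> borel_measurable \<nu>" unfolding B_def by measurable
    show "(\<integral>\<^sup>+ y. ennreal (norm (B y)) \<partial>\<nu>) < \<infinity>"
      using fin by (simp add: B_def)
  qed
  define C where "C = (LINT y|\<nu>. B y)"
  have C: "0 \<le> C" unfolding C_def by (intro integral_nonneg_AE) (auto simp: B_def)
  define g where "g \<theta> y = indicator {..<0} y * (exp (\<theta> * y) - 1 - \<theta> * y * indicator {-1<..} y)" for \<theta> y :: real
  have g_meas: "g \<theta> \<in> borel_measurable \<nu>" for \<theta> unfolding g_def by measurable
  have g_bd: "\<bar>g \<theta> y\<bar> \<le> \<theta>\<^sup>2 * B y \<and> - B y \<le> g \<theta> y" if th: "1 \<le> \<theta>" for \<theta> y
  proof (cases "y < 0")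
    case False then show ?thesis by (auto simp: g_def B_def)
  next
    case y: True
    have th2: "1 \<le> \<theta>\<^sup>2" using th by simp
    show ?thesis
    proof (cases "- 1 < y")
      case True
      define v where "v = - (\<theta> * y)"
      have v: "v \<ge> 0" using y th by (simp add: v_def mult_nonneg_nonpos)
      have "exp (- v) \<le> 1 / (1 + v)"
        using exp_ge_add_one_self[of v] v by (simp add: exp_minus field_simps)
      also have "\<dots> \<le> 1 - v + v\<^sup>2"
      proof -
        have "(1 - v + v\<^sup>2) * (1 + v) = 1 + v ^ 3" by (simp add: power2_eq_square power3_eq_cube algebra_simps)
        then show ?thesis using v by (simp add: divide_le_eq)
      qed
      finally have u: "exp (\<theta> * y) - 1 - \<theta> * y \<le> (\<theta> * y)\<^sup>2" by (simp add: v_def)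
      have l: "exp (\<theta> * y) - 1 - \<theta> * y \<ge> 0" using exp_ge_add_one_self[of "\<theta> * y"] by linarith
      have "y\<^sup>2 \<le> 1" using True y by (simp add: abs_square_le_1)
      then have "B y = y\<^sup>2" by (simp add: B_def)
      then show ?thesis using u l y True by (auto simp: g_def power_mult_distrib intro: order.trans[OF _ l])
    next
      case False
      then have "1 \<le> y\<^sup>2" by (simp add: one_le_power[of "-y" 2, simplified])
      then have B1: "B y = 1" by (simp add: B_def)
      have "exp (\<theta> * y) \<le> 1" using y th by (simp add: mult_nonneg_nonpos)
      moreover have "0 \<le> exp (\<theta> * y)" by simp
      moreover have "g \<theta> y = exp (\<theta> * y) - 1" using y False by (simp add: g_def)
      ultimately have "\<bar>g \<theta> y\<bar> \<le> 1" "- 1 \<le> g \<theta> y" by linarith+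
      then show ?thesis using th2 B1 by auto
    qed
  qed
  have gi: "integrable \<nu> (g \<theta>)" if "1 \<le> \<theta>" for \<theta>
  proof (rule Bochner_Integration.integrable_bound[OF integrable_mult_right[OF B, of "\<theta>\<^sup>2"] g_meas])
    show "AE y in \<nu>. norm (g \<theta> y) \<le> norm (\<theta>\<^sup>2 * B y)"
      using g_bd[OF that] by (intro AE_I2) (simp add: order.trans[OF _ abs_ge_self])
  qed
  have ge: "laplace_exponent \<mu> \<sigma> \<nu> \<theta> = \<mu> * \<theta> + \<sigma>\<^sup>2 / 2 * \<theta>\<^sup>2 + (LINT y|\<nu>. g \<theta> y)" for \<theta>
    by (simp add: laplace_exponent_def set_lebesgue_integral_def g_def)
  have I1: "\<bar>LINT y|\<nu>. g \<theta> y\<bar> \<le> \<theta>\<^sup>2 * C" if th: "1 \<le> \<theta>" for \<theta>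
  proof -
    have "\<bar>LINT y|\<nu>. g \<theta> y\<bar> \<le> (LINT y|\<nu>. \<theta>\<^sup>2 * B y)"
      using g_bd[OF th] by (intro integral_abs_bound_integral gi[OF th] integrable_mult_right B) auto
    then show ?thesis by (simp add: C_def)
  qed
  have I2: "(LINT y|\<nu>. g \<theta> y) \<ge> - C" if th: "1 \<le> \<theta>" for \<theta>
  proof -
    have "(LINT y|\<nu>. - B y) \<le> (LINT y|\<nu>. g \<theta> y)"
      using g_bd[OF th] by (intro integral_mono gi[OF th] integrable_minus B) auto
    then show ?thesis by (simp add: C_def)
  qed
  show ?thesis
  proof (rule that[of "\<bar>\<mu>\<bar> + \<sigma>\<^sup>2 / 2 + C"])
    show "0 \<le> \<bar>\<mu>\<bar> + \<sigma>\<^sup>2 / 2 + C" using C by simp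
    fix \<theta> :: real assume th: "1 \<le> \<theta>"
    have "\<bar>\<mu> * \<theta>\<bar> \<le> \<bar>\<mu>\<bar> * \<theta>\<^sup>2"
      using th by (simp add: abs_mult power2_eq_square mult_left_mono)
    moreover have "0 \<le> \<sigma>\<^sup>2 / 2 * \<theta>\<^sup>2" by simp
    moreover have "(\<bar>\<mu>\<bar> + \<sigma>\<^sup>2 / 2 + C) * \<theta>\<^sup>2 = \<bar>\<mu>\<bar> * \<theta>\<^sup>2 + \<sigma>\<^sup>2 / 2 * \<theta>\<^sup>2 + \<theta>\<^sup>2 * C"
      by (simp add: algebra_simps)
    ultimately show "\<bar>laplace_exponent \<mu> \<sigma> \<nu> \<theta>\<bar> \<le> (\<bar>\<mu>\<bar> + \<sigma>\<^sup>2 / 2 + C) * \<theta>\<^sup>2"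
      using I1[OF th] unfolding ge by linarith
    show "laplace_exponent \<mu> \<sigma> \<nu> \<theta> \<ge> \<mu> * \<theta> + \<sigma>\<^sup>2 / 2 * \<theta>\<^sup>2 - (\<bar>\<mu>\<bar> + \<sigma>\<^sup>2 / 2 + C)"
      using I2[OF th] unfolding ge by (smt (verit) zero_le_power2 divide_nonneg_pos)
  qed
qed

section \<open>Averages of translates\<close>

text \<open>Of a scale function only the integrability of its exponentially weighted version is known. Its
  convolution with a bump f is nevertheless continuous and of exponential growth, since these
  properties are inherited from f.\<close>
lemma mixture_bound:
  fixes Z g :: "'b \<Rightarrow> real" and f :: "real \<Rightarrow> real"
  assumes Z[measurable]: "Z \<in> borel_measurable N" and g[measurable]: "g \<in> borel_measurable N"
    and f[measurable]: "f \<in> borel_measurable borel"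
    and bd: "\<And>x. \<bar>f x\<bar> \<le> C * exp (\<theta> * x)"
    and int: "integrable N (\<lambda>w. exp (\<theta> * Z w) * g w)"
  shows "integrable N (\<lambda>w. f (x + Z w) * g w)"
    and "\<bar>LINT w|N. f (x + Z w) * g w\<bar> \<le> C * (LINT w|N. \<bar>exp (\<theta> * Z w) * g w\<bar>) * exp (\<theta> * x)"
proof -
  have b: "\<bar>f (x + Z w) * g w\<bar> \<le> C * exp (\<theta> * x) * \<bar>exp (\<theta> * Z w) * g w\<bar>" for w
  proof -
    have "\<bar>f (x + Z w) * g w\<bar> \<le> C * exp (\<theta> * (x + Z w)) * \<bar>g w\<bar>"
      unfolding abs_mult by (intro mult_right_mono bd) auto
    also have "exp (\<theta> * (x + Z w)) = exp (\<theta> * x) * exp (\<theta> * Z w)"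
      by (simp add: distrib_left exp_add)
    finally show ?thesis by (simp add: abs_mult mult.assoc)
  qed
  have I: "integrable N (\<lambda>w. C * exp (\<theta> * x) * \<bar>exp (\<theta> * Z w) * g w\<bar>)"
    by (intro integrable_mult_right integrable_abs int)
  show J: "integrable N (\<lambda>w. f (x + Z w) * g w)"
    by (rule Bochner_Integration.integrable_bound[OF I]) (use order.trans[OF b abs_ge_self] in auto)
  have "\<bar>LINT w|N. f (x + Z w) * g w\<bar> \<le> (LINT w|N. C * exp (\<theta> * x) * \<bar>exp (\<theta> * Z w) * g w\<bar>)"
    by (rule order.trans[OF integral_abs_bound integral_mono[OF integrable_abs[OF J] I b]])
  then show "\<bar>LINT w|N. f (x + Z w) * g w\<bar> \<le> C * (LINT w|N. \<bar>exp (\<theta> * Z w) * g w\<bar>) * exp (\<theta> * x)"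
    by (simp only: integral_mult_right_zero mult.assoc mult.commute mult.left_commute)
qed

lemma mixture_continuous:
  fixes Z g :: "'b \<Rightarrow> real" and f :: "real \<Rightarrow> real"
  assumes Z[measurable]: "Z \<in> borel_measurable N" and g[measurable]: "g \<in> borel_measurable N"
    and f: "continuous_on UNIV f" and th: "0 \<le> \<theta>"
    and bd: "\<And>x. \<bar>f x\<bar> \<le> C * exp (\<theta> * x)"
    and int: "integrable N (\<lambda>w. exp (\<theta> * Z w) * g w)"
  shows "continuous_on UNIV (\<lambda>x. LINT w|N. f (x + Z w) * g w)"
proof -
  have f_meas[measurable]: "f \<in> borel_measurable borel"
    by (rule borel_measurable_continuous_onI[OF f])
  have "isCont (\<lambda>x. LINT w|N. f (x + Z w) * g w) x" for x
    unfolding continuous_at_sequentially comp_def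
  proof (intro allI impI)
    fix u :: "nat \<Rightarrow> real" assume u: "u \<longlonglongrightarrow> x"
    then obtain K where K: "\<And>n. \<bar>u n\<bar> \<le> K"
      using convergent_imp_bounded[of u x] unfolding bounded_real by auto
    have "C \<ge> 0" using bd[of 0] by simp
    show "(\<lambda>n. LINT w|N. f (u n + Z w) * g w) \<longlonglongrightarrow> (LINT w|N. f (x + Z w) * g w)"
    proof (rule integral_dominated_convergence)
      show "integrable N (\<lambda>w. C * exp (\<theta> * K) * \<bar>exp (\<theta> * Z w) * g w\<bar>)"
        by (intro integrable_mult_right integrable_abs int)
      show "AE w in N. norm (f (u n + Z w) * g w) \<le> C * exp (\<theta> * K) * \<bar>exp (\<theta> * Z w) * g w\<bar>" for n
      proof (rule AE_I2)
        fix w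
        have "\<bar>f (u n + Z w)\<bar> \<le> C * exp (\<theta> * (u n + Z w))" by (rule bd)
        also have "\<dots> = C * (exp (\<theta> * u n) * exp (\<theta> * Z w))" by (simp add: distrib_left exp_add)
        also have "\<dots> \<le> C * (exp (\<theta> * K) * exp (\<theta> * Z w))"
          using K[of n] th \<open>C \<ge> 0\<close> by (intro mult_left_mono mult_right_mono) (auto intro!: mult_left_mono)
        finally have "\<bar>f (u n + Z w)\<bar> * \<bar>g w\<bar> \<le> C * (exp (\<theta> * K) * exp (\<theta> * Z w)) * \<bar>g w\<bar>"
          by (rule mult_right_mono) simp
        then show "norm (f (u n + Z w) * g w) \<le> C * exp (\<theta> * K) * \<bar>exp (\<theta> * Z w) * g w\<bar>"
          by (simp add: abs_mult mult.assoc)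
      qed
      have "isCont f y" for y using f by (simp add: continuous_on_eq_continuous_at)
      then show "AE w in N. (\<lambda>n. f (u n + Z w) * g w) \<longlonglongrightarrow> f (x + Z w) * g w"
        using u by (intro AE_I2 tendsto_intros isCont_tendsto_compose[where g=f]) 
    qed auto
  qed
  then show ?thesis by (simp add: continuous_on_eq_continuous_at)
qed

section \<open>Dynkin's formula from Laplace transforms\<close>
lemma dyadic_above:
  assumes "0 \<le> t"
  shows "t < (real (nat \<lfloor>t * 2 ^ n\<rfloor>) + 1) / 2 ^ n" "(real (nat \<lfloor>t * 2 ^ n\<rfloor>) + 1) / 2 ^ n \<le> t + 1 / 2 ^ n"
proof -
  have "0 \<le> t * 2 ^ n" using assms by simp
  then have e: "real (nat \<lfloor>t * 2 ^ n\<rfloor>) = of_int \<lfloor>t * 2 ^ n\<rfloor>" by simp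
  show "t < (real (nat \<lfloor>t * 2 ^ n\<rfloor>) + 1) / 2 ^ n"
    unfolding e using floor_correct[of "t * 2 ^ n"] by (simp add: pos_less_divide_eq)
  show "(real (nat \<lfloor>t * 2 ^ n\<rfloor>) + 1) / 2 ^ n \<le> t + 1 / 2 ^ n"
    unfolding e using floor_correct[of "t * 2 ^ n"] by (simp add: pos_divide_le_eq distrib_right)
qed

lemma dyadic_above_at_right:
  assumes "0 \<le> t"
  shows "filterlim (\<lambda>n. (real (nat \<lfloor>t * 2 ^ n\<rfloor>) + 1) / 2 ^ n) (at_right t) sequentially"
proof -
  have "(\<lambda>n. (real (nat \<lfloor>t * 2 ^ n\<rfloor>) + 1) / 2 ^ n) \<longlonglongrightarrow> t"
  proof (rule tendsto_sandwich[where f = "\<lambda>n. t" and h = "\<lambda>n. t + 1 / 2 ^ n"])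
    show "(\<lambda>n. t + 1 / 2 ^ n) \<longlonglongrightarrow> t" by real_asymp
    show "(\<lambda>n. t) \<longlonglongrightarrow> t" by simp
    show "\<forall>\<^sub>F n in sequentially. t \<le> (real (nat \<lfloor>t * 2 ^ n\<rfloor>) + 1) / 2 ^ n"
      by (intro always_eventually allI less_imp_le dyadic_above assms)
    show "\<forall>\<^sub>F n in sequentially. (real (nat \<lfloor>t * 2 ^ n\<rfloor>) + 1) / 2 ^ n \<le> t + 1 / 2 ^ n"
      by (intro always_eventually allI dyadic_above assms)
  qed
  then show ?thesis
    using dyadic_above(1)[OF assms] by (auto simp: filterlim_at less_imp_neq[THEN not_sym])
qed

context levy_process begin

lemma right_limit: "\<omega> \<in> space M \<Longrightarrow> 0 \<le> t \<Longrightarrow> ((\<lambda>t. X t \<omega>) \<longlongrightarrow> X t \<omega>) (at_right t)"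
  using cadlag_paths by (auto simp: cadlag_def)

lemma dyadic_limit:
  "\<omega> \<in> space M \<Longrightarrow> 0 \<le> t \<Longrightarrow> (\<lambda>n. X ((real (nat \<lfloor>t * 2 ^ n\<rfloor>) + 1) / 2 ^ n) \<omega>) \<longlonglongrightarrow> X t \<omega>"
  by (rule filterlim_compose[OF right_limit dyadic_above_at_right])

text \<open>By right-continuity, paths are limits of paths that are constant on dyadic intervals. Truncating
  time at 0 avoids a restriction of the measure space.\<close>
lemma jointly_measurable:
  "(\<lambda>p. X (max 0 (fst p)) (snd p)) \<in> borel_measurable (lborel \<Otimes>\<^sub>M M)"
proof (rule borel_measurable_LIMSEQ_real)
  define k :: "nat \<Rightarrow> real \<times> 'a \<Rightarrow> nat" where "k n p = nat \<lfloor>max 0 (fst p) * 2 ^ n\<rfloor>" for n p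
  show "(\<lambda>n. X ((real (k n p) + 1) / 2 ^ n) (snd p)) \<longlonglongrightarrow> X (max 0 (fst p)) (snd p)"
    if "p \<in> space (lborel \<Otimes>\<^sub>M M)" for p
    unfolding k_def using that by (intro dyadic_limit) (auto simp: space_pair_measure)
  fix n
  have "X ((real i + 1) / 2 ^ n) \<in> borel_measurable M" for i
    by (rule random_variable_X) simp
  then have "(\<lambda>p. X ((real i + 1) / 2 ^ n) (snd p)) \<in> borel_measurable (lborel \<Otimes>\<^sub>M M)" for i
    by measurable
  moreover have "k n \<in> measurable (lborel \<Otimes>\<^sub>M M) (count_space UNIV)"
    unfolding k_def by measurable
  ultimately show "(\<lambda>p. X ((real (k n p) + 1) / 2 ^ n) (snd p)) \<in> borel_measurable (lborel \<Otimes>\<^sub>M M)"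
    by (rule measurable_compose_countable)
qed

end

context spectrally_negative_levy_process begin

abbreviation \<psi> where "\<psi> \<equiv> laplace_exponent \<mu> \<sigma> \<nu>"

lemma exp_moment:
  assumes "0 \<le> t" "0 \<le> \<theta>"
  shows "integrable M (\<lambda>\<omega>. exp (\<theta> * X t \<omega>))" "expectation (\<lambda>\<omega>. exp (\<theta> * X t \<omega>)) = exp (t * \<psi> \<theta>)"
  using exponential_moments[OF assms] by (auto simp: has_bochner_integral_iff)

lemma discounted_exp_moment:
  assumes th: "0 \<le> \<theta>" and t: "0 \<le> t" and ne: "\<psi> \<theta> \<noteq> \<gamma>"
  defines "g \<equiv> \<lambda>p::real \<times> 'a. exp (- \<gamma> * fst p) * indicator {0..t} (fst p)"
  shows "integrable (lborel \<Otimes>\<^sub>M M) (\<lambda>p. exp (\<theta> * X (max 0 (fst p)) (snd p)) * g p)"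
    and "(LINT p|(lborel \<Otimes>\<^sub>M M). exp (\<theta> * X (max 0 (fst p)) (snd p)) * g p)
          = (exp ((\<psi> \<theta> - \<gamma>) * t) - 1) / (\<psi> \<theta> - \<gamma>)"
proof -
  interpret P: pair_sigma_finite lborel M ..
  note [measurable] = jointly_measurable
  let ?f = "\<lambda>p. exp (\<theta> * X (max 0 (fst p)) (snd p)) * g p"
  have inner: "(LINT \<omega>|M. ?f (s, \<omega>)) = exp ((\<psi> \<theta> - \<gamma>) * s) * indicator {0..t} s" for s
  proof (cases "s \<in> {0..t}")
    case True
    then have "(LINT \<omega>|M. ?f (s, \<omega>)) = exp (s * \<psi> \<theta>) * exp (- \<gamma> * s)"
      using exp_moment(2)[of s \<theta>] th by (simp add: g_def)
    then show ?thesis using True by (simp add: exp_add[symmetric] algebra_simps)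
  qed (auto simp: g_def)
  have nn: "norm (?f p) = ?f p" for p by (simp add: g_def abs_mult)
  show I: "integrable (lborel \<Otimes>\<^sub>M M) ?f"
  proof (rule P.Fubini_integrable)
    show "?f \<in> borel_measurable (lborel \<Otimes>\<^sub>M M)" unfolding g_def by measurable
    show "integrable lborel (\<lambda>s. LINT \<omega>|M. norm (?f (s, \<omega>)))"
      unfolding nn inner by (rule exp_integral_Icc) (use ne t in auto)
    show "AE s in lborel. integrable M (\<lambda>\<omega>. ?f (s, \<omega>))"
      by (intro AE_I2) (auto simp: g_def max_def intro!: integrable_mult_left exp_moment th)
  qed
  have "(LINT p|(lborel \<Otimes>\<^sub>M M). ?f p) = (LINT s|lborel. LINT \<omega>|M. ?f (s, \<omega>))"
    by (rule P.integral_fst'[OF I, symmetric])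
  also have "\<dots> = (exp ((\<psi> \<theta> - \<gamma>) * t) - 1) / (\<psi> \<theta> - \<gamma>)"
    unfolding inner by (rule exp_integral_Icc) (use ne t in auto)
  finally show "(LINT p|(lborel \<Otimes>\<^sub>M M). ?f p) = (exp ((\<psi> \<theta> - \<gamma>) * t) - 1) / (\<psi> \<theta> - \<gamma>)" .
qed

text \<open>As the generator acts on transforms as multiplication by \<open>\<psi>\<close>, the hypothesis on the transforms
  says that applying the generator minus \<open>\<gamma>\<close> to F yields G. Solving the resulting
  linear differential equation in t on the transform side shows that the difference of both sides, as
  a function of y, has transform 0; it is continuous, hence 0 everywhere.\<close>
lemma dynkin_formula:
  assumes th0: "0 \<le> \<theta>\<^sub>0" and t: "0 \<le> t"
    and ne: "\<And>\<theta>. \<theta> > \<theta>\<^sub>0 \<Longrightarrow> \<psi> \<theta> \<noteq> \<gamma>"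
    and F: "continuous_on UNIV F" "\<And>x. \<bar>F x\<bar> \<le> C * exp (\<theta>\<^sub>1 * x)"
    and G: "continuous_on UNIV G" "\<And>x. \<bar>G x\<bar> \<le> D * exp (\<theta>\<^sub>1 * x)"
    and th1: "\<theta>\<^sub>0 < \<theta>\<^sub>1"
    and Fi: "\<And>\<theta>. \<theta> > \<theta>\<^sub>0 \<Longrightarrow> integrable lborel (\<lambda>x. exp (- \<theta> * x) * F x)"
    and Gi: "\<And>\<theta>. \<theta> > \<theta>\<^sub>0 \<Longrightarrow> integrable lborel (\<lambda>x. exp (- \<theta> * x) * G x)"
    and FG: "\<And>\<theta>. \<theta> > \<theta>\<^sub>0 \<Longrightarrow> (\<psi> \<theta> - \<gamma>) * bilaplace F \<theta> = bilaplace G \<theta>"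
  shows "exp (- \<gamma> * t) * expectation (\<lambda>\<omega>. F (y + X t \<omega>)) = F y + 
    (LINT s|lborel. exp (- \<gamma> * s) * indicator {0..t} s * expectation (\<lambda>\<omega>. G (y + X s \<omega>)))"
proof -
  interpret P: pair_sigma_finite lborel M ..
  note [measurable] = jointly_measurable random_variable_X[OF t]
  have [measurable]: "F \<in> borel_measurable borel" "G \<in> borel_measurable borel"
    using F(1) G(1) by (auto intro: borel_measurable_continuous_onI)
  define g where "g = (\<lambda>p::real \<times> 'a. exp (- \<gamma> * fst p) * indicator {0..t} (fst p))"
  define Z where "Z = (\<lambda>p. X (max 0 (fst p)) (snd p))"
  have [measurable]: "g \<in> borel_measurable (lborel \<Otimes>\<^sub>M M)" "Z \<in> borel_measurable (lborel \<Otimes>\<^sub>M M)"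
    unfolding g_def Z_def by measurable
  define A where "A x = (LINT \<omega>|M. F (x + X t \<omega>) * exp (- \<gamma> * t))" for x
  define I where "I x = (LINT p|(lborel \<Otimes>\<^sub>M M). G (x + Z p) * g p)" for x
  define h where "h x = A x - F x - I x" for x
  have sf: "sigma_finite_measure (lborel \<Otimes>\<^sub>M M)" by (rule P.sigma_finite_measure_axioms)
  have gi: "integrable (lborel \<Otimes>\<^sub>M M) (\<lambda>p. exp (\<theta> * Z p) * g p)"
      "(LINT p|(lborel \<Otimes>\<^sub>M M). exp (\<theta> * Z p) * g p) = (exp ((\<psi> \<theta> - \<gamma>) * t) - 1) / (\<psi> \<theta> - \<gamma>)"
    if "\<theta> > \<theta>\<^sub>0" for \<theta>
    using discounted_exp_moment[OF _ t ne[OF that]] that th0 by (auto simp: g_def Z_def)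
  have ei: "integrable M (\<lambda>\<omega>. exp (\<theta> * X t \<omega>) * exp (- \<gamma> * t))" 
     "(LINT \<omega>|M. exp (\<theta> * X t \<omega>) * exp (- \<gamma> * t)) = exp ((\<psi> \<theta> - \<gamma>) * t)" if "\<theta> > \<theta>\<^sub>0" for \<theta>
  proof -
    note em = exp_moment[OF t, of \<theta>]
    show "integrable M (\<lambda>\<omega>. exp (\<theta> * X t \<omega>) * exp (- \<gamma> * t))"
      using that th0 by (intro integrable_mult_left em) auto
    have "(LINT \<omega>|M. exp (\<theta> * X t \<omega>) * exp (- \<gamma> * t)) = exp (t * \<psi> \<theta>) * exp (- \<gamma> * t)"
      unfolding integral_mult_left_zero using that th0 em(2) by simp
    also have "\<dots> = exp ((\<psi> \<theta> - \<gamma>) * t)"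
      unfolding exp_add[symmetric] by (simp add: algebra_simps)
    finally show "(LINT \<omega>|M. exp (\<theta> * X t \<omega>) * exp (- \<gamma> * t)) = exp ((\<psi> \<theta> - \<gamma>) * t)" .
  qed
  have "AE x in lborel. h x = 0"
  proof (rule bilaplace_zero_imp_AE_zero)
    fix \<theta> assume th: "\<theta> > \<theta>\<^sub>0"
    have 1: "integrable lborel (\<lambda>x. exp (- \<theta> * x) * A x)" "bilaplace A \<theta> = exp ((\<psi> \<theta> - \<gamma>) * t) * bilaplace F \<theta>"
      unfolding A_def using bilaplace_mixture[OF sigma_finite_measure_axioms _ _ _ ei(1)[OF th] Fi[OF th]] ei(2)[OF th]
      by auto
    have 2: "integrable lborel (\<lambda>x. exp (- \<theta> * x) * I x)" "bilaplace I \<theta> = (exp ((\<psi> \<theta> - \<gamma>) * t) - 1) / (\<psi> \<theta> - \<gamma>) * bilaplace G \<theta>"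
      unfolding I_def using bilaplace_mixture[OF sf _ _ _ gi(1)[OF th] Gi[OF th]] gi(2)[OF th]
      by auto
    have eq: "exp (- \<theta> * x) * h x = exp (- \<theta> * x) * A x - exp (- \<theta> * x) * F x - exp (- \<theta> * x) * I x" for x
      by (simp add: h_def algebra_simps)
    show "integrable lborel (\<lambda>x. exp (- \<theta> * x) * h x)"
      unfolding eq by (intro Bochner_Integration.integrable_diff 1 2 Fi th)
    have "bilaplace h \<theta> = bilaplace A \<theta> - bilaplace F \<theta> - bilaplace I \<theta>"
      unfolding bilaplace_def eq using 1(1) 2(1) Fi[OF th] by simp
    also have "\<dots> = 0"
      unfolding 1 2 FG[OF th, symmetric] using ne[OF th] by (simp add: field_simps)
    finally show "bilaplace h \<theta> = 0" .
  qed
  moreover have "continuous_on UNIV h"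
    unfolding h_def A_def I_def using th0 th1
    by (intro continuous_intros F(1) mixture_continuous[OF _ _ F(1) _ F(2) ei(1)] mixture_continuous[OF _ _ G(1) _ G(2) gi(1)]) auto
  ultimately have "h y = 0" by (intro continuous_AE_zero)
  moreover have "I y = (LINT s|lborel. LINT \<omega>|M. G (y + Z (s, \<omega>)) * g (s, \<omega>))"
    unfolding I_def by (rule P.integral_fst'[symmetric], rule mixture_bound(1)[OF _ _ _ G(2) gi(1)[OF th1]]) auto
  moreover have "\<dots> = (LINT s|lborel. exp (- \<gamma> * s) * indicator {0..t} s * expectation (\<lambda>\<omega>. G (y + X s \<omega>)))"
    by (intro Bochner_Integration.integral_cong) (auto simp: Z_def g_def indicator_def max_def)
  moreover have "A y = exp (- \<gamma> * t) * expectation (\<lambda>\<omega>. F (y + X t \<omega>))"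
    unfolding A_def by (simp add: mult.commute)
  ultimately show ?thesis unfolding h_def by linarith
qed

end

section \<open>Steps over short times\<close>

context spectrally_negative_levy_process begin

text \<open>Chebyshev's inequality for \<open>(1 - exp (X s))\<^sup>2\<close>, whose mean
  \<open>exp (s \<psi>(2)) - 2 exp (s \<psi>(1)) + 1\<close> tends to 0 with s.\<close>
lemma small_time_down:
  assumes eps: "0 < \<epsilon>" and kap: "0 < \<kappa>"
  shows "eventually (\<lambda>\<delta>. \<forall>s\<in>{0..\<delta>}. prob {\<omega> \<in> space M. X s \<omega> < - \<epsilon>} \<le> \<kappa>) (at_right 0)"
proof -
  define c where "c = (1 - exp (- \<epsilon>))\<^sup>2"
  have c: "c > 0" using eps by (simp add: c_def)
  define m where "m s = exp (s * \<psi> 2) - 2 * exp (s * \<psi> 1) + 1" for s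
  have bound: "c * prob {\<omega> \<in> space M. X s \<omega> < - \<epsilon>} \<le> m s" if s: "0 \<le> s" for s
  proof -
    have [measurable]: "X s \<in> borel_measurable M" using random_variable_X s by simp
    define B where "B = {\<omega> \<in> space M. X s \<omega> < - \<epsilon>}"
    have [measurable]: "B \<in> sets M" unfolding B_def by measurable
    have sq: "(1 - exp (X s \<omega>))\<^sup>2 = exp (2 * X s \<omega>) - 2 * exp (1 * X s \<omega>) + 1" for \<omega>
      by (simp add: power2_eq_square exp_double algebra_simps)
    have i1: "integrable M (\<lambda>\<omega>. exp (2 * X s \<omega>))" "integrable M (\<lambda>\<omega>. exp (1 * X s \<omega>))"
      using exp_moment(1)[OF s, of 2] exp_moment(1)[OF s, of 1] by auto
    have "c * prob B = (LINT \<omega>|M. c * indicator B \<omega>)" by simp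
    also have "\<dots> \<le> (LINT \<omega>|M. (1 - exp (X s \<omega>))\<^sup>2)"
    proof (rule integral_mono)
      show "integrable M (\<lambda>\<omega>. (1 - exp (X s \<omega>))\<^sup>2)" unfolding sq using i1 by auto
      show "c * indicator B \<omega> \<le> (1 - exp (X s \<omega>))\<^sup>2" for \<omega>
      proof (cases "\<omega> \<in> B")
        case True
        then have "exp (X s \<omega>) \<le> exp (- \<epsilon>)" by (auto simp: B_def)
        then have "(1 - exp (- \<epsilon>))\<^sup>2 \<le> (1 - exp (X s \<omega>))\<^sup>2" using eps by (intro power_mono) auto
        then show ?thesis using True by (simp add: c_def)
      qed simp
    qed (auto intro!: integrable_mult_right integrable_const_bound[where B=1])
    also have "\<dots> = m s"
      unfolding sq m_def using i1 exp_moment(2)[OF s, of 2] exp_moment(2)[OF s, of 1] by (simp add: prob_space)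
    finally show ?thesis by (simp add: B_def)
  qed
  have "isCont m 0" unfolding m_def by (intro continuous_intros)
  then have "(m \<longlongrightarrow> 0) (at 0)" by (simp add: isCont_def m_def)
  from LIM_D[OF this, of "c * \<kappa>"] c kap
  obtain d where d: "d > 0" "\<And>s. s \<noteq> 0 \<Longrightarrow> \<bar>s\<bar> < d \<Longrightarrow> \<bar>m s\<bar> < c * \<kappa>"
    by auto
  have m0: "m 0 = 0" by (simp add: m_def)
  have "eventually (\<lambda>\<delta>. \<delta> \<in> {0<..<d}) (at_right 0)" by (rule eventually_at_right_real[OF d(1)])
  then show ?thesis
  proof eventually_elim
    case (elim \<delta>)
    show ?case
    proof
      fix s assume s: "s \<in> {0..\<delta>}"
      have "m s \<le> c * \<kappa>" using d(2)[of s] s elim m0 c kap by (cases "s = 0") auto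
      then have "c * prob {\<omega> \<in> space M. X s \<omega> < - \<epsilon>} \<le> c * \<kappa>" using bound[of s] s by auto
      then show "prob {\<omega> \<in> space M. X s \<omega> < - \<epsilon>} \<le> \<kappa>" using c by simp
    qed
  qed
qed

text \<open>Chernoff's bound with exponent \<open>l = 1 / sqrt \<delta>\<close>: as \<open>\<psi>\<close> grows at most quadratically,
  \<open>\<delta> \<psi>(\<theta> + l)\<close> stays bounded, and the factor \<open>exp (- l \<epsilon>)\<close> is smaller than any power of
  \<open>\<delta>\<close>. For a process with positive jumps the left-hand side would be of the order of \<open>\<delta>\<close>.\<close>
lemma small_time_up:
  assumes eps: "0 < \<epsilon>" and th: "0 \<le> \<theta>" and kap: "0 < \<kappa>"
  shows "eventually (\<lambda>\<delta>. expectation (\<lambda>\<omega>. exp (\<theta> * X \<delta> \<omega>) * indicator {\<epsilon><..} (X \<delta> \<omega>)) \<le> \<kappa> * \<delta>) (at_right 0)"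
proof -
  obtain C where C: "0 \<le> C" "\<And>\<theta>. 1 \<le> \<theta> \<Longrightarrow> \<bar>\<psi> \<theta>\<bar> \<le> C * \<theta>\<^sup>2"
    using laplace_exponent_bounds[OF levy_measure] by blast
  have bound: "expectation (\<lambda>\<omega>. exp (\<theta> * X \<delta> \<omega>) * indicator {\<epsilon><..} (X \<delta> \<omega>))
      \<le> exp (- \<epsilon> / sqrt \<delta> + \<delta> * (C * (\<theta> + 1 / sqrt \<delta>)\<^sup>2))" if d: "0 < \<delta>" "\<delta> < 1" for \<delta>
  proof -
    define l where "l = 1 / sqrt \<delta>"
    have l: "l \<ge> 1" using d by (simp add: l_def)
    have [measurable]: "X \<delta> \<in> borel_measurable M" using random_variable_X d by simp
    have th1: "0 \<le> \<theta> + l" "1 \<le> \<theta> + l" using th l by auto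
    note em = exp_moment[OF less_imp_le[OF d(1)]]
    have "expectation (\<lambda>\<omega>. exp (\<theta> * X \<delta> \<omega>) * indicator {\<epsilon><..} (X \<delta> \<omega>))
       \<le> expectation (\<lambda>\<omega>. exp (- l * \<epsilon>) * exp ((\<theta> + l) * X \<delta> \<omega>))"
    proof (rule integral_mono)
      show "integrable M (\<lambda>\<omega>. exp (\<theta> * X \<delta> \<omega>) * indicator {\<epsilon><..} (X \<delta> \<omega>))"
        by (rule Bochner_Integration.integrable_bound[OF em(1)[OF th]]) (auto simp: indicator_def)
      show "integrable M (\<lambda>\<omega>. exp (- l * \<epsilon>) * exp ((\<theta> + l) * X \<delta> \<omega>))"
        by (intro integrable_mult_right em th1)
      show "exp (\<theta> * X \<delta> \<omega>) * indicator {\<epsilon><..} (X \<delta> \<omega>) \<le> exp (- l * \<epsilon>) * exp ((\<theta> + l) * X \<delta> \<omega>)" for \<omega>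
      proof (cases "\<epsilon> < X \<delta> \<omega>")
        case True
        have "exp (\<theta> * X \<delta> \<omega>) \<le> exp (- l * \<epsilon> + (\<theta> + l) * X \<delta> \<omega>)"
          using True l mult_left_mono[of \<epsilon> "X \<delta> \<omega>" l] by (simp add: distrib_right)
        then show ?thesis using True by (simp only: exp_add) simp
      qed simp
    qed
    also have "\<dots> = exp (- l * \<epsilon>) * exp (\<delta> * \<psi> (\<theta> + l))"
      using em(2)[OF th1(1)] by simp
    also have "\<dots> \<le> exp (- l * \<epsilon> + \<delta> * (C * (\<theta> + l)\<^sup>2))"
      using C(2)[OF th1(2)] d unfolding exp_add[symmetric] by (simp add: abs_le_iff mult_left_mono)
    finally show ?thesis by (simp add: l_def)
  qed
  have "((\<lambda>\<delta>. exp (- \<epsilon> / sqrt \<delta> + \<delta> * (C * (\<theta> + 1 / sqrt \<delta>)\<^sup>2)) / \<delta>) \<longlongrightarrow> 0) (at_right 0)"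
    using eps by real_asymp
  then have "eventually (\<lambda>\<delta>. exp (- \<epsilon> / sqrt \<delta> + \<delta> * (C * (\<theta> + 1 / sqrt \<delta>)\<^sup>2)) / \<delta> < \<kappa>) (at_right 0)"
    using kap by (rule order_tendstoD)
  moreover have "eventually (\<lambda>\<delta>. \<delta> \<in> {0<..<1}) (at_right (0::real))"
    by (rule eventually_at_right_real) simp
  ultimately show ?thesis
  proof eventually_elim
    case (elim \<delta>)
    then have "exp (- \<epsilon> / sqrt \<delta> + \<delta> * (C * (\<theta> + 1 / sqrt \<delta>)\<^sup>2)) < \<kappa> * \<delta>" by (simp add: divide_less_eq)
    then show ?case using bound[of \<delta>] elim by auto
  qed
qed

text \<open>A path that starts above \<open>2 \<epsilon>\<close> stays, for a short time and with high probability, above \<open>\<epsilon>\<close>,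
  where G is constant.\<close>
lemma one_step_estimate:
  assumes dynkin: "\<And>t y. 0 \<le> t \<Longrightarrow> exp (- \<gamma> * t) * expectation (\<lambda>\<omega>. F (y + X t \<omega>)) = F y + 
    (LINT s|lborel. exp (- \<gamma> * s) * indicator {0..t} s * expectation (\<lambda>\<omega>. G (y + X s \<omega>)))"
    and gam: "0 < \<gamma>"
    and G: "G \<in> borel_measurable borel" "\<And>x. \<bar>G x\<bar> \<le> D" "\<And>x. \<epsilon> \<le> x \<Longrightarrow> G x = - \<beta>"
    and eps: "0 < \<epsilon>" and kap: "0 < \<kappa>"
  shows "eventually (\<lambda>\<delta>. \<forall>y\<ge>2 * \<epsilon>. 
    \<bar>exp (- \<gamma> * \<delta>) * expectation (\<lambda>\<omega>. F (y + X \<delta> \<omega>)) - F y + \<beta> * ((1 - exp (- \<gamma> * \<delta>)) / \<gamma>)\<bar> \<le> \<kappa> * \<delta>) (at_right 0)"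
proof -
  define E where "E = D + \<bar>\<beta>\<bar> + 1"
  have "D \<ge> 0" using G(2)[of 0] by simp
  then have E: "E > 0" by (simp add: E_def)
  have "0 < \<kappa> / E" using kap E by simp
  note small_time_down[OF eps this]
  moreover have "eventually (\<lambda>\<delta>. \<delta> > 0) (at_right (0::real))" by (simp add: eventually_at_right_less)
  ultimately show ?thesis
  proof eventually_elim
    case (elim \<delta>)
    note [measurable] = G(1) jointly_measurable
    show ?case
    proof (intro allI impI)
      fix y assume y: "2 * \<epsilon> \<le> y"
      define g where "g s = expectation (\<lambda>\<omega>. G (y + X (max 0 s) \<omega>))" for s
      have [measurable]: "g \<in> borel_measurable borel" unfolding g_def
      proof -
        have "(\<lambda>s. LINT \<omega>|M. G (y + (\<lambda>p. X (max 0 (fst p)) (snd p)) (s, \<omega>))) \<in> borel_measurable lborel"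
          by measurable
        then show "(\<lambda>s. expectation (\<lambda>\<omega>. G (y + X (max 0 s) \<omega>))) \<in> borel_measurable borel" by simp
      qed
      have gb: "\<bar>g s + \<beta>\<bar> \<le> \<kappa>" if s: "s \<in> {0..\<delta>}" for s
      proof -
        have [measurable]: "X s \<in> borel_measurable M" using random_variable_X s by simp
        define B where "B = {\<omega> \<in> space M. X s \<omega> < - \<epsilon>}"
        have [measurable]: "B \<in> sets M" unfolding B_def by measurable
        have Gi: "integrable M (\<lambda>\<omega>. G (y + X s \<omega>))"
          by (rule integrable_const_bound[where B=D]) (use G(2) in auto)
        have "\<bar>g s + \<beta>\<bar> = \<bar>expectation (\<lambda>\<omega>. G (y + X s \<omega>) + \<beta>)\<bar>"
          using Gi s by (simp add: g_def prob_space)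
        also have "\<dots> \<le> expectation (\<lambda>\<omega>. E * indicator B \<omega>)"
        proof (rule order.trans[OF integral_abs_bound integral_mono])
          show "integrable M (\<lambda>\<omega>. \<bar>G (y + X s \<omega>) + \<beta>\<bar>)" using Gi by simp
          show "integrable M (\<lambda>\<omega>. E * indicator B \<omega>)" by (intro integrable_mult_right integrable_const_bound[where B=1]) auto
          fix \<omega> assume om: "\<omega> \<in> space M"
          show "\<bar>G (y + X s \<omega>) + \<beta>\<bar> \<le> E * indicator B \<omega>"
          proof (cases "\<omega> \<in> B")
            case True then show ?thesis using G(2)[of "y + X s \<omega>"] by (simp add: E_def)
          next
            case False
            then have "\<epsilon> \<le> y + X s \<omega>" using y om by (simp add: B_def)
            then show ?thesis using False G(3) by simp
          qed
        qed
        also have "\<dots> = E * prob B" by simp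
        also have "\<dots> \<le> \<kappa>" using elim(1) s E by (simp add: B_def pos_le_divide_eq mult.commute)
        finally show ?thesis .
      qed
      have ei: "integrable lborel (\<lambda>s. exp (- \<gamma> * s) * indicator {0..\<delta>} s)"
         "(LINT s|lborel. exp (- \<gamma> * s) * indicator {0..\<delta>} s) = (1 - exp (- \<gamma> * \<delta>)) / \<gamma>"
        using exp_integral_Icc[of "- \<gamma>" \<delta>] gam elim(2) by (auto simp: field_simps)
      have gi: "integrable lborel (\<lambda>s. exp (- \<gamma> * s) * indicator {0..\<delta>} s * (g s + \<beta>))"
      proof (rule Bochner_Integration.integrable_bound[OF integrable_mult_right[OF ei(1), of \<kappa>]])
        show "AE s in lborel. norm (exp (- \<gamma> * s) * indicator {0..\<delta>} s * (g s + \<beta>)) \<le> norm (\<kappa> * (exp (- \<gamma> * s) * indicator {0..\<delta>} s))"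
          using gb kap by (intro AE_I2) (auto simp: abs_mult indicator_def)
      qed simp
      have "exp (- \<gamma> * \<delta>) * expectation (\<lambda>\<omega>. F (y + X \<delta> \<omega>)) - F y + \<beta> * ((1 - exp (- \<gamma> * \<delta>)) / \<gamma>)
        = (LINT s|lborel. exp (- \<gamma> * s) * indicator {0..\<delta>} s * expectation (\<lambda>\<omega>. G (y + X s \<omega>))) 
            + (LINT s|lborel. \<beta> * (exp (- \<gamma> * s) * indicator {0..\<delta>} s))"
        using dynkin[of \<delta> y] elim(2) ei(2) by simp
      also have "(LINT s|lborel. exp (- \<gamma> * s) * indicator {0..\<delta>} s * expectation (\<lambda>\<omega>. G (y + X s \<omega>)))
          = (LINT s|lborel. exp (- \<gamma> * s) * indicator {0..\<delta>} s * (g s + \<beta>) - \<beta> * (exp (- \<gamma> * s) * indicator {0..\<delta>} s))"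
        by (intro Bochner_Integration.integral_cong) (auto simp: g_def indicator_def max_def algebra_simps)
      also have "\<dots> = (LINT s|lborel. exp (- \<gamma> * s) * indicator {0..\<delta>} s * (g s + \<beta>)) - (LINT s|lborel. \<beta> * (exp (- \<gamma> * s) * indicator {0..\<delta>} s))"
        by (intro Bochner_Integration.integral_diff gi integrable_mult_right ei)
      finally have eq: "exp (- \<gamma> * \<delta>) * expectation (\<lambda>\<omega>. F (y + X \<delta> \<omega>)) - F y + \<beta> * ((1 - exp (- \<gamma> * \<delta>)) / \<gamma>)
        = (LINT s|lborel. exp (- \<gamma> * s) * indicator {0..\<delta>} s * (g s + \<beta>))" by simp
      have "\<bar>LINT s|lborel. exp (- \<gamma> * s) * indicator {0..\<delta>} s * (g s + \<beta>)\<bar> \<le> (LINT s|lborel. \<kappa> * indicator {0..\<delta>} s)"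
      proof (rule integral_abs_bound_integral[OF gi])
        show "integrable lborel (\<lambda>s. \<kappa> * indicator {0..\<delta>} s)" using elim(2) by (intro integrable_mult_right integrable_real_indicator) auto
        fix s :: real
        have "exp (- (\<gamma> * s)) * \<bar>g s + \<beta>\<bar> \<le> 1 * \<kappa>" if "s \<in> {0..\<delta>}"
          using gb[OF that] that gam kap by (intro mult_mono) auto
        then show "\<bar>exp (- \<gamma> * s) * indicator {0..\<delta>} s * (g s + \<beta>)\<bar> \<le> \<kappa> * indicator {0..\<delta>} s"
          by (cases "s \<in> {0..\<delta>}") (auto simp: abs_mult)
      qed
      also have "\<dots> = \<kappa> * \<delta>" using elim(2) by simp
      finally show "\<bar>exp (- \<gamma> * \<delta>) * expectation (\<lambda>\<omega>. F (y + X \<delta> \<omega>)) - F y + \<beta> * ((1 - exp (- \<gamma> * \<delta>)) / \<gamma>)\<bar> \<le> \<kappa> * \<delta>"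
        unfolding eq .
    qed
  qed
qed

end

section \<open>Discrete optional stopping on a grid\<close>

context levy_process begin

definition alive :: "real set \<Rightarrow> real \<Rightarrow> real \<Rightarrow> nat \<Rightarrow> 'a set" where
  "alive J y \<delta> k = {\<omega> \<in> space M. \<forall>j\<le>k. y + X (real j * \<delta>) \<omega> \<in> J}"

lemma alive_measurable:
  assumes "J \<in> sets borel" "0 \<le> \<delta>"
  shows "alive J y \<delta> k \<in> sets M"
proof -
  have [measurable]: "X (real j * \<delta>) \<in> borel_measurable M" for j
    using assms by (intro random_variable_X) auto
  note [measurable] = assms(1)
  show ?thesis unfolding alive_def by measurable
qed

lemma alive_Suc: "alive J y \<delta> (Suc k) = alive J y \<delta> k \<inter> {\<omega> \<in> space M. y + X (real (Suc k) * \<delta>) \<omega> \<in> J}"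
  by (auto simp: alive_def le_Suc_eq)

text \<open>The Markov property at a grid point. Survival up to step k is, up to a null set, a function of the
  first k increments, and the next increment is independent of these; the null set is the one where
  the process does not start in 0.\<close>
lemma alive_markov:
  fixes f :: "real \<Rightarrow> real"
  assumes J: "J \<in> sets borel" and d: "0 \<le> \<delta>" and f: "f \<in> borel_measurable borel"
    and fi: "integrable M (\<lambda>\<omega>. f (y + X (real (Suc k) * \<delta>) \<omega>))"
  shows "integrable M (\<lambda>\<omega>. indicator (alive J y \<delta> k) \<omega> * expectation (\<lambda>\<omega>'. f (y + X (real k * \<delta>) \<omega> + X \<delta> \<omega>')))"
    and "expectation (\<lambda>\<omega>. indicator (alive J y \<delta> k) \<omega> * f (y + X (real (Suc k) * \<delta>) \<omega>))
      = expectation (\<lambda>\<omega>. indicator (alive J y \<delta> k) \<omega> * expectation (\<lambda>\<omega>'. f (y + X (real k * \<delta>) \<omega> + X \<delta> \<omega>')))"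
proof -
  note [measurable] = J f
  have [measurable]: "X (real j * \<delta>) \<in> borel_measurable M" for j
    using d by (intro random_variable_X) auto
  have Xd[measurable]: "X \<delta> \<in> borel_measurable M" using d by (intro random_variable_X) auto
  define \<xi> where "\<xi> i \<omega> = X (real (Suc i) * \<delta>) \<omega> - X (real i * \<delta>) \<omega>" for i \<omega>
  have xi_meas[measurable]: "\<xi> i \<in> borel_measurable M" for i unfolding \<xi>_def by measurable
  define S where "S = PiM {..<k} (\<lambda>_. borel :: real measure)"
  define V where "V \<omega> = restrict (\<lambda>i. \<xi> i \<omega>) {..<k}" for \<omega>
  have ind: "indep_vars (\<lambda>_. borel) \<xi> {..<Suc k}"
    unfolding \<xi>_def using d by (intro indep_increments[of "\<lambda>i. real i * \<delta>" "Suc k"]) (auto intro: mult_right_mono)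
  define S' where "S' = PiM {k} (\<lambda>_. borel :: real measure)"
  define U where "U \<omega> = restrict (\<lambda>i. \<xi> i \<omega>) {k}" for \<omega>
  have iv: "indep_var S V S' U"
    unfolding S_def V_def S'_def U_def by (rule indep_var_restrict[OF ind]) auto
  have V_meas[measurable]: "V \<in> measurable M S" using iv by (rule indep_var_rv1)
  have U_meas[measurable]: "U \<in> measurable M S'" using iv by (rule indep_var_rv2)
  have k_meas[measurable]: "(\<lambda>u. u k) \<in> borel_measurable S'" unfolding S'_def by measurable
  have Uk: "U \<omega> k = \<xi> k \<omega>" for \<omega> by (simp add: U_def)
  interpret DV: prob_space "distr M S V" by (rule prob_space_distr[OF V_meas])
  interpret DX: prob_space "distr M S' U" by (rule prob_space_distr[OF U_meas])
  interpret P: pair_sigma_finite "distr M S V" "distr M S' U" ..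
  have xi_distr: "distr M borel (\<xi> k) = distr M borel (X \<delta>)"
    unfolding \<xi>_def using stationary_increments[of "real k * \<delta>" \<delta>] d by (simp add: algebra_simps)
  have joint: "distr M S V \<Otimes>\<^sub>M distr M S' U = distr M (S \<Otimes>\<^sub>M S') (\<lambda>\<omega>. (V \<omega>, U \<omega>))"
    using iv unfolding indep_var_distribution_eq by simp
  define s where "s j v = (\<Sum>i<j. v i)" for j :: nat and v :: "nat \<Rightarrow> real"
  have s_meas[measurable]: "s j \<in> borel_measurable S" if "j \<le> k" for j
    unfolding s_def S_def by (intro borel_measurable_sum measurable_component_singleton) (use that in auto)
  define A where "A = {v \<in> space S. \<forall>j\<le>k. y + s j v \<in> J}"
  have A_meas[measurable]: "A \<in> sets S"
  proof -
    have "A = space S \<inter> (\<Inter>j\<in>{..k}. {v \<in> space S. y + s j v \<in> J})" unfolding A_def by auto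
    also have "\<dots> \<in> sets S" by (intro sets.Int sets.top sets.finite_INT) (auto intro!: measurable_sets_Collect)
    finally show ?thesis .
  qed
  define \<phi> where "\<phi> = (\<lambda>(v, u). indicator A v * f (y + s k v + u k))"
  have phi_meas[measurable]: "\<phi> \<in> borel_measurable (S \<Otimes>\<^sub>M S')" 
    unfolding \<phi>_def using s_meas[of k] by measurable
  have sV: "s j (V \<omega>) = X (real j * \<delta>) \<omega> - X 0 \<omega>" if "j \<le> k" for j \<omega>
  proof -
    have "s j (V \<omega>) = (\<Sum>i<j. \<xi> i \<omega>)" unfolding s_def V_def using that by (intro sum.cong refl) auto
    also have "\<dots> = X (real j * \<delta>) \<omega> - X (real 0 * \<delta>) \<omega>"
      unfolding \<xi>_def by (rule sum_lessThan_telescope)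
    finally show ?thesis by simp
  qed
  have ae_alive: "AE \<omega> in M. indicator A (V \<omega>) = (indicator (alive J y \<delta> k) \<omega> :: real)"
    using start AE_space
  proof eventually_elim
    case (elim \<omega>)
    then have "V \<omega> \<in> A \<longleftrightarrow> \<omega> \<in> alive J y \<delta> k"
      using measurable_space[OF V_meas] by (auto simp: A_def alive_def sV)
    then show ?case by (simp add: indicator_def)
  qed
  have ae1: "AE \<omega> in M. \<phi> (V \<omega>, U \<omega>) = indicator (alive J y \<delta> k) \<omega> * f (y + X (real (Suc k) * \<delta>) \<omega>)"
    using start ae_alive by eventually_elim (simp add: \<phi>_def sV Uk, simp add: \<xi>_def)
  have [measurable]: "alive J y \<delta> k \<in> sets M" by (rule alive_measurable[OF J d])
  have I0: "integrable M (\<lambda>\<omega>. indicator (alive J y \<delta> k) \<omega> * f (y + X (real (Suc k) * \<delta>) \<omega>))"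
  proof (rule Bochner_Integration.integrable_bound[OF fi])
    show "(\<lambda>\<omega>. indicator (alive J y \<delta> k) \<omega> * f (y + X (real (Suc k) * \<delta>) \<omega>)) \<in> borel_measurable M"
      by measurable
  qed (auto simp: indicator_def)
  have I1: "integrable M (\<lambda>\<omega>. \<phi> (V \<omega>, U \<omega>))"
  proof (rule iffD2[OF integrable_cong_AE[OF _ _ ae1] I0])
    show "(\<lambda>\<omega>. \<phi> (V \<omega>, U \<omega>)) \<in> borel_measurable M" by measurable
    show "(\<lambda>\<omega>. indicator (alive J y \<delta> k) \<omega> * f (y + X (real (Suc k) * \<delta>) \<omega>)) \<in> borel_measurable M" by measurable
  qed
  then have I2: "integrable (distr M S V \<Otimes>\<^sub>M distr M S' U) \<phi>"
    unfolding joint by (subst integrable_distr_eq) auto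
  have inner: "(LINT u|distr M S' U. \<phi> (v, u)) = indicator A v * expectation (\<lambda>\<omega>'. f (y + s k v + X \<delta> \<omega>'))" for v
  proof -
    have "(LINT u|distr M S' U. \<phi> (v, u)) = indicator A v * (LINT u|distr M S' U. f (y + s k v + u k))"
      by (simp add: \<phi>_def)
    also have "(LINT u|distr M S' U. f (y + s k v + u k)) = expectation (\<lambda>\<omega>. f (y + s k v + \<xi> k \<omega>))"
      by (subst integral_distr) (auto simp: Uk)
    also have "\<dots> = (LINT x|distr M borel (\<xi> k). f (y + s k v + x))" 
      by (subst integral_distr) auto
    also have "\<dots> = expectation (\<lambda>\<omega>'. f (y + s k v + X \<delta> \<omega>'))"
      unfolding xi_distr by (subst integral_distr) auto
    finally show ?thesis .
  qed
  have ae2: "AE \<omega> in M. indicator A (V \<omega>) * expectation (\<lambda>\<omega>'. f (y + s k (V \<omega>) + X \<delta> \<omega>'))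
     = indicator (alive J y \<delta> k) \<omega> * expectation (\<lambda>\<omega>'. f (y + X (real k * \<delta>) \<omega> + X \<delta> \<omega>'))"
    using start ae_alive by eventually_elim (simp add: sV)
  have I3: "integrable (distr M S V) (\<lambda>v. indicator A v * expectation (\<lambda>\<omega>'. f (y + s k v + X \<delta> \<omega>')))"
    using P.integrable_fst'[OF I2] unfolding inner .
  then have "integrable M (\<lambda>\<omega>. indicator A (V \<omega>) * expectation (\<lambda>\<omega>'. f (y + s k (V \<omega>) + X \<delta> \<omega>')))"
    by (rule integrable_distr[OF V_meas])
  then show "integrable M (\<lambda>\<omega>. indicator (alive J y \<delta> k) \<omega> * expectation (\<lambda>\<omega>'. f (y + X (real k * \<delta>) \<omega> + X \<delta> \<omega>')))"
    by (subst integrable_cong_AE[OF _ _ ae2, symmetric]) auto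
  have "expectation (\<lambda>\<omega>. indicator (alive J y \<delta> k) \<omega> * f (y + X (real (Suc k) * \<delta>) \<omega>)) = expectation (\<lambda>\<omega>. \<phi> (V \<omega>, U \<omega>))"
  proof (rule integral_cong_AE)
    show "AE \<omega> in M. indicator (alive J y \<delta> k) \<omega> * f (y + X (real (Suc k) * \<delta>) \<omega>) = \<phi> (V \<omega>, U \<omega>)"
      using ae1 by eventually_elim (rule sym)
    show "(\<lambda>\<omega>. indicator (alive J y \<delta> k) \<omega> * f (y + X (real (Suc k) * \<delta>) \<omega>)) \<in> borel_measurable M" by measurable
  qed measurable
  also have "\<dots> = (LINT p|(distr M S V \<Otimes>\<^sub>M distr M S' U). \<phi> p)"
    unfolding joint by (subst integral_distr) auto
  also have "\<dots> = (LINT v|distr M S V. indicator A v * expectation (\<lambda>\<omega>'. f (y + s k v + X \<delta> \<omega>')))"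
    unfolding inner[symmetric] by (rule P.integral_fst'[OF I2, symmetric])
  also have "\<dots> = expectation (\<lambda>\<omega>. indicator A (V \<omega>) * expectation (\<lambda>\<omega>'. f (y + s k (V \<omega>) + X \<delta> \<omega>')))"
    by (rule integral_distr[OF V_meas]) (use I3 in auto)
  also have "\<dots> = expectation (\<lambda>\<omega>. indicator (alive J y \<delta> k) \<omega> * expectation (\<lambda>\<omega>'. f (y + X (real k * \<delta>) \<omega> + X \<delta> \<omega>')))"
    by (rule integral_cong_AE) (use ae2 in auto)
  finally show "expectation (\<lambda>\<omega>. indicator (alive J y \<delta> k) \<omega> * f (y + X (real (Suc k) * \<delta>) \<omega>))
      = expectation (\<lambda>\<omega>. indicator (alive J y \<delta> k) \<omega> * expectation (\<lambda>\<omega>'. f (y + X (real k * \<delta>) \<omega> + X \<delta> \<omega>')))" .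
qed

end

text \<open>The weights \<open>r ^ k\<close> turn the one-step relation into a telescoping sum. The errors of size d add up
  to a geometric series, whereas those proportional to the decrease of p telescope again.\<close>
lemma discounted_telescope:
  fixes a p :: "nat \<Rightarrow> real"
  assumes r: "0 < r" "r < 1" and eta: "0 \<le> \<eta>" and d: "0 \<le> d"
    and p: "\<And>k. 0 \<le> p k" "\<And>k. p (Suc k) \<le> p k" "p 0 \<le> 1"
    and a: "\<And>k. \<bar>a k\<bar> \<le> B"
    and step: "\<And>k. \<bar>a k - r * a (Suc k) - b * p k\<bar> \<le> \<eta> * (p k - p (Suc k)) + d"
  shows "summable (\<lambda>k. r ^ k * p k)" "\<bar>a 0 - b * (\<Sum>k. r ^ k * p k)\<bar> \<le> \<eta> + d / (1 - r)"
proof -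
  have p1: "p k \<le> 1" for k
    using p(3) lift_Suc_antimono_le[of p 0 k] p(2) by auto
  show sm: "summable (\<lambda>k. r ^ k * p k)"
    by (rule summable_comparison_test'[of "\<lambda>k. r ^ k" 0]) (use r p p1 in \<open>auto simp: abs_mult mult_left_le\<close>)
  have part: "\<bar>a 0 - r ^ K * a K - b * (\<Sum>k<K. r ^ k * p k)\<bar> \<le> \<eta> * (p 0 - p K) + d * (\<Sum>k<K. r ^ k)" for K
  proof (induction K)
    case (Suc K)
    have "a 0 - r ^ Suc K * a (Suc K) - b * (\<Sum>k<Suc K. r ^ k * p k)
      = (a 0 - r ^ K * a K - b * (\<Sum>k<K. r ^ k * p k)) + r ^ K * (a K - r * a (Suc K) - b * p K)"
      by (simp add: algebra_simps)
    also have "\<bar>\<dots>\<bar> \<le> \<bar>a 0 - r ^ K * a K - b * (\<Sum>k<K. r ^ k * p k)\<bar> + r ^ K * \<bar>a K - r * a (Suc K) - b * p K\<bar>"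
      using r by (intro order.trans[OF abs_triangle_ineq]) (simp add: abs_mult)
    also have "\<dots> \<le> (\<eta> * (p 0 - p K) + d * (\<Sum>k<K. r ^ k)) + r ^ K * (\<eta> * (p K - p (Suc K)) + d)"
      using r by (intro add_mono Suc.IH mult_left_mono step) auto
    also have "r ^ K * (\<eta> * (p K - p (Suc K)) + d) \<le> \<eta> * (p K - p (Suc K)) + d * r ^ K"
    proof -
      have "r ^ K * (\<eta> * (p K - p (Suc K))) \<le> 1 * (\<eta> * (p K - p (Suc K)))"
        using r eta p(2)[of K] by (intro mult_right_mono) (auto simp: power_le_one)
      then show ?thesis by (simp add: algebra_simps)
    qed
    finally show ?case by (simp add: algebra_simps)
  qed simp
  have bound: "\<bar>a 0 - r ^ K * a K - b * (\<Sum>k<K. r ^ k * p k)\<bar> \<le> \<eta> + d / (1 - r)" for K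
  proof -
    have "\<eta> * (p 0 - p K) \<le> \<eta> * 1" using eta p(1)[of K] p(3) by (intro mult_left_mono) auto
    moreover have "d * (\<Sum>k<K. r ^ k) \<le> d * (1 / (1 - r))"
      using d r by (intro mult_left_mono) (auto simp: sum_gp_strict divide_right_mono)
    ultimately show ?thesis using part[of K] by simp
  qed
  have "(\<lambda>K. r ^ K * a K) \<longlonglongrightarrow> 0"
  proof (rule Lim_null_comparison)
    show "\<forall>\<^sub>F K in sequentially. norm (r ^ K * a K) \<le> r ^ K * B"
      using a r by (intro always_eventually allI) (auto simp: abs_mult)
    show "(\<lambda>K. r ^ K * B) \<longlonglongrightarrow> 0"
      using r by (intro tendsto_mult_left_zero LIMSEQ_realpow_zero) auto
  qed
  then have "(\<lambda>K. \<bar>a 0 - r ^ K * a K - b * (\<Sum>k<K. r ^ k * p k)\<bar>) \<longlonglongrightarrow> \<bar>a 0 - 0 - b * (\<Sum>k. r ^ k * p k)\<bar>"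
    using summable_LIMSEQ[OF sm] by (intro tendsto_intros)
  then show "\<bar>a 0 - b * (\<Sum>k. r ^ k * p k)\<bar> \<le> \<eta> + d / (1 - r)"
    using bound by (intro LIMSEQ_le_const2) auto
qed

context spectrally_negative_levy_process begin

text \<open>Leaving J costs at most \<open>\<eta>\<close> in total, because it happens only once
  and F is small next to J; F is large only above c, and by hypothesis a single step hardly gets there.\<close>
lemma grid_estimate:
  fixes F :: "real \<Rightarrow> real"
  assumes gam: "0 < \<gamma>" and del: "0 < \<delta>" and th: "0 \<le> \<theta>"
    and F: "F \<in> borel_measurable borel" "\<And>x. \<bar>F x\<bar> \<le> C * exp (\<theta> * x)"
    and J: "J \<in> sets borel" and y: "y \<in> J" and eta: "0 \<le> \<eta>" and kap: "0 \<le> \<kappa>"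
    and step: "\<And>z. z \<in> J \<Longrightarrow> \<bar>exp (- \<gamma> * \<delta>) * expectation (\<lambda>\<omega>. F (z + X \<delta> \<omega>)) - F z + \<beta> * ((1 - exp (- \<gamma> * \<delta>)) / \<gamma>)\<bar> \<le> \<kappa>"
    and over: "\<And>z. z \<in> J \<Longrightarrow> expectation (\<lambda>\<omega>. indicator {c<..} (z + X \<delta> \<omega>) * \<bar>F (z + X \<delta> \<omega>)\<bar>) \<le> \<kappa>"
    and small: "\<And>z. z \<le> c \<Longrightarrow> z \<notin> J \<Longrightarrow> \<bar>F z\<bar> \<le> \<eta>"
    and bdd: "\<And>z. z \<in> J \<Longrightarrow> \<bar>F z\<bar> \<le> B"
  shows "\<bar>F y - \<beta> / \<gamma> * (\<Sum>k. (1 - exp (- \<gamma> * \<delta>)) * exp (- \<gamma> * \<delta>) ^ k * prob (alive J y \<delta> k))\<bar>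
    \<le> \<eta> + 2 * \<kappa> / (1 - exp (- \<gamma> * \<delta>))"
proof -
  define r where "r = exp (- \<gamma> * \<delta>)"
  have r: "0 < r" "r < 1" using gam del by (auto simp: r_def)
  have dn: "0 \<le> \<delta>" using del by simp
  define q where "q = (1 - r) / \<gamma>"
  define Y where "Y k \<omega> = y + X (real k * \<delta>) \<omega>" for k \<omega>
  define A where "A = alive J y \<delta>"
  define p where "p k = prob (A k)" for k
  define a where "a k = expectation (\<lambda>\<omega>. indicator (A k) \<omega> * F (Y k \<omega>))" for k
  note [measurable] = F(1) J
  have [measurable]: "A k \<in> sets M" for k unfolding A_def by (rule alive_measurable[OF J dn])
  have Xm[measurable]: "X (real k * \<delta>) \<in> borel_measurable M" for k using dn by (intro random_variable_X) simp
  have Ym[measurable]: "Y k \<in> borel_measurable M" for k unfolding Y_def by measurable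
  have Xd[measurable]: "X \<delta> \<in> borel_measurable M" using dn by (rule random_variable_X)
  have AJ: "Y k \<omega> \<in> J" if "\<omega> \<in> A k" for k \<omega> using that by (auto simp: A_def alive_def Y_def)
  have Asub: "A (Suc k) \<subseteq> A k" for k by (auto simp: A_def alive_def)
  have Fi: "integrable M (\<lambda>\<omega>. F (z + X t \<omega>))" if "0 \<le> t" for z t
  proof -
    have "integrable M (\<lambda>\<omega>. F (z + X t \<omega>) * 1)"
      by (rule mixture_bound(1)[where \<theta> = \<theta> and C = C]) (use that F exp_moment(1)[OF that th] random_variable_X[OF that] in auto)
    then show ?thesis by simp
  qed
  have FY: "integrable M (\<lambda>\<omega>. F (Y k \<omega>))" for k unfolding Y_def using dn by (intro Fi) simp
  have iF: "integrable M (\<lambda>\<omega>. indicator S \<omega> * F (Y k \<omega>))" if [measurable]: "S \<in> sets M" for S k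
    by (rule Bochner_Integration.integrable_bound[OF FY]) (auto simp: indicator_def)
  define PF where "PF z = expectation (\<lambda>\<omega>. F (z + X \<delta> \<omega>))" for z
  define ft where "ft z = indicator {c<..} z * \<bar>F z\<bar>" for z
  have [measurable]: "ft \<in> borel_measurable borel" unfolding ft_def by measurable
  have ftY: "integrable M (\<lambda>\<omega>. ft (Y k \<omega>))" for k
    by (rule Bochner_Integration.integrable_bound[OF FY]) (auto simp: ft_def indicator_def)
  have ift: "integrable M (\<lambda>\<omega>. indicator S \<omega> * ft (Y k \<omega>))" if [measurable]: "S \<in> sets M" for S k
    by (rule Bochner_Integration.integrable_bound[OF ftY]) (auto simp: indicator_def)
  define Pf where "Pf z = expectation (\<lambda>\<omega>. ft (z + X \<delta> \<omega>))" for z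
  have m1: "integrable M (\<lambda>\<omega>. indicator (A k) \<omega> * PF (Y k \<omega>))"
     "expectation (\<lambda>\<omega>. indicator (A k) \<omega> * F (Y (Suc k) \<omega>)) = expectation (\<lambda>\<omega>. indicator (A k) \<omega> * PF (Y k \<omega>))" for k
    using alive_markov[OF J dn F(1), of y k] FY[of "Suc k"] unfolding A_def PF_def Y_def by blast+
  have m2: "integrable M (\<lambda>\<omega>. indicator (A k) \<omega> * Pf (Y k \<omega>))"
     "expectation (\<lambda>\<omega>. indicator (A k) \<omega> * ft (Y (Suc k) \<omega>)) = expectation (\<lambda>\<omega>. indicator (A k) \<omega> * Pf (Y k \<omega>))" for k
    using alive_markov[OF J dn, of ft y k] ftY[of "Suc k"] unfolding A_def Pf_def Y_def by auto
  have iA: "integrable M (\<lambda>\<omega>. c * indicator (A k) \<omega>)" for c :: real and k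
    by (intro integrable_mult_right integrable_const_bound[where B=1]) auto
  have bound_const: "\<bar>expectation g\<bar> \<le> K" if "integrable M g" "\<And>\<omega>. \<omega> \<in> space M \<Longrightarrow> \<bar>g \<omega>\<bar> \<le> K" for g :: "'a \<Rightarrow> real" and K
  proof -
    have "\<bar>expectation g\<bar> \<le> expectation (\<lambda>\<omega>. \<bar>g \<omega>\<bar>)" by (rule integral_abs_bound)
    also have "\<dots> \<le> expectation (\<lambda>\<omega>. K)" using that by (intro integral_mono) auto
    finally show ?thesis by (simp add: prob_space)
  qed
  have step': "\<bar>a k - r * a (Suc k) - \<beta> * q * p k\<bar> \<le> \<eta> * (p k - p (Suc k)) + 2 * \<kappa>" for k
  proof -
    define m where "m = expectation (\<lambda>\<omega>. indicator (A k) \<omega> * F (Y (Suc k) \<omega>))"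
    have "r * m - a k + \<beta> * q * p k = expectation (\<lambda>\<omega>. r * (indicator (A k) \<omega> * PF (Y k \<omega>)) - indicator (A k) \<omega> * F (Y k \<omega>) + \<beta> * q * indicator (A k) \<omega>)"
      unfolding m_def m1 a_def p_def using m1(1) iF iA by simp
    also have "\<dots> = expectation (\<lambda>\<omega>. indicator (A k) \<omega> * (r * PF (Y k \<omega>) - F (Y k \<omega>) + \<beta> * q))"
      by (intro Bochner_Integration.integral_cong) (auto simp: algebra_simps)
    finally have e1: "r * m - a k + \<beta> * q * p k = \<dots>" .
    have "\<bar>r * m - a k + \<beta> * q * p k\<bar> \<le> \<kappa>"
      unfolding e1
    proof (rule bound_const)
      have eq: "indicator (A k) \<omega> * (r * PF (Y k \<omega>) - F (Y k \<omega>) + \<beta> * q) 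
         = r * (indicator (A k) \<omega> * PF (Y k \<omega>)) - indicator (A k) \<omega> * F (Y k \<omega>) + \<beta> * q * indicator (A k) \<omega>" for \<omega>
        by (simp add: algebra_simps)
      show "integrable M (\<lambda>\<omega>. indicator (A k) \<omega> * (r * PF (Y k \<omega>) - F (Y k \<omega>) + \<beta> * q))"
        unfolding eq by (intro Bochner_Integration.integrable_add Bochner_Integration.integrable_diff integrable_mult_right[OF m1(1)] iF iA) auto
      show "\<bar>indicator (A k) \<omega> * (r * PF (Y k \<omega>) - F (Y k \<omega>) + \<beta> * q)\<bar> \<le> \<kappa>" for \<omega>
        using step[OF AJ[of \<omega> k]] kap by (cases "\<omega> \<in> A k") (auto simp: PF_def r_def q_def)
    qed
    moreover have "\<bar>m - a (Suc k)\<bar> \<le> \<eta> * (p k - p (Suc k)) + \<kappa>"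
    proof -
      have "\<bar>m - a (Suc k)\<bar> = \<bar>expectation (\<lambda>\<omega>. indicator (A k) \<omega> * F (Y (Suc k) \<omega>) - indicator (A (Suc k)) \<omega> * F (Y (Suc k) \<omega>))\<bar>"
        unfolding m_def a_def using iF by simp
      also have "\<dots> \<le> expectation (\<lambda>\<omega>. \<bar>indicator (A k) \<omega> * F (Y (Suc k) \<omega>) - indicator (A (Suc k)) \<omega> * F (Y (Suc k) \<omega>)\<bar>)"
        by (rule integral_abs_bound)
      also have "\<dots> \<le> expectation (\<lambda>\<omega>. (\<eta> * indicator (A k) \<omega> - \<eta> * indicator (A (Suc k)) \<omega>) + indicator (A k) \<omega> * ft (Y (Suc k) \<omega>))"
      proof (rule integral_mono)
        show "integrable M (\<lambda>\<omega>. \<bar>indicator (A k) \<omega> * F (Y (Suc k) \<omega>) - indicator (A (Suc k)) \<omega> * F (Y (Suc k) \<omega>)\<bar>)"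
          using iF by (intro integrable_abs Bochner_Integration.integrable_diff) auto
        show "integrable M (\<lambda>\<omega>. (\<eta> * indicator (A k) \<omega> - \<eta> * indicator (A (Suc k)) \<omega>) + indicator (A k) \<omega> * ft (Y (Suc k) \<omega>))"
          using iA ift by (intro Bochner_Integration.integrable_add Bochner_Integration.integrable_diff) auto
        fix \<omega> assume om: "\<omega> \<in> space M"
        show "\<bar>indicator (A k) \<omega> * F (Y (Suc k) \<omega>) - indicator (A (Suc k)) \<omega> * F (Y (Suc k) \<omega>)\<bar>
          \<le> (\<eta> * indicator (A k) \<omega> - \<eta> * indicator (A (Suc k)) \<omega>) + indicator (A k) \<omega> * ft (Y (Suc k) \<omega>)"
        proof (cases "\<omega> \<in> A k")
          case False
          then have "\<omega> \<notin> A (Suc k)" using Asub[of k] by auto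
          then show ?thesis using False by simp
        next
          case True
          show ?thesis
          proof (cases "\<omega> \<in> A (Suc k)")
            case True then show ?thesis using Asub[of k] by (auto simp: ft_def)
          next
            case False
            then have "Y (Suc k) \<omega> \<notin> J" using True om unfolding A_def Y_def alive_Suc by auto
            then show ?thesis using True False small[of "Y (Suc k) \<omega>"] eta
              by (cases "Y (Suc k) \<omega> \<le> c") (auto simp: ft_def)
          qed
        qed
      qed
      also have "\<dots> = \<eta> * (p k - p (Suc k)) + expectation (\<lambda>\<omega>. indicator (A k) \<omega> * Pf (Y k \<omega>))"
      proof -
        have "expectation (\<lambda>\<omega>. (\<eta> * indicator (A k) \<omega> - \<eta> * indicator (A (Suc k)) \<omega>) + indicator (A k) \<omega> * ft (Y (Suc k) \<omega>))
          = expectation (\<lambda>\<omega>. \<eta> * indicator (A k) \<omega> - \<eta> * indicator (A (Suc k)) \<omega>) + expectation (\<lambda>\<omega>. indicator (A k) \<omega> * ft (Y (Suc k) \<omega>))"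
          by (intro Bochner_Integration.integral_add Bochner_Integration.integrable_diff iA ift) auto
        also have "expectation (\<lambda>\<omega>. \<eta> * indicator (A k) \<omega> - \<eta> * indicator (A (Suc k)) \<omega>) = \<eta> * p k - \<eta> * p (Suc k)"
          using iA by (subst Bochner_Integration.integral_diff) (auto simp: p_def)
        finally show ?thesis unfolding m2 by (simp add: algebra_simps)
      qed
      also have "expectation (\<lambda>\<omega>. indicator (A k) \<omega> * Pf (Y k \<omega>)) \<le> \<kappa>"
      proof -
        have nn: "0 \<le> Pf z" for z unfolding Pf_def by (intro integral_nonneg_AE) (auto simp: ft_def)
        have "\<bar>expectation (\<lambda>\<omega>. indicator (A k) \<omega> * Pf (Y k \<omega>))\<bar> \<le> \<kappa>"
        proof (rule bound_const[OF m2(1)])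
          show "\<bar>indicator (A k) \<omega> * Pf (Y k \<omega>)\<bar> \<le> \<kappa>" for \<omega>
            using over[OF AJ[of \<omega> k]] kap nn[of "Y k \<omega>"] by (cases "\<omega> \<in> A k") (auto simp: Pf_def ft_def)
        qed
        then show ?thesis by simp
      qed
      finally show ?thesis by simp
    qed
    then have "\<bar>r * m - r * a (Suc k)\<bar> \<le> \<eta> * (p k - p (Suc k)) + \<kappa>"
    proof -
      assume h: "\<bar>m - a (Suc k)\<bar> \<le> \<eta> * (p k - p (Suc k)) + \<kappa>"
      have "\<bar>r * m - r * a (Suc k)\<bar> = r * \<bar>m - a (Suc k)\<bar>" using r by (simp add: abs_mult right_diff_distrib[symmetric])
      also have "\<dots> \<le> 1 * \<bar>m - a (Suc k)\<bar>" using r by (intro mult_right_mono) auto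
      finally show ?thesis using h by simp
    qed
    ultimately show ?thesis by linarith
  qed
  have "\<bar>a 0 - \<beta> * q * (\<Sum>k. r ^ k * p k)\<bar> \<le> \<eta> + 2 * \<kappa> / (1 - r)" and sm: "summable (\<lambda>k. r ^ k * p k)"
  proof -
    have pm: "p (Suc k) \<le> p k" for k unfolding p_def by (rule finite_measure_mono[OF Asub]) simp
    have ab: "\<bar>a k\<bar> \<le> \<bar>B\<bar>" for k unfolding a_def
    proof (rule bound_const[OF iF])
      show "\<bar>indicator (A k) \<omega> * F (Y k \<omega>)\<bar> \<le> \<bar>B\<bar>" for \<omega>
        using bdd[OF AJ[of \<omega> k]] by (cases "\<omega> \<in> A k") auto
    qed simp
    have p01: "0 \<le> p k" "p 0 \<le> 1" for k by (auto simp: p_def)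
    have "0 \<le> 2 * \<kappa>" using kap by simp
    note dt = discounted_telescope[OF r eta this p01(1) pm p01(2) ab, where b = "\<beta> * q", OF step']
    show "\<bar>a 0 - \<beta> * q * (\<Sum>k. r ^ k * p k)\<bar> \<le> \<eta> + 2 * \<kappa> / (1 - r)" by (rule dt(2))
    show "summable (\<lambda>k. r ^ k * p k)" by (rule dt(1))
  qed
  moreover have "a 0 = F y"
  proof -
    have "a 0 = expectation (\<lambda>\<omega>. F y)"
      unfolding a_def
    proof (rule integral_cong_AE)
      show "AE \<omega> in M. indicator (A 0) \<omega> * F (Y 0 \<omega>) = F y"
        using start AE_space by eventually_elim (use y in \<open>auto simp: A_def alive_def Y_def\<close>)
    qed auto
    then show ?thesis by (simp add: prob_space)
  qed
  moreover have "\<beta> * q * (\<Sum>k. r ^ k * p k) = \<beta> / \<gamma> * (\<Sum>k. (1 - r) * r ^ k * p k)"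
    unfolding q_def using suminf_mult[OF sm, of "1 - r"] by (simp add: mult.assoc)
  ultimately show ?thesis by (simp add: r_def p_def A_def)
qed

end

section \<open>Survival up to an independent exponential time\<close>

context levy_process begin

text \<open>The parameter h delays the killing time; it serves to pass from the open time interval before T to
  the closed one.\<close>
definition survive :: "('a \<Rightarrow> real) \<Rightarrow> real set \<Rightarrow> real \<Rightarrow> real \<Rightarrow> real \<Rightarrow> 'a set" where
  "survive T J y \<delta> h = {\<omega> \<in> space M. \<forall>j. real j * \<delta> < T \<omega> + h \<longrightarrow> y + X (real j * \<delta>) \<omega> \<in> J}"

lemma survive_measurable:
  assumes "J \<in> sets borel" "0 \<le> \<delta>" and [measurable]: "T \<in> borel_measurable M"
  shows "survive T J y \<delta> h \<in> sets M"
proof -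
  have [measurable]: "X (real j * \<delta>) \<in> borel_measurable M" for j
    using assms by (intro random_variable_X) auto
  note [measurable] = assms(1)
  show ?thesis unfolding survive_def by measurable
qed

lemma alive_process_event:
  assumes J: "J \<in> sets borel" and d: "0 \<le> \<delta>"
  shows "alive J y \<delta> k \<in> process_events M X"
proof -
  interpret PE: sigma_algebra "space M" "process_events M X"
    unfolding process_events_def by (rule sigma_algebra_sigma_sets) auto
  have J': "(\<lambda>x. y + x) -` J \<in> sets borel"
    using measurable_sets[of "\<lambda>x. y + x" borel borel J] J by simp
  have "alive J y \<delta> k = (\<Inter>j\<in>{..k}. X (real j * \<delta>) -` ((\<lambda>x. y + x) -` J) \<inter> space M)"
    by (auto simp: alive_def)
  also have "\<dots> \<in> process_events M X"
  proof (intro PE.finite_INT)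
    fix j
    have "\<exists>t A. X (real j * \<delta>) -` ((\<lambda>x. y + x) -` J) \<inter> space M = X t -` A \<inter> space M \<and> 0 \<le> t \<and> A \<in> sets borel"
      using J' d by (intro exI[of _ "real j * \<delta>"] exI[of _ "(\<lambda>x. y + x) -` J"]) auto
    then show "X (real j * \<delta>) -` ((\<lambda>x. y + x) -` J) \<inter> space M \<in> process_events M X"
      unfolding process_events_def by (intro sigma_sets.Basic) blast
  qed auto
  finally show ?thesis .
qed

text \<open>The half-open cells \<open>(k \<delta>, (k + 1) \<delta>]\<close> fit the strict inequality in the definition of survival: if
  T lies in the k-th cell, the grid points strictly before \<open>T + n \<delta>\<close> are those up to \<open>k + n\<close>.\<close>
lemma survive_sums:
  assumes T: "distributed M lborel T (exponential_density \<gamma>)" and gam: "0 < \<gamma>"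
    and ind: "independent_of_process M T X"
    and J: "J \<in> sets borel" and d: "0 < \<delta>"
  shows "(\<lambda>k. (1 - exp (- \<gamma> * \<delta>)) * exp (- \<gamma> * \<delta>) ^ k * prob (alive J y \<delta> (k + n)))
     sums prob (survive T J y \<delta> (real n * \<delta>))"
proof -
  have [measurable]: "T \<in> borel_measurable M" using distributed_measurable[OF T] by simp
  define E where "E k = T -` {real k * \<delta> <.. real (Suc k) * \<delta>} \<inter> space M" for k
  define D where "D = survive T J y \<delta> (real n * \<delta>)"
  have [measurable]: "D \<in> sets M" unfolding D_def using d J by (intro survive_measurable) auto
  have [measurable]: "E k \<in> sets M" for k unfolding E_def by measurable
  have disj: "k = l" if "\<omega> \<in> E k" "\<omega> \<in> E l" for k l \<omega>
  proof -
    have "real k * \<delta> < real (Suc l) * \<delta>" "real l * \<delta> < real (Suc k) * \<delta>"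
      using that by (auto simp: E_def intro: less_le_trans)
    then have "real k < real (Suc l)" "real l < real (Suc k)" using d by (simp_all only: mult_less_cancel_right_pos)
    then show ?thesis by simp
  qed
  have cover: "\<omega> \<in> (\<Union>k. E k)" if om: "\<omega> \<in> space M" and T0: "0 < T \<omega>" for \<omega>
  proof -
    define k where "k = nat (\<lceil>T \<omega> / \<delta>\<rceil> - 1)"
    have "\<lceil>T \<omega> / \<delta>\<rceil> \<ge> 1" using T0 d by (simp add: one_le_ceiling)
    then have k: "real k = real_of_int \<lceil>T \<omega> / \<delta>\<rceil> - 1" by (simp add: k_def)
    have "real k < T \<omega> / \<delta>" "T \<omega> / \<delta> \<le> real k + 1"
      using ceiling_correct[of "T \<omega> / \<delta>"] by (auto simp: k)
    then have "\<omega> \<in> E k" using om d by (auto simp: E_def pos_less_divide_eq pos_divide_le_eq add.commute)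
    then show ?thesis by auto
  qed
  have DE: "D \<inter> E k = E k \<inter> alive J y \<delta> (k + n)" for k
  proof -
    have iff: "real j * \<delta> < T \<omega> + real n * \<delta> \<longleftrightarrow> j \<le> k + n" if "\<omega> \<in> E k" for j \<omega>
    proof
      assume "real j * \<delta> < T \<omega> + real n * \<delta>"
      also have "\<dots> \<le> real (Suc k) * \<delta> + real n * \<delta>" using that by (simp add: E_def)
      also have "\<dots> = real (Suc k + n) * \<delta>" by (simp add: algebra_simps)
      finally have "real j < real (Suc k + n)" using d by (simp only: mult_less_cancel_right_pos)
      then show "j \<le> k + n" by simp
    next
      assume "j \<le> k + n"
      then have "real j * \<delta> \<le> (real k + real n) * \<delta>" using d by (intro mult_right_mono) auto
      also have "\<dots> < T \<omega> + real n * \<delta>" using that by (simp add: E_def algebra_simps)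
      finally show "real j * \<delta> < T \<omega> + real n * \<delta>" .
    qed
    show ?thesis unfolding D_def survive_def alive_def using iff by auto
  qed
  have ae: "AE \<omega> in M. 0 < T \<omega>"
  proof -
    have "prob {\<omega> \<in> space M. 0 < T \<omega>} = 1"
      using exponential_distributedD_gt[OF T _ gam, of 0] by simp
    then show ?thesis by (subst (asm) prob_Collect_eq_1) auto
  qed
  have PE: "prob (E k) = (1 - exp (- \<gamma> * \<delta>)) * exp (- \<gamma> * \<delta>) ^ k" for k
  proof -
    have le: "prob {\<omega> \<in> space M. T \<omega> \<le> real j * \<delta>} = 1 - exp (- \<gamma> * \<delta>) ^ j" for j
      using exponential_distributedD_le[OF T _ gam, of "real j * \<delta>"] d 
      by (simp add: exp_of_nat_mult[symmetric] mult_ac)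
    have "E k = {\<omega> \<in> space M. T \<omega> \<le> real (Suc k) * \<delta>} - {\<omega> \<in> space M. T \<omega> \<le> real k * \<delta>}"
      by (auto simp: E_def)
    then have "prob (E k) = prob {\<omega> \<in> space M. T \<omega> \<le> real (Suc k) * \<delta>} - prob {\<omega> \<in> space M. T \<omega> \<le> real k * \<delta>}"
      using d by (simp only:) (intro finite_measure_Diff, auto intro: order.trans mult_right_mono)
    then show ?thesis unfolding le by (simp add: algebra_simps)
  qed
  have PEA: "prob (E k \<inter> alive J y \<delta> l) = prob (E k) * prob (alive J y \<delta> l)" for k l
    using ind unfolding independent_of_process_def
    by (rule indep_setD) (use alive_process_event[OF J] d in \<open>auto simp: E_def\<close>)
  have "(\<lambda>k. prob (D \<inter> E k)) sums prob (\<Union>k. D \<inter> E k)"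
    using disj by (intro finite_measure_UNION) (auto simp: disjoint_family_on_def)
  also have "prob (\<Union>k. D \<inter> E k) = prob D"
  proof (rule finite_measure_eq_AE)
    show "AE \<omega> in M. \<omega> \<in> (\<Union>k. D \<inter> E k) \<longleftrightarrow> \<omega> \<in> D"
      using ae AE_space by eventually_elim (use cover in auto)
  qed auto
  finally show ?thesis unfolding D_def[symmetric] DE PEA PE .
qed

text \<open>Lack of memory: survival beyond T by a time h is as likely, up to the factor \<open>exp (\<gamma> h)\<close>, as survival
  up to T together with \<open>T > h\<close>.\<close>
lemma survive_shift:
  assumes T: "distributed M lborel T (exponential_density \<gamma>)" and gam: "0 < \<gamma>"
    and ind: "independent_of_process M T X"
    and J: "J \<in> sets borel" and d: "0 < \<delta>"
  shows "prob (survive T J y \<delta> 0) \<le> prob (survive T J y \<delta> (real n * \<delta>)) + (1 - exp (- \<gamma> * (real n * \<delta>)))"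
proof -
  define r where "r = exp (- \<gamma> * \<delta>)"
  have r: "0 < r" "r < 1" using gam d by (auto simp: r_def)
  define p where "p k = prob (alive J y \<delta> k)" for k
  have s0: "(\<lambda>k. (1 - r) * r ^ k * p k) sums prob (survive T J y \<delta> 0)"
    using survive_sums[OF T gam ind J d, of y 0] by (simp add: r_def p_def)
  have sn: "(\<lambda>k. (1 - r) * r ^ k * p (k + n)) sums prob (survive T J y \<delta> (real n * \<delta>))"
    using survive_sums[OF T gam ind J d, of y n] by (simp add: r_def p_def)
  have "(\<lambda>k. (1 - r) * r ^ (k + n) * p (k + n)) sums (prob (survive T J y \<delta> 0) - (\<Sum>k<n. (1 - r) * r ^ k * p k))"
    by (rule sums_split_initial_segment[OF s0])
  then have "prob (survive T J y \<delta> 0) - (\<Sum>k<n. (1 - r) * r ^ k * p k) \<le> prob (survive T J y \<delta> (real n * \<delta>))"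
  proof (rule sums_le[OF _ _ sn, rotated])
    fix k
    have "r ^ (k + n) \<le> r ^ k" using r by (intro power_decreasing) auto
    then show "(1 - r) * r ^ (k + n) * p (k + n) \<le> (1 - r) * r ^ k * p (k + n)"
      using r by (intro mult_right_mono mult_left_mono) (auto simp: p_def)
  qed
  moreover have "(\<Sum>k<n. (1 - r) * r ^ k * p k) \<le> (\<Sum>k<n. (1 - r) * r ^ k)"
    using r by (intro sum_mono mult_right_le_one_le) (auto simp: p_def)
  moreover have "(\<Sum>k<n. (1 - r) * r ^ k) = 1 - r ^ n"
    unfolding sum_distrib_left[symmetric] using r by (simp add: sum_gp_strict)
  moreover have "r ^ n = exp (- \<gamma> * (real n * \<delta>))"
    by (simp add: r_def exp_of_nat_mult[symmetric] mult_ac)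
  ultimately show ?thesis by simp
qed

definition confined :: "('a \<Rightarrow> real) \<Rightarrow> real set \<Rightarrow> real \<Rightarrow> real \<Rightarrow> 'a set" where
  "confined T J y h = (\<Inter>m. survive T J y (1 / 2 ^ m) h)"

lemma confined_iff: "\<omega> \<in> confined T J y h \<longleftrightarrow> 
    \<omega> \<in> space M \<and> (\<forall>m j. real j / 2 ^ m < T \<omega> + h \<longrightarrow> y + X (real j / 2 ^ m) \<omega> \<in> J)"
  by (auto simp: confined_def survive_def)

lemma confined_measurable:
  assumes "J \<in> sets borel" "T \<in> borel_measurable M"
  shows "confined T J y h \<in> sets M"
  unfolding confined_def by (intro sets.countable_INT) (auto intro!: survive_measurable assms)

lemma survive_tendsto_confined:
  assumes "J \<in> sets borel" "T \<in> borel_measurable M"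
  shows "(\<lambda>m. prob (survive T J y (1 / 2 ^ m) h)) \<longlonglongrightarrow> prob (confined T J y h)"
  unfolding confined_def
proof (rule finite_Lim_measure_decseq)
  show "range (\<lambda>m. survive T J y (1 / 2 ^ m) h) \<subseteq> sets M"
    using assms by (auto intro!: survive_measurable)
  show "decseq (\<lambda>m. survive T J y (1 / 2 ^ m) h)"
  proof (rule decseq_SucI)
    fix m
    have e: "real j * (1 / 2 ^ m) = real (2 * j) * (1 / 2 ^ Suc m)" for j by simp
    show "survive T J y (1 / 2 ^ Suc m) h \<subseteq> survive T J y (1 / 2 ^ m) h"
      unfolding survive_def e by blast
  qed
qed

lemma confined_shift:
  assumes T: "distributed M lborel T (exponential_density \<gamma>)" and gam: "0 < \<gamma>"
    and ind: "independent_of_process M T X" and J: "J \<in> sets borel"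
  shows "prob (confined T J y 0) \<le> prob (confined T J y (1 / 2 ^ l)) + (1 - exp (- \<gamma> * (1 / 2 ^ l)))"
proof (rule LIMSEQ_le)
  have Tm: "T \<in> borel_measurable M" using distributed_measurable[OF T] by simp
  show "(\<lambda>m. prob (survive T J y (1 / 2 ^ m) 0)) \<longlonglongrightarrow> prob (confined T J y 0)"
    by (rule survive_tendsto_confined[OF J Tm])
  show "(\<lambda>m. prob (survive T J y (1 / 2 ^ m) (1 / 2 ^ l)) + (1 - exp (- \<gamma> * (1 / 2 ^ l))))
     \<longlonglongrightarrow> prob (confined T J y (1 / 2 ^ l)) + (1 - exp (- \<gamma> * (1 / 2 ^ l)))"
    by (intro tendsto_intros survive_tendsto_confined[OF J Tm])
  have "prob (survive T J y (1 / 2 ^ m) 0) \<le> prob (survive T J y (1 / 2 ^ m) (1 / 2 ^ l)) + (1 - exp (- \<gamma> * (1 / 2 ^ l)))"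
    if "m \<ge> l" for m
  proof -
    have "(2 :: real) ^ m = 2 ^ (m - l) * 2 ^ l" using that by (simp add: power_add[symmetric])
    then have "real (2 ^ (m - l)) * (1 / 2 ^ m) = (1 / 2 ^ l :: real)" by simp
    then show ?thesis using survive_shift[OF T gam ind J, of "1 / 2 ^ m" y "2 ^ (m - l)"] by simp
  qed
  then show "\<exists>N. \<forall>m\<ge>N. prob (survive T J y (1 / 2 ^ m) 0) \<le> prob (survive T J y (1 / 2 ^ m) (1 / 2 ^ l)) + (1 - exp (- \<gamma> * (1 / 2 ^ l)))"
    by blast
qed

end

section \<open>Mollification\<close>

text \<open>The bump is the parabola \<open>6 u (\<epsilon> - u) / \<epsilon>\<^sup>3\<close>, cut off below 0.\<close>
lemma mollifier_exists:
  assumes eps: "0 < (\<epsilon>::real)"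
  shows "\<exists>\<rho> K. continuous_on UNIV \<rho> \<and> (\<forall>u. 0 \<le> \<rho> u) \<and> (\<forall>u. \<rho> u \<le> K) \<and>
    (\<forall>u\<le>0. \<rho> u = 0) \<and> (\<forall>u\<ge>\<epsilon>. \<rho> u = 0) \<and> has_bochner_integral lborel \<rho> (1 :: real)"
proof -
  define q where "q u = 6 * u * (\<epsilon> - u) / \<epsilon> ^ 3" for u
  define \<rho> where "\<rho> u = max 0 (q u)" for u
  have e3: "\<epsilon> ^ 3 > 0" using eps by simp
  have inside: "0 \<le> q u" "q u \<le> 6 * \<epsilon> * \<epsilon> / \<epsilon> ^ 3" if "u \<in> {0..\<epsilon>}" for u
    using that eps e3 by (auto simp: q_def intro!: divide_right_mono mult_mono divide_nonneg_pos)
  have outside: "q u \<le> 0" if "u \<le> 0 \<or> \<epsilon> \<le> u" for u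
    using that eps e3 by (auto simp: q_def divide_le_0_iff mult_le_0_iff)
  have rho_eq: "\<rho> u = q u * indicator {0..\<epsilon>} u" for u
    using inside(1)[of u] outside[of u] by (cases "u \<in> {0..\<epsilon>}") (auto simp: \<rho>_def)
  show ?thesis
  proof (intro exI[of _ \<rho>] exI[of _ "6 * \<epsilon> * \<epsilon> / \<epsilon> ^ 3"] conjI allI impI)
    show "continuous_on UNIV \<rho>" unfolding \<rho>_def q_def using eps by (intro continuous_intros) auto
    show "0 \<le> \<rho> u" for u by (simp add: \<rho>_def)
    show "\<rho> u \<le> 6 * \<epsilon> * \<epsilon> / \<epsilon> ^ 3" for u using inside(2)[of u] eps by (auto simp: rho_eq indicator_def)
    show "u \<le> 0 \<Longrightarrow> \<rho> u = 0" for u using outside[of u] by (auto simp: \<rho>_def)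
    show "\<epsilon> \<le> u \<Longrightarrow> \<rho> u = 0" for u using outside[of u] by (auto simp: \<rho>_def)
    define Q where "Q u = (3 * u\<^sup>2 * \<epsilon> - 2 * u ^ 3) / \<epsilon> ^ 3" for u
    have "has_bochner_integral lborel (\<lambda>u. q u * indicator {0..\<epsilon>} u) (Q \<epsilon> - Q 0)"
    proof (rule has_bochner_integral_FTC_Icc_real)
      fix u assume "0 \<le> u" "u \<le> \<epsilon>"
      show "DERIV Q u :> q u" unfolding Q_def q_def
        using eps by (auto intro!: derivative_eq_intros simp: power2_eq_square field_simps)
      show "isCont q u" unfolding q_def using eps by (intro continuous_intros) auto
    qed (use eps in auto)
    moreover have "Q \<epsilon> - Q 0 = 1" using eps by (simp add: Q_def power2_eq_square power3_eq_cube)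
    ultimately show "has_bochner_integral lborel \<rho> 1" by (simp add: rho_eq[abs_def])
  qed
qed

lemma mollify_close:
  fixes F \<rho> :: "real \<Rightarrow> real"
  assumes rho: "\<And>u. 0 \<le> \<rho> u" "\<And>u. u \<le> 0 \<Longrightarrow> \<rho> u = 0" "\<And>u. \<epsilon> \<le> u \<Longrightarrow> \<rho> u = 0"
      "has_bochner_integral lborel \<rho> 1"
    and Fi: "integrable lborel (\<lambda>w. \<rho> (z + - w) * F w)"
    and close: "\<And>u. z - \<epsilon> \<le> u \<Longrightarrow> u \<le> z \<Longrightarrow> \<bar>F u - k\<bar> \<le> \<eta>"
  shows "\<bar>(LINT w|lborel. \<rho> (z + - w) * F w) - k\<bar> \<le> \<eta>"
proof -
  have ri: "integrable lborel (\<lambda>w. \<rho> (z + - w))" 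
    using lborel_integrable_real_affine[of \<rho> "-1" z] rho(4) by (simp add: has_bochner_integral_iff)
  have rv: "(LINT w|lborel. \<rho> (z + - w)) = 1"
    using lborel_integral_real_affine[of "-1" \<rho> z] rho(4) by (simp add: has_bochner_integral_iff)
  have "(LINT w|lborel. \<rho> (z + - w) * F w) - k = (LINT w|lborel. \<rho> (z + - w) * F w) - (LINT w|lborel. \<rho> (z + - w) * k)"
    using rv by simp
  also have "\<dots> = (LINT w|lborel. \<rho> (z + - w) * F w - \<rho> (z + - w) * k)"
    by (rule Bochner_Integration.integral_diff[symmetric]) (intro Fi integrable_mult_left ri)+
  also have "\<bar>\<dots>\<bar> \<le> (LINT w|lborel. \<bar>\<rho> (z + - w) * F w - \<rho> (z + - w) * k\<bar>)" by (rule integral_abs_bound)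
  also have "\<dots> \<le> (LINT w|lborel. \<rho> (z + - w) * \<eta>)"
  proof (rule integral_mono)
    show "integrable lborel (\<lambda>w. \<bar>\<rho> (z + - w) * F w - \<rho> (z + - w) * k\<bar>)"
      by (intro integrable_abs Bochner_Integration.integrable_diff Fi integrable_mult_left ri)
    show "integrable lborel (\<lambda>w. \<rho> (z + - w) * \<eta>)" by (intro integrable_mult_left ri)
    fix w
    have eq: "\<bar>\<rho> (z + - w) * F w - \<rho> (z + - w) * k\<bar> = \<rho> (z + - w) * \<bar>F w - k\<bar>"
      using rho(1)[of "z + - w"] by (simp add: right_diff_distrib[symmetric] abs_mult)
    show "\<bar>\<rho> (z + - w) * F w - \<rho> (z + - w) * k\<bar> \<le> \<rho> (z + - w) * \<eta>"
    proof (cases "z - \<epsilon> \<le> w \<and> w \<le> z")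
      case True
      then show ?thesis unfolding eq using close[of w] rho(1) by (intro mult_left_mono) auto
    next
      case False
      then have "\<rho> (z + - w) = 0" using rho(2)[of "z + - w"] rho(3)[of "z + - w"] by linarith
      then show ?thesis by simp
    qed
  qed
  also have "\<dots> = \<eta>" using rv by simp
  finally show ?thesis .
qed

context spectrally_negative_levy_process begin

text \<open>The convolution \<open>F'\<close> of F with a bump satisfies Dynkin's formula with
  \<open>G = \<alpha> \<rho> - \<beta> R\<close>, where R, the distribution function of the bump, replaces the indicator of the positive
  half-line. Mollification moves values of F by at most \<open>\<epsilon>\<close> to the right, so \<open>F'\<close> is small outside
  the shrunk interval if F is small in the neighbourhoods of 0 and c named here.\<close>
lemma mollified_grid_limit:
  assumes T: "distributed M lborel T (exponential_density \<gamma>)" and gam: "0 < \<gamma>"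
    and ind: "independent_of_process M T X"
    and th0: "0 \<le> \<theta>\<^sub>0" 
    and F: "F \<in> borel_measurable borel" "\<And>\<theta>. \<theta> > \<theta>\<^sub>0 \<Longrightarrow> integrable lborel (\<lambda>x. exp (- \<theta> * x) * F x)"
    and ne: "\<And>\<theta>. \<theta> > \<theta>\<^sub>0 \<Longrightarrow> \<psi> \<theta> \<noteq> \<gamma>"
    and LF: "\<And>\<theta>. \<theta> > \<theta>\<^sub>0 \<Longrightarrow> bilaplace F \<theta> = (\<alpha> - \<beta> / \<theta>) / (\<psi> \<theta> - \<gamma>)"
    and eps: "0 < \<epsilon>" and x: "x \<in> {2 * \<epsilon>..c - \<epsilon>}" and eta: "0 \<le> \<eta>"
    and small: "\<And>u. u < 2 * \<epsilon> \<Longrightarrow> \<bar>F u\<bar> \<le> \<eta>" "\<And>u. u \<in> {c - 2 * \<epsilon>..c} \<Longrightarrow> \<bar>F u\<bar> \<le> \<eta>"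
    and close: "\<And>u. u \<in> {x - \<epsilon>..x} \<Longrightarrow> \<bar>F u - F x\<bar> \<le> \<eta>"
  shows "\<bar>F x - \<beta> / \<gamma> * prob (confined T {2 * \<epsilon>..c - \<epsilon>} x 0)\<bar> \<le> 2 * \<eta>"
proof -
  obtain \<rho> K where "continuous_on UNIV \<rho> \<and> (\<forall>u. 0 \<le> \<rho> u) \<and> (\<forall>u. \<rho> u \<le> K) \<and>
    (\<forall>u\<le>0. \<rho> u = 0) \<and> (\<forall>u\<ge>\<epsilon>. \<rho> u = 0) \<and> has_bochner_integral lborel \<rho> (1 :: real)"
    using mollifier_exists[OF eps] by blast
  then have rho: "continuous_on UNIV \<rho>" "0 \<le> \<rho> u" "\<rho> u \<le> K" "u \<le> 0 \<Longrightarrow> \<rho> u = 0" "\<epsilon> \<le> u \<Longrightarrow> \<rho> u = 0"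
    "has_bochner_integral lborel \<rho> 1" for u by auto
  have K0: "0 \<le> K" using rho(2)[of 0] rho(3)[of 0] by simp
  define \<theta>\<^sub>1 where "\<theta>\<^sub>1 = \<theta>\<^sub>0 + 1"
  have th1: "\<theta>\<^sub>0 < \<theta>\<^sub>1" "0 < \<theta>\<^sub>1" "0 \<le> \<theta>\<^sub>1" using th0 by (auto simp: \<theta>\<^sub>1_def)
  have [measurable]: "\<rho> \<in> borel_measurable borel" by (rule borel_measurable_continuous_onI[OF rho(1)])
  note [measurable] = F(1)
  have rho_exp: "\<bar>\<rho> u\<bar> \<le> K * exp (\<theta>\<^sub>1 * u)" for u
  proof (cases "u \<le> 0")
    case False
    then have "K * 1 \<le> K * exp (\<theta>\<^sub>1 * u)" using K0 th1 by (intro mult_left_mono) auto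
    then show ?thesis using rho(2,3)[of u] by simp
  qed (use rho(4) K0 in simp)
  have ri: "integrable lborel (\<lambda>x. exp (- \<theta> * x) * \<rho> x)" if "0 \<le> \<theta>" for \<theta>
  proof (rule Bochner_Integration.integrable_bound)
    show "integrable lborel \<rho>" using rho(6) by (simp add: has_bochner_integral_iff)
    show "AE x in lborel. norm (exp (- \<theta> * x) * \<rho> x) \<le> norm (\<rho> x)"
    proof (rule AE_I2)
      fix x show "norm (exp (- \<theta> * x) * \<rho> x) \<le> norm (\<rho> x)"
        using that rho(4)[of x] by (cases "x \<le> 0") (auto simp: abs_mult mult_left_le_one_le)
    qed
  qed simp
  define H :: "real \<Rightarrow> real" where "H = indicator {0..}"
  have [measurable]: "H \<in> borel_measurable borel" unfolding H_def by measurable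
  have Fe: "integrable lborel (\<lambda>w. exp (\<theta> * - w) * F w)" "(LINT w|lborel. exp (\<theta> * - w) * F w) = bilaplace F \<theta>"
    if "\<theta> > \<theta>\<^sub>0" for \<theta>
    using F(2)[OF that] by (auto simp: bilaplace_def)
  have He: "integrable lborel (\<lambda>w. exp (\<theta> * - w) * H w)" "(LINT w|lborel. exp (\<theta> * - w) * H w) = 1 / \<theta>"
    if "\<theta> > \<theta>\<^sub>0" for \<theta>
    using exp_integral_atLeast[of \<theta>] that th0 by (auto simp: H_def)
  define F' where "F' z = (LINT w|lborel. \<rho> (z + - w) * F w)" for z
  define R where "R z = (LINT w|lborel. \<rho> (z + - w) * H w)" for z
  define G where "G z = \<alpha> * \<rho> z - \<beta> * R z" for z
  define C where "C = K * (LINT w|lborel. \<bar>exp (\<theta>\<^sub>1 * - w) * F w\<bar>)"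
  have um: "(\<lambda>w::real. - w) \<in> borel_measurable lborel" by simp
  have F'_int: "integrable lborel (\<lambda>w. \<rho> (z + - w) * F w)" for z
    by (rule mixture_bound(1)[OF _ _ _ rho_exp Fe(1)[OF th1(1)]]) auto
  have F'_bd: "\<bar>F' z\<bar> \<le> C * exp (\<theta>\<^sub>1 * z)" for z
    unfolding F'_def C_def by (rule mixture_bound(2)[OF _ _ _ rho_exp Fe(1)[OF th1(1)]]) auto
  have F'_cont: "continuous_on UNIV F'"
    unfolding F'_def by (rule mixture_continuous[OF _ _ rho(1) th1(3) rho_exp Fe(1)[OF th1(1)]]) auto
  have R_cont: "continuous_on UNIV R"
    unfolding R_def by (rule mixture_continuous[OF _ _ rho(1) th1(3) rho_exp He(1)[OF th1(1)]]) auto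
  have R_int: "integrable lborel (\<lambda>w. \<rho> (z + - w) * H w)" for z
    by (rule mixture_bound(1)[OF _ _ _ rho_exp He(1)[OF th1(1)]]) auto
  have R_close: "\<bar>R z - k\<bar> \<le> \<eta>'" if "\<And>u. z - \<epsilon> \<le> u \<Longrightarrow> u \<le> z \<Longrightarrow> \<bar>H u - k\<bar> \<le> \<eta>'" for z k \<eta>'
    unfolding R_def using that by (intro mollify_close[OF rho(2,4,5,6) R_int]) auto
  have R_abs: "\<bar>R z\<bar> \<le> 1" for z using R_close[of z 0 1] by (auto simp: H_def indicator_def)
  have R_one: "R z = 1" if "\<epsilon> \<le> z" for z using R_close[of z 1 0] that by (auto simp: H_def indicator_def)
  have R_zero: "R z = 0" if "z < 0" for z using R_close[of z 0 0] that by (auto simp: H_def indicator_def)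
  have F'_close: "\<bar>F' z - k\<bar> \<le> \<eta>'" if "\<And>u. z - \<epsilon> \<le> u \<Longrightarrow> u \<le> z \<Longrightarrow> \<bar>F u - k\<bar> \<le> \<eta>'" for z k \<eta>'
    unfolding F'_def using that by (intro mollify_close[OF rho(2,4,5,6) F'_int]) auto
  have F'_meas[measurable]: "F' \<in> borel_measurable borel" by (rule borel_measurable_continuous_onI[OF F'_cont])
  have G_cont: "continuous_on UNIV G" unfolding G_def by (intro continuous_intros rho(1) R_cont)
  have G_meas: "G \<in> borel_measurable borel" by (rule borel_measurable_continuous_onI[OF G_cont])
  define D where "D = \<bar>\<alpha>\<bar> * K + \<bar>\<beta>\<bar>"
  have D0: "0 \<le> D" using K0 by (simp add: D_def)
  have G_bd: "\<bar>G z\<bar> \<le> D" for z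
  proof -
    have "\<bar>G z\<bar> \<le> \<bar>\<alpha>\<bar> * \<bar>\<rho> z\<bar> + \<bar>\<beta>\<bar> * \<bar>R z\<bar>"
      unfolding G_def by (intro order.trans[OF abs_triangle_ineq4]) (simp add: abs_mult)
    also have "\<dots> \<le> \<bar>\<alpha>\<bar> * K + \<bar>\<beta>\<bar> * 1"
      using rho(2,3)[of z] R_abs[of z] by (intro add_mono mult_left_mono) auto
    finally show ?thesis by (simp add: D_def)
  qed
  have G_exp: "\<bar>G z\<bar> \<le> D * exp (\<theta>\<^sub>1 * z)" for z
  proof (cases "z < 0")
    case True
    then have "G z = 0" using rho(4)[of z] R_zero by (simp add: G_def)
    then show ?thesis using D0 by simp
  next
    case False
    then have "D * 1 \<le> D * exp (\<theta>\<^sub>1 * z)" using D0 th1 by (intro mult_left_mono) auto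
    then show ?thesis using G_bd[of z] by simp
  qed
  have G_const: "G z = - \<beta>" if "\<epsilon> \<le> z" for z using rho(5)[OF that] R_one[OF that] by (simp add: G_def)
  have L1: "integrable lborel (\<lambda>x. exp (- \<theta> * x) * F' x)" "bilaplace F' \<theta> = bilaplace F \<theta> * bilaplace \<rho> \<theta>"
    if th: "\<theta> > \<theta>\<^sub>0" for \<theta>
    using bilaplace_mixture[OF lborel.sigma_finite_measure_axioms um _ _ Fe(1)[OF th] ri] Fe(2)[OF th] th th0
    unfolding F'_def by auto
  have L2: "integrable lborel (\<lambda>x. exp (- \<theta> * x) * R x)" "bilaplace R \<theta> = 1 / \<theta> * bilaplace \<rho> \<theta>"
    if th: "\<theta> > \<theta>\<^sub>0" for \<theta>
    using bilaplace_mixture[OF lborel.sigma_finite_measure_axioms um _ _ He(1)[OF th] ri] He(2)[OF th] th th0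
    unfolding R_def by auto
  have G_eq: "exp (- \<theta> * x) * G x = \<alpha> * (exp (- \<theta> * x) * \<rho> x) - \<beta> * (exp (- \<theta> * x) * R x)" for \<theta> x
    by (simp add: G_def algebra_simps)
  have L3: "integrable lborel (\<lambda>x. exp (- \<theta> * x) * G x)" "bilaplace G \<theta> = (\<alpha> - \<beta> / \<theta>) * bilaplace \<rho> \<theta>"
    if th: "\<theta> > \<theta>\<^sub>0" for \<theta>
  proof -
    have i: "integrable lborel (\<lambda>x. exp (- \<theta> * x) * \<rho> x)" using ri th th0 by simp
    show "integrable lborel (\<lambda>x. exp (- \<theta> * x) * G x)"
      unfolding G_eq by (intro Bochner_Integration.integrable_diff integrable_mult_right i L2 th)
    have "bilaplace G \<theta> = \<alpha> * bilaplace \<rho> \<theta> - \<beta> * bilaplace R \<theta>"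
      unfolding bilaplace_def G_eq using i L2(1)[OF th] by simp
    then show "bilaplace G \<theta> = (\<alpha> - \<beta> / \<theta>) * bilaplace \<rho> \<theta>" 
      unfolding L2(2)[OF th] by (simp add: algebra_simps)
  qed
  have dynkin: "exp (- \<gamma> * t) * expectation (\<lambda>\<omega>. F' (y + X t \<omega>)) = F' y + 
    (LINT s|lborel. exp (- \<gamma> * s) * indicator {0..t} s * expectation (\<lambda>\<omega>. G (y + X s \<omega>)))" if t: "0 \<le> t" for t y
  proof (rule dynkin_formula[OF th0 t ne F'_cont F'_bd G_cont G_exp th1(1) L1(1) L3(1)])
    show "(\<psi> \<theta> - \<gamma>) * bilaplace F' \<theta> = bilaplace G \<theta>" if "\<theta> > \<theta>\<^sub>0" for \<theta>
      unfolding L1(2)[OF that] L3(2)[OF that] LF[OF that] using ne[OF that] by simp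
  qed
  define J where "J = {2 * \<epsilon>..c - \<epsilon>}"
  have J_sets: "J \<in> sets borel" and xJ: "x \<in> J" using x by (auto simp: J_def)
  define C' where "C' = C * exp (\<theta>\<^sub>1 * c) + 1"
  have "0 \<le> C * exp (\<theta>\<^sub>1 * c)" using F'_bd[of c] by (auto intro: order.trans[OF abs_ge_zero])
  then have C': "C' > 0" by (simp add: C'_def)
  have C0: "0 \<le> C" using F'_bd[of 0] by (simp add: order.trans[OF abs_ge_zero])
  have main: "\<bar>F' x - \<beta> / \<gamma> * prob (confined T J x 0)\<bar> \<le> \<eta> + e" if e: "0 < e" for e
  proof -
    \<comment> \<open>The total error of the grid estimate is \<open>2 \<kappa> \<delta> / (1 - exp (- \<gamma> \<delta>))\<close>, and the quotient
      \<open>\<delta> / (1 - exp (- \<gamma> \<delta>))\<close> is eventually below \<open>2 / \<gamma>\<close>.\<close>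
    define \<kappa> where "\<kappa> = e * \<gamma> / 4"
    have kap: "0 < \<kappa>" using e gam by (simp add: \<kappa>_def)
    have E1: "eventually (\<lambda>\<delta>. \<forall>y\<ge>2 * \<epsilon>. 
      \<bar>exp (- \<gamma> * \<delta>) * expectation (\<lambda>\<omega>. F' (y + X \<delta> \<omega>)) - F' y + \<beta> * ((1 - exp (- \<gamma> * \<delta>)) / \<gamma>)\<bar> \<le> \<kappa> * \<delta>) (at_right 0)"
      by (rule one_step_estimate[OF dynkin gam G_meas G_bd G_const eps kap])
    have E2: "eventually (\<lambda>\<delta>. expectation (\<lambda>\<omega>. exp (\<theta>\<^sub>1 * X \<delta> \<omega>) * indicator {\<epsilon><..} (X \<delta> \<omega>)) \<le> \<kappa> / C' * \<delta>) (at_right 0)"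
      using kap C' by (intro small_time_up eps th1) simp
    have "((\<lambda>\<delta>. \<delta> / (1 - exp (- \<gamma> * \<delta>))) \<longlongrightarrow> inverse \<gamma>) (at_right 0)" using gam by real_asymp
    then have E3: "eventually (\<lambda>\<delta>. \<delta> / (1 - exp (- \<gamma> * \<delta>)) < 2 / \<gamma>) (at_right 0)"
      using gam by (intro order_tendstoD(2)) (auto simp: divide_inverse)
    have E4: "eventually (\<lambda>\<delta>. 0 < \<delta>) (at_right (0::real))" by (rule eventually_at_right_less)
    have "eventually (\<lambda>\<delta>. \<bar>F' x - \<beta> / \<gamma> * prob (survive T J x \<delta> 0)\<bar> \<le> \<eta> + e) (at_right 0)"
      using E1 E2 E3 E4
    proof eventually_elim
      case (elim \<delta>)
      note d = elim(4)
      have Xm[measurable]: "X \<delta> \<in> borel_measurable M" using d by (intro random_variable_X) simp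
      have grid: "\<bar>F' x - \<beta> / \<gamma> * (\<Sum>k. (1 - exp (- \<gamma> * \<delta>)) * exp (- \<gamma> * \<delta>) ^ k * prob (alive J x \<delta> k))\<bar>
        \<le> \<eta> + 2 * (\<kappa> * \<delta>) / (1 - exp (- \<gamma> * \<delta>))"
      proof (rule grid_estimate[OF gam d th1(3) F'_meas F'_bd J_sets xJ eta, where c = c and B = "C * exp (\<theta>\<^sub>1 * c)"])
        show "0 \<le> \<kappa> * \<delta>" using kap d by simp
        fix z
        show "\<bar>exp (- \<gamma> * \<delta>) * expectation (\<lambda>\<omega>. F' (z + X \<delta> \<omega>)) - F' z + \<beta> * ((1 - exp (- \<gamma> * \<delta>)) / \<gamma>)\<bar> \<le> \<kappa> * \<delta>"
          if "z \<in> J" using elim(1) that by (simp add: J_def)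
        show "\<bar>F' z\<bar> \<le> \<eta>" if z: "z \<le> c" "z \<notin> J"
        proof -
          have "\<bar>F' z - 0\<bar> \<le> \<eta>"
          proof (rule F'_close)
            fix u assume "z - \<epsilon> \<le> u" "u \<le> z"
            then show "\<bar>F u - 0\<bar> \<le> \<eta>" using small(1)[of u] small(2)[of u] z by (cases "z < 2 * \<epsilon>") (auto simp: J_def)
          qed
          then show ?thesis by simp
        qed
        show "\<bar>F' z\<bar> \<le> C * exp (\<theta>\<^sub>1 * c)" if z: "z \<in> J"
        proof (rule order.trans[OF F'_bd])
          show "C * exp (\<theta>\<^sub>1 * z) \<le> C * exp (\<theta>\<^sub>1 * c)"
            using z eps th1 C0 by (intro mult_left_mono) (auto simp: J_def)
        qed
        show "expectation (\<lambda>\<omega>. indicator {c<..} (z + X \<delta> \<omega>) * \<bar>F' (z + X \<delta> \<omega>)\<bar>) \<le> \<kappa> * \<delta>" if z: "z \<in> J"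
        proof -
          have ei: "integrable M (\<lambda>\<omega>. exp (\<theta>\<^sub>1 * X \<delta> \<omega>) * indicator {\<epsilon><..} (X \<delta> \<omega>))"
            by (rule Bochner_Integration.integrable_bound[OF exp_moment(1)[OF less_imp_le[OF d] th1(3)]]) (auto simp: indicator_def)
          have b: "indicator {c<..} (z + X \<delta> \<omega>) * \<bar>F' (z + X \<delta> \<omega>)\<bar> \<le> C' * (exp (\<theta>\<^sub>1 * X \<delta> \<omega>) * indicator {\<epsilon><..} (X \<delta> \<omega>))" for \<omega>
          proof (cases "c < z + X \<delta> \<omega>")
            case True
            then have X: "\<epsilon> < X \<delta> \<omega>" using z by (simp add: J_def)
            have "\<bar>F' (z + X \<delta> \<omega>)\<bar> \<le> C * exp (\<theta>\<^sub>1 * (z + X \<delta> \<omega>))" by (rule F'_bd)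
            also have "\<dots> \<le> C * exp (\<theta>\<^sub>1 * (c + X \<delta> \<omega>))"
              using z eps th1 C0 by (intro mult_left_mono) (auto simp: J_def)
            also have "\<dots> = C * exp (\<theta>\<^sub>1 * c) * exp (\<theta>\<^sub>1 * X \<delta> \<omega>)" by (simp add: distrib_left exp_add)
            also have "\<dots> \<le> C' * exp (\<theta>\<^sub>1 * X \<delta> \<omega>)" by (intro mult_right_mono) (auto simp: C'_def)
            finally show ?thesis using True X by simp
          next
            case False then show ?thesis using C' by simp
          qed
          have "expectation (\<lambda>\<omega>. indicator {c<..} (z + X \<delta> \<omega>) * \<bar>F' (z + X \<delta> \<omega>)\<bar>) \<le> expectation (\<lambda>\<omega>. C' * (exp (\<theta>\<^sub>1 * X \<delta> \<omega>) * indicator {\<epsilon><..} (X \<delta> \<omega>)))"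
          proof (rule integral_mono_AE')
            show "integrable M (\<lambda>\<omega>. C' * (exp (\<theta>\<^sub>1 * X \<delta> \<omega>) * indicator {\<epsilon><..} (X \<delta> \<omega>)))" by (intro integrable_mult_right ei)
          qed (use b C' in auto)
          also have "\<dots> \<le> C' * (\<kappa> / C' * \<delta>)"
            unfolding integral_mult_right_zero by (rule mult_left_mono[OF elim(2)]) (use C' in simp)
          also have "\<dots> = \<kappa> * \<delta>" using C' by simp
          finally show ?thesis .
        qed
      qed
      have sum_eq: "(\<Sum>k. (1 - exp (- \<gamma> * \<delta>)) * exp (- \<gamma> * \<delta>) ^ k * prob (alive J x \<delta> k)) = prob (survive T J x \<delta> 0)"
        using sums_unique[OF survive_sums[OF T gam ind J_sets d, of x 0]] by simp
      have "2 * (\<kappa> * \<delta>) / (1 - exp (- \<gamma> * \<delta>)) \<le> e"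
      proof -
        have "2 * (\<kappa> * \<delta>) / (1 - exp (- \<gamma> * \<delta>)) = 2 * \<kappa> * (\<delta> / (1 - exp (- \<gamma> * \<delta>)))" by simp
        also have "\<dots> \<le> 2 * \<kappa> * (2 / \<gamma>)" using elim(3) kap by (intro mult_left_mono) auto
        also have "\<dots> = e" using gam by (simp add: \<kappa>_def)
        finally show ?thesis .
      qed
      then show ?case using grid unfolding sum_eq by linarith
    qed
    moreover have "filterlim (\<lambda>m. 1 / 2 ^ m) (at_right (0::real)) sequentially" by real_asymp
    ultimately have ev: "eventually (\<lambda>m. \<bar>F' x - \<beta> / \<gamma> * prob (survive T J x (1 / 2 ^ m) 0)\<bar> \<le> \<eta> + e) sequentially"
      by (rule eventually_compose_filterlim)
    have "(\<lambda>m. \<bar>F' x - \<beta> / \<gamma> * prob (survive T J x (1 / 2 ^ m) 0)\<bar>) \<longlonglongrightarrow> \<bar>F' x - \<beta> / \<gamma> * prob (confined T J x 0)\<bar>"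
      using distributed_measurable[OF T] by (intro tendsto_intros survive_tendsto_confined J_sets) simp
    then show ?thesis by (rule tendsto_upperbound[OF _ ev]) simp
  qed
  have "\<bar>F' x - \<beta> / \<gamma> * prob (confined T J x 0)\<bar> \<le> \<eta>" by (rule field_le_epsilon[OF main])
  moreover have "\<bar>F' x - F x\<bar> \<le> \<eta>" by (rule F'_close) (use close in auto)
  ultimately show ?thesis unfolding J_def by linarith
qed

end

section \<open>The running extrema\<close>

text \<open>One-sided limits bound the path near each point, and compactness does the rest. Boundedness
  is needed because the infimum or supremum of an unbounded set of reals is an unspecified number.\<close>
lemma cadlag_bounded:
  assumes x: "cadlag x" and t: "0 \<le> t"
  obtains B where "\<And>s. s \<in> {0..t} \<Longrightarrow> \<bar>x s\<bar> \<le> B"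
proof -
  define P where "P u v \<longleftrightarrow> (\<exists>B. \<forall>s\<in>{u..v} \<inter> {0..t}. \<bar>x s\<bar> \<le> B)" for u v
  have "P 0 t"
  proof (rule Bolzano[OF t])
    fix u v w assume "P u v" "P v w" "u \<le> v" "v \<le> w"
    then obtain B1 B2 where "\<And>s. s \<in> {u..v} \<inter> {0..t} \<Longrightarrow> \<bar>x s\<bar> \<le> B1" "\<And>s. s \<in> {v..w} \<inter> {0..t} \<Longrightarrow> \<bar>x s\<bar> \<le> B2"
      unfolding P_def by blast
    then have "\<bar>x s\<bar> \<le> max B1 B2" if "s \<in> {u..w} \<inter> {0..t}" for s
      using that by (cases "s \<le> v") (force simp: le_max_iff_disj)+
    then show "P u w" unfolding P_def by blast
  next
    fix u assume u: "0 \<le> u" "u \<le> t"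
    have "eventually (\<lambda>s. dist (x s) (x u) < 1) (at_right u)"
      using x u(1) by (intro tendstoD) (auto simp: cadlag_def)
    then obtain d1 where d1: "u < d1" "\<And>s. u < s \<Longrightarrow> s < d1 \<Longrightarrow> \<bar>x s - x u\<bar> < 1"
      unfolding eventually_at_right_field by (auto simp: dist_real_def)
    obtain d2 l where d2: "d2 < u" "\<And>s. 0 \<le> s \<Longrightarrow> d2 < s \<Longrightarrow> s < u \<Longrightarrow> \<bar>x s - l\<bar> < 1"
    proof (cases "u = 0")
      case True then show ?thesis by (intro that[of "- 1"]) auto
    next
      case False
      then have "\<exists>l. (x \<longlongrightarrow> l) (at_left u)" using x u(1) by (simp add: cadlag_def)
      then obtain l where "(x \<longlongrightarrow> l) (at_left u)" ..
      then have "eventually (\<lambda>s. dist (x s) l < 1) (at_left u)" by (rule tendstoD) simp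
      then obtain d where "d < u" "\<And>s. d < s \<Longrightarrow> s < u \<Longrightarrow> \<bar>x s - l\<bar> < 1"
        unfolding eventually_at_left_field by (auto simp: dist_real_def)
      then show ?thesis by (intro that) auto
    qed
    show "\<exists>d>0. \<forall>a b. a \<le> u \<and> u \<le> b \<and> b - a < d \<longrightarrow> P a b"
    proof (intro exI[of _ "min (d1 - u) (u - d2)"] conjI allI impI)
      show "0 < min (d1 - u) (u - d2)" using d1 d2 by simp
      fix a b assume ab: "a \<le> u \<and> u \<le> b \<and> b - a < min (d1 - u) (u - d2)"
      show "P a b" unfolding P_def
      proof (intro exI[of _ "\<bar>x u\<bar> + \<bar>l\<bar> + 1"] ballI)
        fix s assume s: "s \<in> {a..b} \<inter> {0..t}"
        consider "s < u" | "s = u" | "u < s" by linarith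
        then show "\<bar>x s\<bar> \<le> \<bar>x u\<bar> + \<bar>l\<bar> + 1"
        proof cases
          case 1 then have "\<bar>x s - l\<bar> < 1" using s ab by (intro d2(2)) auto
          then show ?thesis by linarith
        next
          case 3 then have "\<bar>x s - x u\<bar> < 1" using s ab by (intro d1(2)) auto
          then show ?thesis by linarith
        qed simp
      qed
    qed
  qed
  then obtain B where "\<And>s. s \<in> {0..t} \<Longrightarrow> \<bar>x s\<bar> \<le> B" unfolding P_def by blast
  then show ?thesis by (rule that)
qed

text \<open>These closed intervals exhaust the open interval from 0 to c.\<close>
definition inner_interval :: "real \<Rightarrow> nat \<Rightarrow> real set" where
  "inner_interval c i = {2 * (1 / (real i + 1))..c - 1 / (real i + 1)}"

lemma inner_interval_mono: "i \<le> j \<Longrightarrow> inner_interval c i \<subseteq> inner_interval c j"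
proof -
  assume "i \<le> j"
  then have "1 / (real j + 1) \<le> 1 / (real i + 1)" by (intro divide_left_mono) auto
  then show ?thesis by (auto simp: inner_interval_def)
qed

lemma inner_interval_sets: "inner_interval c i \<in> sets borel" by (simp add: inner_interval_def)

context levy_process begin

lemma incseq_confined: "incseq (\<lambda>i. confined T (inner_interval c i) y h)"
  unfolding incseq_def
proof (intro allI impI)
  fix i j :: nat assume "i \<le> j"
  then show "confined T (inner_interval c i) y h \<subseteq> confined T (inner_interval c j) y h"
    using subsetD[OF inner_interval_mono[of i j c]] by (simp add: subset_iff confined_iff)
qed

lemma confined_Union_tendsto:
  assumes "T \<in> borel_measurable M"
  shows "(\<lambda>i. prob (confined T (inner_interval c i) y h)) \<longlonglongrightarrow> prob (\<Union>i. confined T (inner_interval c i) y h)"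
  using confined_measurable[OF inner_interval_sets assms]
  by (intro finite_Lim_measure_incseq incseq_confined) auto

text \<open>A path whose infimum and supremum over \<open>[0, T]\<close> lie strictly inside the interval stays, by
  right-continuity at T, inside some closed subinterval for a little longer. Conversely, dyadic times
  up to a bit beyond T determine the path on all of \<open>[0, T]\<close>.\<close>
lemma extrema_in_interval_iff:
  assumes om: "\<omega> \<in> space M" and T0: "0 \<le> T \<omega>"
  shows "a < running_inf X (T \<omega>) \<omega> \<and> running_sup X (T \<omega>) \<omega> < b
    \<longleftrightarrow> \<omega> \<in> (\<Union>l. \<Union>i. confined T (inner_interval (b - a) i) (- a) (1 / 2 ^ l))"
proof
  assume "\<omega> \<in> (\<Union>l. \<Union>i. confined T (inner_interval (b - a) i) (- a) (1 / 2 ^ l))"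
  then obtain l i where conf: "\<omega> \<in> confined T (inner_interval (b - a) i) (- a) (1 / 2 ^ l)" by blast
  define e where "e = 1 / (real i + 1)"
  have e: "e > 0" by (simp add: e_def)
  have in_inner: "- a + X s \<omega> \<in> inner_interval (b - a) i" if s: "s \<in> {0..T \<omega>}" for s
  proof (rule Lim_in_closed_set)
    show "closed (inner_interval (b - a) i)" by (simp add: inner_interval_def)
    let ?u = "\<lambda>n. (real (nat \<lfloor>s * 2 ^ n\<rfloor>) + 1) / 2 ^ n"
    show "(\<lambda>n. - a + X (?u n) \<omega>) \<longlonglongrightarrow> - a + X s \<omega>"
      using s by (intro tendsto_intros dyadic_limit om) auto
    have "eventually (\<lambda>n. ?u n \<in> {s<..<T \<omega> + 1 / 2 ^ l}) sequentially"
      using s by (intro eventually_compose_filterlim[OF eventually_at_right_real dyadic_above_at_right])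
        (auto intro: add_pos_nonneg le_less_trans[of s "T \<omega>"])
    then show "eventually (\<lambda>n. - a + X (?u n) \<omega> \<in> inner_interval (b - a) i) sequentially"
    proof eventually_elim
      case (elim n)
      have "real (Suc (nat \<lfloor>s * 2 ^ n\<rfloor>)) / 2 ^ n = ?u n" by simp
      then show ?case using conf elim unfolding confined_iff by (metis greaterThanLessThan_iff)
    qed
  qed simp
  have le: "a + 2 * e \<le> X s \<omega> \<and> X s \<omega> \<le> b - e" if "s \<in> {0..T \<omega>}" for s
    using in_inner[OF that] by (auto simp: inner_interval_def e_def)
  have ne: "{0..T \<omega>} \<noteq> {}" using T0 by simp
  have "a + 2 * e \<le> running_inf X (T \<omega>) \<omega>" unfolding running_inf_def
    using le by (intro cINF_greatest[OF ne]) auto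
  moreover have "running_sup X (T \<omega>) \<omega> \<le> b - e" unfolding running_sup_def
    using le by (intro cSUP_least[OF ne]) auto
  ultimately show "a < running_inf X (T \<omega>) \<omega> \<and> running_sup X (T \<omega>) \<omega> < b" using e by simp
next
  assume ab: "a < running_inf X (T \<omega>) \<omega> \<and> running_sup X (T \<omega>) \<omega> < b"
  obtain B where B: "\<And>s. s \<in> {0..T \<omega>} \<Longrightarrow> \<bar>X s \<omega>\<bar> \<le> B"
    using cadlag_bounded[OF cadlag_paths[OF om] T0] by blast
  define e where "e = min (running_inf X (T \<omega>) \<omega> - a) (b - running_sup X (T \<omega>) \<omega>)"
  have e: "e > 0" using ab by (simp add: e_def)
  have bdd: "bdd_below ((\<lambda>s. X s \<omega>) ` {0..T \<omega>})" "bdd_above ((\<lambda>s. X s \<omega>) ` {0..T \<omega>})"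
    using B by (auto intro!: bdd_belowI2[of _ "- B"] bdd_aboveI2[of _ _ B] simp: abs_le_iff) (metis add.inverse_inverse atLeastAtMost_iff neg_le_iff_le)
  have path: "a + e \<le> X s \<omega>" "X s \<omega> \<le> b - e" if s: "s \<in> {0..T \<omega>}" for s
  proof -
    have "running_inf X (T \<omega>) \<omega> \<le> X s \<omega>" unfolding running_inf_def by (rule cINF_lower[OF bdd(1) s])
    moreover have "X s \<omega> \<le> running_sup X (T \<omega>) \<omega>" unfolding running_sup_def by (rule cSUP_upper[OF s bdd(2)])
    ultimately show "a + e \<le> X s \<omega>" "X s \<omega> \<le> b - e" by (auto simp: e_def)
  qed
  have "eventually (\<lambda>s. dist (X s \<omega>) (X (T \<omega>) \<omega>) < e / 2) (at_right (T \<omega>))"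
    using e by (intro tendstoD right_limit om T0) simp
  then obtain d where d: "T \<omega> < d" "\<And>s. T \<omega> < s \<Longrightarrow> s < d \<Longrightarrow> \<bar>X s \<omega> - X (T \<omega>) \<omega>\<bar> < e / 2"
    unfolding eventually_at_right_field by (auto simp: dist_real_def)
  obtain l where l: "1 / 2 ^ l < d - T \<omega>"
    using real_arch_pow_inv[of "d - T \<omega>" "1 / 2"] d(1) by (auto simp: power_one_over)
  obtain i where i: "1 / (real i + 1) < e / 4"
    using reals_Archimedean[of "e / 4"] e by (auto simp: inverse_eq_divide add.commute)
  have "\<omega> \<in> confined T (inner_interval (b - a) i) (- a) (1 / 2 ^ l)"
    unfolding confined_iff
  proof (intro conjI om allI impI)
    fix m j assume s: "real j / 2 ^ m < T \<omega> + 1 / 2 ^ l"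
    define s where "s = real j / 2 ^ m"
    have s0: "0 \<le> s" by (simp add: s_def)
    have "a + e / 2 \<le> X s \<omega> \<and> X s \<omega> \<le> b - e / 2"
    proof (cases "s \<le> T \<omega>")
      case True then show ?thesis using path[of s] s0 e by auto
    next
      case False
      then have "\<bar>X s \<omega> - X (T \<omega>) \<omega>\<bar> < e / 2" using s l by (intro d(2)) (auto simp: s_def)
      moreover have "a + e \<le> X (T \<omega>) \<omega>" "X (T \<omega>) \<omega> \<le> b - e" using path[of "T \<omega>"] T0 by auto
      ultimately show ?thesis by linarith
    qed
    then show "- a + X (real j / 2 ^ m) \<omega> \<in> inner_interval (b - a) i" using i e by (simp add: inner_interval_def s_def)
  qed
  then show "\<omega> \<in> (\<Union>l. \<Union>i. confined T (inner_interval (b - a) i) (- a) (1 / 2 ^ l))" by blast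
qed

text \<open>The event is, up to a null set, the union of the confinement events delayed by \<open>h = 1 / 2 ^ l\<close>, whose
  probabilities fall short of that of the event without delay by at most \<open>1 - exp (- \<gamma> h)\<close>. Negative
  values of T, for which the extrema are those of the empty set, matter for measurability only.\<close>
lemma prob_extrema_in_interval:
  assumes T: "distributed M lborel T (exponential_density \<gamma>)" and gam: "0 < \<gamma>"
    and ind: "independent_of_process M T X"
  shows "prob {\<omega> \<in> space M. a < running_inf X (T \<omega>) \<omega> \<and> running_sup X (T \<omega>) \<omega> < b}
    = prob (\<Union>i. confined T (inner_interval (b - a) i) (- a) 0)"
proof -
  have Tm[measurable]: "T \<in> borel_measurable M" using distributed_measurable[OF T] by simp
  define D where "D h = (\<Union>i. confined T (inner_interval (b - a) i) (- a) h)" for h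
  have Dm[measurable]: "D h \<in> sets M" for h unfolding D_def
    by (intro sets.countable_UN) (auto intro!: confined_measurable inner_interval_sets)
  have Dmono: "D h \<subseteq> D h'" if "h' \<le> h" for h h'
  proof
    fix \<omega> assume "\<omega> \<in> D h"
    then obtain i where i: "\<omega> \<in> confined T (inner_interval (b - a) i) (- a) h" by (auto simp: D_def)
    have "\<omega> \<in> confined T (inner_interval (b - a) i) (- a) h'"
      unfolding confined_iff
    proof (intro conjI allI impI)
      fix m j assume "real j / 2 ^ m < T \<omega> + h'"
      then have "real j / 2 ^ m < T \<omega> + h" using that by simp
      then show "- a + X (real j / 2 ^ m) \<omega> \<in> inner_interval (b - a) i" using i unfolding confined_iff by blast
    qed (use i in \<open>simp add: confined_iff\<close>)
    then show "\<omega> \<in> D h'" by (auto simp: D_def)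
  qed
  define S where "S = {\<omega> \<in> space M. a < running_inf X (T \<omega>) \<omega> \<and> running_sup X (T \<omega>) \<omega> < b}"
  have iff: "\<omega> \<in> S \<longleftrightarrow> \<omega> \<in> (\<Union>l. D (1 / 2 ^ l))" if "\<omega> \<in> space M" "0 \<le> T \<omega>" for \<omega>
    unfolding S_def D_def using extrema_in_interval_iff[where T = T and \<omega> = \<omega> and a = a and b = b] that by simp
  have "S \<in> sets M"
  proof -
    have nonneg: "S \<inter> {\<omega> \<in> space M. 0 \<le> T \<omega>} = (\<Union>l. D (1 / 2 ^ l)) \<inter> {\<omega> \<in> space M. 0 \<le> T \<omega>}"
      using iff by blast
    have neg: "S \<inter> {\<omega> \<in> space M. T \<omega> < 0} = (if a < Inf {} \<and> Sup {} < b then {\<omega> \<in> space M. T \<omega> < 0} else {})"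
      by (auto simp: S_def running_inf_def running_sup_def)
    have "S = (S \<inter> {\<omega> \<in> space M. 0 \<le> T \<omega>}) \<union> (S \<inter> {\<omega> \<in> space M. T \<omega> < 0})"
      by (auto simp: S_def)
    also have "\<dots> \<in> sets M"
    proof (rule sets.Un)
      show "S \<inter> {\<omega> \<in> space M. 0 \<le> T \<omega>} \<in> sets M"
        unfolding nonneg by (intro sets.Int sets.countable_UN) auto
      show "S \<inter> {\<omega> \<in> space M. T \<omega> < 0} \<in> sets M"
        unfolding neg by (cases "a < Inf {} \<and> Sup {} < b") simp_all
    qed
    finally show ?thesis .
  qed
  have ae: "AE \<omega> in M. 0 < T \<omega>"
  proof -
    have "prob {\<omega> \<in> space M. 0 < T \<omega>} = 1"
      using exponential_distributedD_gt[OF T _ gam, of 0] by simp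
    then show ?thesis by (subst (asm) prob_Collect_eq_1) auto
  qed
  have "prob S = prob (\<Union>l. D (1 / 2 ^ l))"
  proof (rule finite_measure_eq_AE)
    show "AE \<omega> in M. \<omega> \<in> S \<longleftrightarrow> \<omega> \<in> (\<Union>l. D (1 / 2 ^ l))"
      using ae AE_space by eventually_elim (use iff in auto)
  qed (use \<open>S \<in> sets M\<close> in auto)
  moreover have "(\<lambda>l. prob (D (1 / 2 ^ l))) \<longlonglongrightarrow> prob (\<Union>l. D (1 / 2 ^ l))"
  proof (rule finite_Lim_measure_incseq)
    show "incseq (\<lambda>l. D (1 / 2 ^ l))" by (intro incseq_SucI Dmono) (simp add: field_simps)
  qed auto
  moreover have "(\<lambda>l. prob (D (1 / 2 ^ l))) \<longlonglongrightarrow> prob (D 0)"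
  proof (rule tendsto_sandwich)
    have "prob (D 0) - (1 - exp (- \<gamma> * (1 / 2 ^ l))) \<le> prob (D (1 / 2 ^ l))" for l
    proof -
      have "prob (D 0) \<le> prob (D (1 / 2 ^ l)) + (1 - exp (- \<gamma> * (1 / 2 ^ l)))"
        unfolding D_def
      proof (rule LIMSEQ_le)
        show "(\<lambda>i. prob (confined T (inner_interval (b - a) i) (- a) 0)) \<longlonglongrightarrow> prob (\<Union>i. confined T (inner_interval (b - a) i) (- a) 0)"
          by (rule confined_Union_tendsto[OF Tm])
        show "(\<lambda>i. prob (confined T (inner_interval (b - a) i) (- a) (1 / 2 ^ l)) + (1 - exp (- \<gamma> * (1 / 2 ^ l))))
          \<longlonglongrightarrow> prob (\<Union>i. confined T (inner_interval (b - a) i) (- a) (1 / 2 ^ l)) + (1 - exp (- \<gamma> * (1 / 2 ^ l)))"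
          by (intro tendsto_intros confined_Union_tendsto[OF Tm])
      qed (use confined_shift[OF T gam ind inner_interval_sets] in blast)
      then show ?thesis by simp
    qed
    then show "\<forall>\<^sub>F l in sequentially. prob (D 0) - (1 - exp (- \<gamma> * (1 / 2 ^ l))) \<le> prob (D (1 / 2 ^ l))" by simp
    show "\<forall>\<^sub>F l in sequentially. prob (D (1 / 2 ^ l)) \<le> prob (D 0)"
      by (intro always_eventually allI finite_measure_mono Dmono) auto
    show "(\<lambda>l. prob (D 0) - (1 - exp (- \<gamma> * (1 / 2 ^ l)))) \<longlonglongrightarrow> prob (D 0)"
      by real_asymp
  qed simp
  ultimately show ?thesis unfolding S_def[symmetric] D_def[symmetric] by (simp add: LIMSEQ_unique)
qed

end

section \<open>Scale functions\<close>

context spectrally_negative_levy_process begin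

text \<open>The transform of W is \<open>1 / (\<psi> \<theta> - \<gamma>)\<close>, which is \<open>o(1 / \<theta>)\<close>; hence \<open>W 0 = 0\<close>, and W is
  continuous across 0.\<close>
lemma scale_function_facts:
  assumes sig: "0 < \<sigma>" and W: "is_scale_function \<psi> \<gamma> W"
  obtains \<theta>\<^sub>0 where "1 \<le> \<theta>\<^sub>0" "\<And>\<theta>. \<theta> > \<theta>\<^sub>0 \<Longrightarrow> \<psi> \<theta> \<noteq> \<gamma>"
    "\<And>\<theta>. \<theta> > \<theta>\<^sub>0 \<Longrightarrow> integrable lborel (\<lambda>x. exp (- \<theta> * x) * W x)"
    "\<And>\<theta>. \<theta> > \<theta>\<^sub>0 \<Longrightarrow> bilaplace W \<theta> = 1 / (\<psi> \<theta> - \<gamma>)"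
    "continuous_on UNIV W" "W 0 = 0"
proof -
  obtain C where C: "\<And>\<theta>. 1 \<le> \<theta> \<Longrightarrow> \<psi> \<theta> \<ge> \<mu> * \<theta> + \<sigma>\<^sup>2 / 2 * \<theta>\<^sup>2 - C"
    using laplace_exponent_bounds[OF levy_measure] by blast
  define g where "g \<theta> = \<mu> * \<theta> + \<sigma>\<^sup>2 / 2 * \<theta>\<^sup>2 - C - \<gamma>" for \<theta> :: real
  have "filterlim g at_top at_top" unfolding g_def using sig by real_asymp
  then have "eventually (\<lambda>\<theta>. 0 < g \<theta>) at_top" by (rule filterlim_at_top_dense[THEN iffD1, rule_format])
  then obtain N where N: "\<And>\<theta>. N \<le> \<theta> \<Longrightarrow> 0 < g \<theta>" unfolding eventually_at_top_linorder by blast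
  define \<theta>\<^sub>0 where "\<theta>\<^sub>0 = max 1 (max N (right_inverse \<psi> \<gamma>))"
  have neg: "\<And>x. x < 0 \<Longrightarrow> W x = 0" and cont: "continuous_on {0..} W"
    and lap: "\<And>\<theta>. right_inverse \<psi> \<gamma> < \<theta> \<Longrightarrow> has_bochner_integral lborel (\<lambda>x. indicator {0..} x * (exp (- \<theta> * x) * W x)) (1 / (\<psi> \<theta> - \<gamma>))"
    using W unfolding is_scale_function_def by auto
  have ge: "g \<theta> \<le> \<psi> \<theta> - \<gamma>" if "1 \<le> \<theta>" for \<theta> using C[OF that] by (simp add: g_def)
  have gpos: "0 < \<psi> \<theta> - \<gamma>" if "\<theta> > \<theta>\<^sub>0" for \<theta>
    using ge[of \<theta>] N[of \<theta>] that by (auto simp: \<theta>\<^sub>0_def)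
  have lap': "integrable lborel (\<lambda>x. exp (- \<theta> * x) * W x)" "bilaplace W \<theta> = 1 / (\<psi> \<theta> - \<gamma>)" if "\<theta> > \<theta>\<^sub>0" for \<theta>
  proof -
    have "(\<lambda>x. indicator {0..} x * (exp (- \<theta> * x) * W x)) = (\<lambda>x. exp (- \<theta> * x) * W x)"
      using neg by (auto simp: fun_eq_iff indicator_def)
    then show "integrable lborel (\<lambda>x. exp (- \<theta> * x) * W x)" "bilaplace W \<theta> = 1 / (\<psi> \<theta> - \<gamma>)"
      using lap[of \<theta>] that by (auto simp: \<theta>\<^sub>0_def bilaplace_def has_bochner_integral_iff)
  qed
  have W0: "W 0 = 0"
  proof (rule tendsto_bilaplace_zero_initial[OF lap'(1)[of "\<theta>\<^sub>0 + 1"] neg cont])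
    show "((\<lambda>\<theta>. \<theta> * bilaplace W \<theta>) \<longlongrightarrow> 0) at_top"
    proof (rule Lim_null_comparison)
      show "eventually (\<lambda>\<theta>. norm (\<theta> * bilaplace W \<theta>) \<le> \<theta> / g \<theta>) at_top"
        using eventually_gt_at_top[of \<theta>\<^sub>0]
      proof eventually_elim
        case (elim \<theta>)
        then have th: "1 \<le> \<theta>" "0 < g \<theta>" using N[of \<theta>] by (auto simp: \<theta>\<^sub>0_def)
        have "norm (\<theta> * bilaplace W \<theta>) = \<theta> / (\<psi> \<theta> - \<gamma>)"
          using lap'(2)[OF elim] gpos[OF elim] th by simp
        also have "\<dots> \<le> \<theta> / g \<theta>" using th ge[OF th(1)] gpos[OF elim] by (intro divide_left_mono) auto
        finally show ?case .
      qed
      show "((\<lambda>\<theta>. \<theta> / g \<theta>) \<longlongrightarrow> 0) at_top" unfolding g_def using sig by real_asymp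
    qed
  qed simp
  have "continuous_on ({..0} \<union> {0..}) W"
  proof (rule continuous_on_closed_Un)
    show "continuous_on {..0} W"
      using neg W0 by (intro continuous_on_eq[OF continuous_on_const[of _ 0]]) (auto simp: le_less)
  qed (use cont in auto)
  moreover have "{..0} \<union> {0..} = (UNIV :: real set)" by auto
  ultimately have "continuous_on UNIV W" by simp
  show ?thesis
  proof (rule that[of \<theta>\<^sub>0])
    show "1 \<le> \<theta>\<^sub>0" by (simp add: \<theta>\<^sub>0_def)
    show "\<psi> \<theta> \<noteq> \<gamma>" if "\<theta> > \<theta>\<^sub>0" for \<theta> using gpos[OF that] by simp
  qed (fact lap' \<open>continuous_on UNIV W\<close> W0)+
qed

text \<open>The central identity: by continuity, F is uniformly small near its zeros 0 and c, so the error in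
  the mollified estimate disappears in the limit. The coefficients are left free for the sake of
  the two applications, W itself and the combination in the theorem.\<close>
lemma confined_probability:
  assumes T: "distributed M lborel T (exponential_density \<gamma>)" and gam: "0 < \<gamma>"
    and ind: "independent_of_process M T X"
    and sig: "0 < \<sigma>" and W: "is_scale_function \<psi> \<gamma> W"
    and x: "0 < x" "x < c"
    and F_def: "F = (\<lambda>u. \<alpha> * W u - \<beta> * (LINT y:{0..u}|lborel. W y))" and Fc: "F c = 0"
  shows "F x = \<beta> / \<gamma> * prob (\<Union>i. confined T (inner_interval c i) x 0)"
proof -
  obtain \<theta>\<^sub>0 where th0: "1 \<le> \<theta>\<^sub>0" and ne: "\<And>\<theta>. \<theta> > \<theta>\<^sub>0 \<Longrightarrow> \<psi> \<theta> \<noteq> \<gamma>"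
    and Wi: "\<And>\<theta>. \<theta> > \<theta>\<^sub>0 \<Longrightarrow> integrable lborel (\<lambda>x. exp (- \<theta> * x) * W x)"
    and LW: "\<And>\<theta>. \<theta> > \<theta>\<^sub>0 \<Longrightarrow> bilaplace W \<theta> = 1 / (\<psi> \<theta> - \<gamma>)"
    and Wc: "continuous_on UNIV W" and W0: "W 0 = 0"
    using scale_function_facts[OF sig W] by metis
  have neg: "W x = 0" if "x < 0" for x using W that by (simp add: is_scale_function_def)
  have [measurable]: "W \<in> borel_measurable borel" by (rule borel_measurable_continuous_onI[OF Wc])
  define V where "V u = (LINT y:{0..u}|lborel. W y)" for u
  have V_conv: "V u = (LINT w|lborel. W (u + - w) * indicator {0..} w)" for u
  proof -
    have "(LINT y|lborel. W y * indicator {0..} (u - y)) = (LINT w|lborel. W (u + - w) * indicator {0..} w)"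
      using lborel_integral_real_affine[of "-1" "\<lambda>y. W y * indicator {0..} (u - y)" u] by simp
    moreover have "(LINT y|lborel. W y * indicator {0..} (u - y)) = V u"
      unfolding V_def set_lebesgue_integral_def
      by (intro Bochner_Integration.integral_cong) (auto simp: indicator_def neg)
    ultimately show ?thesis by simp
  qed
  have V: "integrable lborel (\<lambda>x. exp (- \<theta> * x) * V x)" "bilaplace V \<theta> = 1 / \<theta> * bilaplace W \<theta>" if th: "\<theta> > \<theta>\<^sub>0" for \<theta>
  proof -
    have e: "integrable lborel (\<lambda>w. exp (\<theta> * - w) * indicator {0..} w)" "(LINT w|lborel. exp (\<theta> * - w) * indicator {0..} w) = 1 / \<theta>"
      using exp_integral_atLeast[of \<theta>] th th0 by auto
    note m = bilaplace_mixture[OF lborel.sigma_finite_measure_axioms _ _ _ e(1) Wi[OF th]]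
    show "integrable lborel (\<lambda>x. exp (- \<theta> * x) * V x)" unfolding V_conv by (rule m(1)) auto
    have "bilaplace (\<lambda>x. LINT w|lborel. W (x + - w) * indicator {0..} w) \<theta> = 1 / \<theta> * bilaplace W \<theta>"
      unfolding e(2)[symmetric] by (rule m(2)) auto
    then show "bilaplace V \<theta> = 1 / \<theta> * bilaplace W \<theta>" by (simp add: V_conv[abs_def])
  qed
  have V_neg: "V u = 0" if "u < 0" for u using that by (simp add: V_def set_lebesgue_integral_def)
  have V_cont: "continuous_on {0..c} V"
  proof -
    have "W integrable_on {0..c}" by (rule integrable_continuous_real) (rule continuous_on_subset[OF Wc], simp)
    then have "continuous_on {0..c} (\<lambda>u. integral {0..u} W)" by (rule indefinite_integral_continuous_1)
    moreover have "integral {0..u} W = V u" for u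
    proof -
      have "set_integrable lborel {0..u} W"
        by (rule borel_integrable_atLeastAtMost') (rule continuous_on_subset[OF Wc], simp)
      then show ?thesis unfolding V_def by (rule set_borel_integral_eq_integral(2)[symmetric])
    qed
    ultimately show ?thesis by simp
  qed
  have V0: "V 0 = 0"
  proof -
    have "V 0 = (LINT y|(lborel :: real measure). (0 :: real))"
      unfolding V_def set_lebesgue_integral_def by (intro Bochner_Integration.integral_cong) (auto simp: indicator_def W0)
    then show ?thesis by simp
  qed
  have F: "F u = \<alpha> * W u - \<beta> * V u" for u by (simp add: F_def V_def)
  have F_neg: "F u = 0" if "u < 0" for u using that by (simp add: F neg V_neg)
  have F_cont: "continuous_on {0..c} F"
    unfolding F[abs_def] by (intro continuous_intros V_cont continuous_on_subset[OF Wc]) simp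
  have F0: "F 0 = 0" by (simp add: F W0 V0)
  have Vm[measurable]: "V \<in> borel_measurable borel"
  proof -
    have "(\<lambda>u. LINT w|lborel. W (u + - w) * indicator {0..} w) \<in> borel_measurable lborel" by measurable
    then show ?thesis by (simp add: V_conv[abs_def])
  qed
  have Fm: "F \<in> borel_measurable borel" unfolding F[abs_def] by measurable
  have F_eq: "exp (- \<theta> * u) * F u = \<alpha> * (exp (- \<theta> * u) * W u) - \<beta> * (exp (- \<theta> * u) * V u)" for \<theta> u
    by (simp add: F algebra_simps)
  have Fi: "integrable lborel (\<lambda>u. exp (- \<theta> * u) * F u)" if "\<theta> > \<theta>\<^sub>0" for \<theta>
    unfolding F_eq by (intro Bochner_Integration.integrable_diff integrable_mult_right Wi V that)
  have LF: "bilaplace F \<theta> = (\<alpha> - \<beta> / \<theta>) / (\<psi> \<theta> - \<gamma>)" if th: "\<theta> > \<theta>\<^sub>0" for \<theta>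
  proof -
    have "bilaplace F \<theta> = \<alpha> * bilaplace W \<theta> - \<beta> * bilaplace V \<theta>"
      unfolding bilaplace_def F_eq using Wi[OF th] V(1)[OF th] by simp
    also have "\<dots> = \<alpha> * (1 / (\<psi> \<theta> - \<gamma>)) - \<beta> * (1 / \<theta> * (1 / (\<psi> \<theta> - \<gamma>)))"
      unfolding V(2)[OF th] LW[OF th] ..
    finally show ?thesis by (simp add: diff_divide_distrib)
  qed
  have Tm: "T \<in> borel_measurable M" using distributed_measurable[OF T] by simp
  define P where "P = prob (\<Union>i. confined T (inner_interval c i) x 0)"
  have lim: "(\<lambda>i. \<bar>F x - \<beta> / \<gamma> * prob (confined T (inner_interval c i) x 0)\<bar>) \<longlonglongrightarrow> \<bar>F x - \<beta> / \<gamma> * P\<bar>"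
    unfolding P_def by (intro tendsto_intros confined_Union_tendsto Tm)
  have bound: "\<bar>F x - \<beta> / \<gamma> * P\<bar> \<le> 0 + e" if e: "0 < e" for e
  proof -
    define \<eta> where "\<eta> = e / 2"
    have eta: "\<eta> > 0" using e by (simp add: \<eta>_def)
    have mod: "\<exists>d>0. \<forall>u\<in>{0..c}. \<bar>u - v\<bar> < d \<longrightarrow> \<bar>F u - F v\<bar> \<le> \<eta>" if "v \<in> {0..c}" for v
      using F_cont that eta unfolding continuous_on_iff dist_real_def by (meson less_imp_le)
    have c0: "0 < c" using x by simp
    obtain d0 where d0: "d0 > 0" "\<And>u. u \<in> {0..c} \<Longrightarrow> \<bar>u - 0\<bar> < d0 \<Longrightarrow> \<bar>F u - F 0\<bar> \<le> \<eta>"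
      using mod[of 0] c0 by auto
    obtain d1 where d1: "d1 > 0" "\<And>u. u \<in> {0..c} \<Longrightarrow> \<bar>u - c\<bar> < d1 \<Longrightarrow> \<bar>F u - F c\<bar> \<le> \<eta>"
      using mod[of c] c0 by auto
    obtain d2 where d2: "d2 > 0" "\<And>u. u \<in> {0..c} \<Longrightarrow> \<bar>u - x\<bar> < d2 \<Longrightarrow> \<bar>F u - F x\<bar> \<le> \<eta>"
      using mod[of x] x by auto
    define d where "d = min (min (d0 / 2) (d1 / 2)) (min (min d2 (x / 2)) (min (c - x) (c / 2)))"
    have d: "d > 0" unfolding d_def using d0(1) d1(1) d2(1) x by (intro min_less_iff_conj[THEN iffD2] conjI) auto
    have dle: "d \<le> d0 / 2" "d \<le> d1 / 2" "d \<le> d2" "d \<le> x / 2" "d \<le> c - x" "d \<le> c / 2"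
      unfolding d_def by (meson min.cobounded1 min.cobounded2 order.trans)+
    have "(\<lambda>i. 1 / (real i + 1)) \<longlonglongrightarrow> 0" by real_asymp
    then have "eventually (\<lambda>i. 1 / (real i + 1) < d) sequentially" using d by (rule order_tendstoD)
    then have ev: "eventually (\<lambda>i. \<bar>F x - \<beta> / \<gamma> * prob (confined T (inner_interval c i) x 0)\<bar> \<le> 0 + e) sequentially"
    proof eventually_elim
      case (elim i)
      define \<epsilon> where "\<epsilon> = 1 / (real i + 1)"
      have eps: "0 < \<epsilon>" "\<epsilon> < d" using elim by (auto simp: \<epsilon>_def)
      have "\<bar>F x - \<beta> / \<gamma> * prob (confined T {2 * \<epsilon>..c - \<epsilon>} x 0)\<bar> \<le> 2 * \<eta>"
      proof (rule mollified_grid_limit[OF T gam ind _ Fm Fi ne LF eps(1)])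
        show "0 \<le> \<theta>\<^sub>0" using th0 by simp
        show "x \<in> {2 * \<epsilon>..c - \<epsilon>}" using eps dle by simp
        show "0 \<le> \<eta>" using eta by simp
        show "\<bar>F u\<bar> \<le> \<eta>" if "u < 2 * \<epsilon>" for u
          using d0(2)[of u] that eps dle F_neg[of u] F0 eta by (cases "u < 0") auto
        show "\<bar>F u\<bar> \<le> \<eta>" if "u \<in> {c - 2 * \<epsilon>..c}" for u
          using d1(2)[of u] that eps dle Fc by auto
        show "\<bar>F u - F x\<bar> \<le> \<eta>" if "u \<in> {x - \<epsilon>..x}" for u
          using d2(2)[of u] that eps dle x by auto
      qed
      then show ?case by (simp add: inner_interval_def \<epsilon>_def \<eta>_def)
    qed
    show ?thesis by (rule tendsto_upperbound[OF lim ev]) simp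
  qed
  have "\<bar>F x - \<beta> / \<gamma> * P\<bar> \<le> 0" by (rule field_le_epsilon[OF bound])
  then show ?thesis by (simp add: P_def)
qed

text \<open>If \<open>W c = 0\<close>, the preceding identity with \<open>\<alpha> = 1\<close> and \<open>\<beta> = 0\<close> makes W vanish on \<open>(0, c)\<close>. Then the
  transform of W decays exponentially, but it is the inverse of a function of quadratic growth.\<close>
lemma scale_function_nonzero:
  assumes T: "distributed M lborel T (exponential_density \<gamma>)" and gam: "0 < \<gamma>"
    and ind: "independent_of_process M T X"
    and sig: "0 < \<sigma>" and W: "is_scale_function \<psi> \<gamma> W" and c: "0 < c"
  shows "W c \<noteq> 0"
proof
  assume Wc: "W c = 0"
  have zero: "W x = 0" if "x < c" for x
  proof -
    consider "x < 0" | "x = 0" | "0 < x" by linarith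
    then show ?thesis
    proof cases
      case 1 then show ?thesis using W by (simp add: is_scale_function_def)
    next
      case 2 then show ?thesis using scale_function_facts[OF sig W] by metis
    next
      case 3
      show ?thesis
        using confined_probability[OF T gam ind sig W 3 that, of W 1 0] Wc by (simp add: fun_eq_iff)
    qed
  qed
  obtain \<theta>\<^sub>0 where th0: "1 \<le> \<theta>\<^sub>0" and ne: "\<And>\<theta>. \<theta> > \<theta>\<^sub>0 \<Longrightarrow> \<psi> \<theta> \<noteq> \<gamma>"
    and Wi: "\<And>\<theta>. \<theta> > \<theta>\<^sub>0 \<Longrightarrow> integrable lborel (\<lambda>x. exp (- \<theta> * x) * W x)"
    and LW: "\<And>\<theta>. \<theta> > \<theta>\<^sub>0 \<Longrightarrow> bilaplace W \<theta> = 1 / (\<psi> \<theta> - \<gamma>)"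
    using scale_function_facts[OF sig W] by metis
  define a where "a = \<theta>\<^sub>0 + 1"
  define B where "B = (LINT x|lborel. \<bar>exp (- a * x) * W x\<bar>)"
  obtain C where C: "0 \<le> C" "\<And>\<theta>. 1 \<le> \<theta> \<Longrightarrow> \<bar>\<psi> \<theta>\<bar> \<le> C * \<theta>\<^sup>2"
    using laplace_exponent_bounds[OF levy_measure] by blast
  have key: "1 \<le> (C * \<theta>\<^sup>2 + \<gamma>) * (exp (- (\<theta> - a) * c) * B)" if th: "\<theta> \<ge> a" for \<theta>
  proof -
    have th': "\<theta> > \<theta>\<^sub>0" "1 \<le> \<theta>" using th th0 by (auto simp: a_def)
    have "\<bar>1 / (\<psi> \<theta> - \<gamma>)\<bar> \<le> exp (- (\<theta> - a) * c) * B"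
      unfolding LW[OF th'(1), symmetric] B_def
      by (rule bilaplace_decay[OF Wi zero th]) (auto simp: a_def)
    then have "1 \<le> \<bar>\<psi> \<theta> - \<gamma>\<bar> * (exp (- (\<theta> - a) * c) * B)"
      using ne[OF th'(1)] by (simp add: pos_divide_le_eq mult.commute)
    also have "\<dots> \<le> (C * \<theta>\<^sup>2 + \<gamma>) * (exp (- (\<theta> - a) * c) * B)"
    proof (rule mult_right_mono)
      show "\<bar>\<psi> \<theta> - \<gamma>\<bar> \<le> C * \<theta>\<^sup>2 + \<gamma>" using C(2)[OF th'(2)] gam by linarith
      show "0 \<le> exp (- (\<theta> - a) * c) * B" by (simp add: B_def)
    qed
    finally show ?thesis .
  qed
  have "((\<lambda>\<theta>. (C * \<theta>\<^sup>2 + \<gamma>) * (exp (- (\<theta> - a) * c) * B)) \<longlongrightarrow> 0) at_top"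
    using c by real_asymp
  then have "(1::real) \<le> 0"
  proof (rule tendsto_lowerbound)
    show "eventually (\<lambda>\<theta>. 1 \<le> (C * \<theta>\<^sup>2 + \<gamma>) * (exp (- (\<theta> - a) * c) * B)) at_top"
      using eventually_ge_at_top[of a] by eventually_elim (rule key)
  qed simp
  then show False by simp
qed

end

theorem mainTheorem6:
  fixes M :: "'a measure" and X :: "real \<Rightarrow> 'a \<Rightarrow> real" and T :: "'a \<Rightarrow> real"
    and \<mu> \<sigma> \<gamma> a b :: real and \<nu> :: "real measure" and W :: "real \<Rightarrow> real"
  assumes "spectrally_negative_levy_process M X \<mu> \<sigma> \<nu>"
    and "\<sigma> > 0"
    and "\<gamma> > 0"
    and "distributed M lborel T (exponential_density \<gamma>)"
    and "independent_of_process M T X"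
    and "is_scale_function (laplace_exponent \<mu> \<sigma> \<nu>) \<gamma> W"
    and "a < 0" and "0 < b"
  shows "measure M {\<omega> \<in> space M. a < running_inf X (T \<omega>) \<omega> \<and> running_sup X (T \<omega>) \<omega> < b} =
      1 - second_scale_function \<gamma> W (- a)
        + (second_scale_function \<gamma> W (b - a) - 1) * (W (- a) / W (b - a))"
proof -
  interpret spectrally_negative_levy_process M X \<mu> \<sigma> \<nu> by (rule assms(1))
  define c where "c = b - a"
  define V where "V u = (LINT y:{0..u}|lborel. W y)" for u
  \<comment> \<open>With this coefficient the combination of W and V vanishes at c.\<close>
  define \<alpha> where "\<alpha> = \<gamma> * V c / W c"
  have c: "0 < c" "0 < - a" "- a < c" using assms(7,8) by (auto simp: c_def)
  have Wc: "W c \<noteq> 0"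
    by (rule scale_function_nonzero[OF assms(4,3,5,2,6) c(1)])
  have Fc: "(\<lambda>u. \<alpha> * W u - \<gamma> * (LINT y:{0..u}|lborel. W y)) c = 0"
    using Wc by (simp add: \<alpha>_def V_def)
  have "prob (\<Union>i. confined T (inner_interval c i) (- a) 0) = \<alpha> * W (- a) - \<gamma> * V (- a)"
    using confined_probability[OF assms(4,3,5,2,6) c(2,3) refl Fc] assms(3) by (simp add: V_def)
  moreover have "\<alpha> * W (- a) = (second_scale_function \<gamma> W (b - a) - 1) * (W (- a) / W (b - a))"
    by (simp add: \<alpha>_def second_scale_function_def c_def V_def)
  moreover have "\<gamma> * V (- a) = second_scale_function \<gamma> W (- a) - 1"
    by (simp add: second_scale_function_def V_def)
  ultimately show ?thesis
    unfolding prob_extrema_in_interval[OF assms(4,3,5)] c_def[symmetric] by linarith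
qed

end
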